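(* Let $\mathscr{PR}:\widehat{\mathsf{GT}}_{\mathsf{NFI}}\to\mathsf{GTSh}^{\heartsuit}$ be the functor that is the identity on objects and sends a morphism $\hat T$ with target $\mathsf{N}$ to the $\mathsf{GT}$-shadow $T_{\mathsf{N}}$; let $\mathscr{A}:\widehat{\mathsf{GT}}_{\mathsf{NFI}}\to\mathsf{Dessin}$ be the contravariant functor that is the identity on objects and is given on morphisms by $\mathscr{A}(\hat T)([\hat\psi])=[\hat\psi\circ\hat T_{\widehat{\mathsf{F}}_2}]$; and let $\mathscr{A}^{sh}:\mathsf{GTSh}^{\heartsuit}\to\mathsf{Dessin}$ be the contravariant functor that is the identity on objects and is given on morphisms by $\mathscr{A}^{sh}([m,f])([\psi])=[\psi^{(m,f)}]$. Then the triangle formed by these (co)functors commutes strictly ("on the nose"): $$\mathscr{A}=\mathscr{A}^{sh}\circ\mathscr{PR}.$$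
   Context: Braid groups. $\mathrm{B}_n$ is the Artin braid group on $n$ strands with standard generators $\sigma_1,\dots,\sigma_{n-1}$; $\mathrm{PB}_n\le \mathrm{B}_n$ is the pure braid group with generators $x_{ij} := \sigma_{j-1}\cdots\sigma_{i+1}\sigma_i^2\sigma_{i+1}^{-1}\cdots\sigma_{j-1}^{-1}$, $1\le i<j\le n$. Set $c := x_{23}x_{12}x_{13}\in \mathrm{PB}_3$; it generates the center of $\mathrm{PB}_3$. The elements $x:=x_{12}$, $y:=x_{23}$ generate a free subgroup of rank 2 in $\mathrm{PB}_3$, which is identified with the free group $\mathsf{F}_2$, and $\mathrm{PB}_3=\mathsf{F}_2\times\langle c\rangle$. $\mathsf{NFI}_{\mathrm{PB}_4}(\mathrm{B}_4)$ is the poset of finite index normal subgroups $\mathsf{N}\unlhd \mathrm{B}_4$ with $\mathsf{N}\le\mathrm{PB}_4$. Hats denote profinite completions. Homomorphisms $\mathrm{PB}_3\to\mathrm{PB}_4$ (values on $x_{12},x_{23},x_{13}$): $\varphi_{123}: x_{12}, x_{23}, x_{13}$; $\varphi_{234}: x_{23}, x_{34}, x_{24}$; $\varphi_{12,3,4}: x_{13}x_{23},\ x_{34},\ x_{14}x_{24}$; $\varphi_{1,23,4}: x_{12}x_{13},\ x_{24}x_{34},\ x_{14}$; $\varphi_{1,2,34}: x_{12},\ x_{23}x_{24},\ x_{13}x_{14}$. For $\mathsf{N}\in\mathsf{NFI}_{\mathrm{PB}_4}(\mathrm{B}_4)$ let $\mathsf{N}_{\mathrm{PB}_3}$ be the intersection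 of the preimages of $\mathsf{N}$ under these five homomorphisms, let $N_{\mathrm{ord}}$ be the least common multiple of the orders of $x_{12}\mathsf{N}_{\mathrm{PB}_3}, x_{23}\mathsf{N}_{\mathrm{PB}_3}, c\,\mathsf{N}_{\mathrm{PB}_3}$ in $\mathrm{PB}_3/\mathsf{N}_{\mathrm{PB}_3}$, and $\mathsf{N}_{\mathsf{F}_2}:=\mathsf{N}_{\mathrm{PB}_3}\cap\mathsf{F}_2$. $\mathsf{GT}$-shadows. A $\mathsf{GT}$-shadow with target $\mathsf{N}$ is a pair $[m,f]:=(m+N_{\mathrm{ord}}\mathbb{Z},\ f\,\mathsf{N}_{\mathrm{PB}_3})$ represented by some $(m,f)\in\mathbb{Z}\times\mathsf{F}_2$ such that: (i) $\sigma_1 x_{12}^m f^{-1}\sigma_2 x_{23}^m f\,\mathsf{N}_{\mathrm{PB}_3} = f^{-1}\sigma_1\sigma_2 x_{12}^{-m}c^m\,\mathsf{N}_{\mathrm{PB}_3}$ and $f^{-1}\sigma_2x_{23}^m f\sigma_1x_{12}^m\,\mathsf{N}_{\mathrm{PB}_3} = \sigma_2\sigma_1x_{23}^{-m}c^m f\,\mathsf{N}_{\mathrm{PB}_3}$ in $\mathrm{B}_3/\mathsf{N}_{\mathrm{PB}_3}$; (ii) $\varphi_{234}(f)\varphi_{1,23,4}(f)\varphi_{123}(f)\,\mathsf{N}=\varphi_{1,2,34}(f)\varphi_{12,3,4}(f)\,\mathsf{N}$ in $\mathrm{PB}_4/\mathsf{N}$; (iii) $2m+1$ is a unit modulo $N_{\mathrm{ord}}$;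 (iv) the homomorphism $\mathrm{PB}_3\to\mathrm{PB}_3/\mathsf{N}_{\mathrm{PB}_3}$, $x_{12}\mapsto x_{12}^{2m+1}\mathsf{N}_{\mathrm{PB}_3}$, $x_{23}\mapsto f^{-1}x_{23}^{2m+1}f\,\mathsf{N}_{\mathrm{PB}_3}$, $c\mapsto c^{2m+1}\mathsf{N}_{\mathrm{PB}_3}$, is onto. $\mathsf{GT}(\mathsf{N})$ is the set of $\mathsf{GT}$-shadows with target $\mathsf{N}$; $[m,f]$ is charming if $f\mathsf{N}_{\mathsf{F}_2}$ lies in the commutator subgroup of $\mathsf{F}_2/\mathsf{N}_{\mathsf{F}_2}$. For $[m,f]\in\mathsf{GT}(\mathsf{N})$ the formulas $\sigma_1\mapsto\sigma_1^{2m+1}\mathsf{N}$, $\sigma_2\mapsto\varphi_{123}(f)^{-1}\sigma_2^{2m+1}\varphi_{123}(f)\mathsf{N}$, $\sigma_3\mapsto\varphi_{12,3,4}(f)^{-1}\sigma_3^{2m+1}\varphi_{12,3,4}(f)\mathsf{N}$ define a homomorphism $\mathrm{B}_4\to\mathrm{B}_4/\mathsf{N}$ with restriction $T^{\mathrm{PB}_4}_{m,f}:\mathrm{PB}_4\to\mathrm{PB}_4/\mathsf{N}$. The source of $[m,f]$ is $\ker(T^{\mathrm{PB}_4}_{m,f})\in\mathsf{NFI}_{\mathrm{PB}_4}(\mathrm{B}_4)$. $\mathsf{GT}$-shadows form a groupoid $\mathsf{GTSh}$ with object set $\mathsf{NFI}_{\mathrm{PB}_4}(\mathrm{B}_4)$;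 morphisms from $\mathsf{N}^{(2)}$ to $\mathsf{N}^{(1)}$ are the $[m,f]\in\mathsf{GT}(\mathsf{N}^{(1)})$ with source $\mathsf{N}^{(2)}$; composition is $[m_1,f_1]\circ[m_2,f_2]=[2m_1m_2+m_1+m_2,\ f_1(x,y)f_2(x^{2m_1+1},f_1^{-1}y^{2m_1+1}f_1)]$. Charming $\mathsf{GT}$-shadows form a subgroupoid $\mathsf{GTSh}^{\heartsuit}$. The group $\widehat{\mathsf{GT}}$. Consider pairs $(\hat m,\hat f)\in\widehat{\mathbb{Z}}\times\widehat{\mathsf{F}}_2$ satisfying the two relations in (i) in $\widehat{\mathrm{B}}_3$ and the relation in (ii) in $\widehat{\mathrm{PB}}_4$ (with $m,f$ replaced by $\hat m,\hat f$ and no quotient). They form a monoid under $(\hat m_1,\hat f_1)\circ(\hat m_2,\hat f_2)=(2\hat m_1\hat m_2+\hat m_1+\hat m_2,\ \hat f_1 E_1(\hat f_2))$, where $E_i$ is the continuous endomorphism of $\widehat{\mathsf{F}}_2$ with $x\mapsto x^{2\hat m_i+1}$, $y\mapsto\hat f_i^{-1}y^{2\hat m_i+1}\hat f_i$. $\widehat{\mathsf{GT}}$ is the group of invertible elements of this monoid (it is known that then $\hat f$ lies in the closure of the commutator subgroup). For $\hat T=(\hat m,\hat f)\in\widehat{\mathsf{GT}}$, $\hat T_{\widehat{\mathsf{F}}_2}$ denotes the continuous automorphism of $\widehat{\mathsf{F}}_2$ with $x\mapsto x^{2\hat m+1}$, $y\mapsto \hat f^{-1}y^{2\hat m+1}\hat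 f$. For $\mathsf{N}\in\mathsf{NFI}_{\mathrm{PB}_4}(\mathrm{B}_4)$, $T_{\mathsf{N}}\in\mathsf{GT}(\mathsf{N})$ is the $\mathsf{GT}$-shadow given by the residue of $\hat m$ modulo $N_{\mathrm{ord}}$ and the image of $\hat f$ in $\mathrm{PB}_3/\mathsf{N}_{\mathrm{PB}_3}$; it is charming. $\widehat{\mathsf{GT}}$ acts on $\mathsf{NFI}_{\mathrm{PB}_4}(\mathrm{B}_4)$ on the right by letting $\mathsf{N}^{\hat T}$ be the source of $T_{\mathsf{N}}$. $\widehat{\mathsf{GT}}_{\mathsf{NFI}}$ is the transformation groupoid: its objects are the elements of $\mathsf{NFI}_{\mathrm{PB}_4}(\mathrm{B}_4)$, morphisms from $\mathsf{N}^{(1)}$ to $\mathsf{N}^{(2)}$ are the $\hat T\in\widehat{\mathsf{GT}}$ with $(\mathsf{N}^{(2)})^{\hat T}=\mathsf{N}^{(1)}$, and composition is the multiplication of $\widehat{\mathsf{GT}}$. Child's drawings. A child's drawing of degree $d$ is an $S_d$-conjugacy class $[\psi]$ of homomorphisms $\psi:\mathsf{F}_2\to S_d$ with transitive image; equivalently, the class $[\hat\psi]$ of the unique continuous extension $\hat\psi:\widehat{\mathsf{F}}_2\to S_d$. It is subordinate to $\mathsf{N}$ if $\mathsf{N}_{\mathsf{F}_2}\le\ker(\psi)$; $\mathsf{Dessin}(\mathsf{N})$ is the set of child's drawings subordinate to $\mathsf{N}$. $\mathsf{Dessin}$ is the category whose objects are the elements of $\mathsf{NFI}_{\mathrm{PB}_4}(\mathrm{B}_4)$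 and whose morphisms from $\mathsf{N}^{(1)}$ to $\mathsf{N}^{(2)}$ are all functions $\mathsf{Dessin}(\mathsf{N}^{(1)})\to\mathsf{Dessin}(\mathsf{N}^{(2)})$. For $[\psi]\in\mathsf{Dessin}(\mathsf{N})$ and $[m,f]\in\mathsf{GT}(\mathsf{N})$, $\psi^{(m,f)}:\mathsf{F}_2\to S_d$ is given by $x\mapsto\psi(x^{2m+1})$, $y\mapsto\psi(f^{-1}y^{2m+1}f)$. *)

theory Defs
  imports "HOL-Algebra.Algebra" "HOL-Analysis.Function_Topology"
begin

section \<open>Presented groups\<close>

text \<open>A word is a list of letters \<open>(s, True)\<close>, standing for \<open>s\<close>, and \<open>(s, False)\<close>,
  standing for the inverse of \<open>s\<close>.\<close>

type_synonym 'a word = "('a \<times> bool) list"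

definition words :: "'a set \<Rightarrow> 'a word set" where
  "words S = lists (S \<times> UNIV)"

inductive_set word_cong :: "'a set \<Rightarrow> ('a word \<times> 'a word) set \<Rightarrow> ('a word \<times> 'a word) set"
  for S :: "'a set" and R :: "('a word \<times> 'a word) set" where
  refl: "w \<in> words S \<Longrightarrow> (w, w) \<in> word_cong S R"
| sym: "(v, w) \<in> word_cong S R \<Longrightarrow> (w, v) \<in> word_cong S R"
| trans: "(u, v) \<in> word_cong S R \<Longrightarrow> (v, w) \<in> word_cong S R \<Longrightarrow> (u, w) \<in> word_cong S R"
| cancel: "u \<in> words S \<Longrightarrow> v \<in> words S \<Longrightarrow> s \<in> S \<Longrightarrow>
    (u @ [(s, b), (s, \<not> b)] @ v, u @ v) \<in> word_cong S R"
| relator: "u \<in> words S \<Longrightarrow> v \<in> words S \<Longrightarrow> (l, r) \<in> R \<Longrightarrow> l \<in> words S \<Longrightarrow> r \<in> words S \<Longrightarrow>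
    (u @ l @ v, u @ r @ v) \<in> word_cong S R"

definition word_class :: "'a set \<Rightarrow> ('a word \<times> 'a word) set \<Rightarrow> 'a word \<Rightarrow> 'a word set" where
  "word_class S R w = word_cong S R `` {w}"

definition presented_group :: "'a set \<Rightarrow> ('a word \<times> 'a word) set \<Rightarrow> 'a word set monoid" where
  "presented_group S R =
    \<lparr> carrier = words S // word_cong S R,
      monoid.mult = (\<lambda>A B. \<Union>a\<in>A. \<Union>b\<in>B. word_class S R (a @ b)),
      one = word_class S R [] \<rparr>"


section \<open>Braid groups and the free group of rank 2\<close>

definition braid_rels :: "nat \<Rightarrow> (nat word \<times> nat word) set" where
  "braid_rels n =
    {([(i, True), (j, True)], [(j, True), (i, True)]) | i j. 1 \<le> i \<and> i + 2 \<le> j \<and> j < n} \<union>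
    {([(i, True), (i + 1, True), (i, True)], [(i + 1, True), (i, True), (i + 1, True)]) | i.
       1 \<le> i \<and> i + 1 < n}"

definition B :: "nat \<Rightarrow> nat word set monoid" where
  "B n = presented_group {1..<n} (braid_rels n)"

definition braid :: "nat \<Rightarrow> nat word \<Rightarrow> nat word set" where
  "braid n w = word_class {1..<n} (braid_rels n) w"

definition sigma :: "nat \<Rightarrow> nat \<Rightarrow> nat word set" where
  "sigma n i = braid n [(i, True)]"

text \<open>The pure braid group is the kernel of the homomorphism to the symmetric group which sends
  the i-th generator to the transposition of i and i + 1.\<close>

definition word_perm :: "nat word \<Rightarrow> nat \<Rightarrow> nat" where
  "word_perm w = foldr (\<lambda>(i, b) p. transpose i (Suc i) \<circ> p) w id"

definition PB :: "nat \<Rightarrow> nat word set set" where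
  "PB n = {g \<in> carrier (B n). \<forall>w\<in>g. word_perm w = id}"

definition PBgrp :: "nat \<Rightarrow> nat word set monoid" where
  "PBgrp n = (B n)\<lparr>carrier := PB n\<rparr>"

definition xgen :: "nat \<Rightarrow> nat \<Rightarrow> nat \<Rightarrow> nat word set" where
  "xgen n i j = braid n
    (map (\<lambda>k. (k, True)) (rev [i+1..<j]) @ [(i, True), (i, True)] @ map (\<lambda>k. (k, False)) [i+1..<j])"

definition cgen :: "nat word set" where
  "cgen = xgen 3 2 3 \<otimes>\<^bsub>B 3\<^esub> xgen 3 1 2 \<otimes>\<^bsub>B 3\<^esub> xgen 3 1 3"

datatype f2gen = GenX | GenY

type_synonym f2 = "f2gen word set"

definition F2 :: "f2 monoid" where
  "F2 = presented_group UNIV {}"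

definition F2x :: f2 where "F2x = word_class UNIV {} [(GenX, True)]"
definition F2y :: f2 where "F2y = word_class UNIV {} [(GenY, True)]"

definition F2_hom :: "('b, 'c) monoid_scheme \<Rightarrow> 'b \<Rightarrow> 'b \<Rightarrow> f2 \<Rightarrow> 'b" where
  "F2_hom H a b = (THE h. h \<in> hom F2 H \<and> h \<in> extensional (carrier F2) \<and> h F2x = a \<and> h F2y = b)"

text \<open>The embedding through which the free group is identified with the subgroup of the pure
  braid group on three strands generated by \<open>x\<^sub>1\<^sub>2\<close> and \<open>x\<^sub>2\<^sub>3\<close>.\<close>

definition iota :: "f2 \<Rightarrow> nat word set" where
  "iota = F2_hom (PBgrp 3) (xgen 3 1 2) (xgen 3 2 3)"


section \<open>The subgroups attached to an object\<close>

definition NFI :: "nat word set set set" where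
  "NFI = {N. N \<lhd> B 4 \<and> N \<subseteq> PB 4 \<and> finite (carrier (B 4 Mod N))}"

text \<open>Arguments: the values on \<open>x\<^sub>1\<^sub>2\<close>, \<open>x\<^sub>2\<^sub>3\<close>, \<open>x\<^sub>1\<^sub>3\<close>.\<close>

definition phi_hom :: "nat word set \<Rightarrow> nat word set \<Rightarrow> nat word set \<Rightarrow> nat word set \<Rightarrow> nat word set" where
  "phi_hom a b d = (THE h. h \<in> hom (PBgrp 3) (PBgrp 4) \<and> h \<in> extensional (PB 3) \<and>
     h (xgen 3 1 2) = a \<and> h (xgen 3 2 3) = b \<and> h (xgen 3 1 3) = d)"

definition phi_123 :: "nat word set \<Rightarrow> nat word set" where
  "phi_123 = phi_hom (xgen 4 1 2) (xgen 4 2 3) (xgen 4 1 3)"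

definition phi_234 :: "nat word set \<Rightarrow> nat word set" where
  "phi_234 = phi_hom (xgen 4 2 3) (xgen 4 3 4) (xgen 4 2 4)"

definition phi_12_3_4 :: "nat word set \<Rightarrow> nat word set" where
  "phi_12_3_4 = phi_hom (xgen 4 1 3 \<otimes>\<^bsub>B 4\<^esub> xgen 4 2 3) (xgen 4 3 4) (xgen 4 1 4 \<otimes>\<^bsub>B 4\<^esub> xgen 4 2 4)"

definition phi_1_23_4 :: "nat word set \<Rightarrow> nat word set" where
  "phi_1_23_4 = phi_hom (xgen 4 1 2 \<otimes>\<^bsub>B 4\<^esub> xgen 4 1 3) (xgen 4 2 4 \<otimes>\<^bsub>B 4\<^esub> xgen 4 3 4) (xgen 4 1 4)"

definition phi_1_2_34 :: "nat word set \<Rightarrow> nat word set" where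
  "phi_1_2_34 = phi_hom (xgen 4 1 2) (xgen 4 2 3 \<otimes>\<^bsub>B 4\<^esub> xgen 4 2 4) (xgen 4 1 3 \<otimes>\<^bsub>B 4\<^esub> xgen 4 1 4)"

definition N_PB3 :: "nat word set set \<Rightarrow> nat word set set" where
  "N_PB3 N = {g \<in> PB 3. phi_123 g \<in> N \<and> phi_234 g \<in> N \<and>
     phi_12_3_4 g \<in> N \<and> phi_1_23_4 g \<in> N \<and> phi_1_2_34 g \<in> N}"

definition N_ord :: "nat word set set \<Rightarrow> nat" where
  "N_ord N = (LCM g \<in> {xgen 3 1 2, xgen 3 2 3, cgen}.
     group.ord (PBgrp 3 Mod N_PB3 N) (N_PB3 N #>\<^bsub>PBgrp 3\<^esub> g))"

definition N_F2 :: "nat word set set \<Rightarrow> f2 set" where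
  "N_F2 N = {f \<in> carrier F2. iota f \<in> N_PB3 N}"


section \<open>The hexagon and pentagon relations\<close>

text \<open>The hexagon relations in a group \<open>G\<close>, for the images \<open>s\<^sub>1\<close>, \<open>s\<^sub>2\<close> of the standard
  generators, with \<open>p\<close>, \<open>q\<close>, \<open>z\<close> the powers of \<open>x\<^sub>1\<^sub>2\<close>, \<open>x\<^sub>2\<^sub>3\<close>, \<open>c\<close> with exponent \<open>m\<close>.\<close>

definition hexagons :: "('a, 'b) monoid_scheme \<Rightarrow> 'a \<Rightarrow> 'a \<Rightarrow> 'a \<Rightarrow> 'a \<Rightarrow> 'a \<Rightarrow> 'a \<Rightarrow> bool" where
  "hexagons G s1 s2 p q z f \<longleftrightarrow>
     s1 \<otimes>\<^bsub>G\<^esub> p \<otimes>\<^bsub>G\<^esub> inv\<^bsub>G\<^esub> f \<otimes>\<^bsub>G\<^esub> s2 \<otimes>\<^bsub>G\<^esub> q \<otimes>\<^bsub>G\<^esub> f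
       = inv\<^bsub>G\<^esub> f \<otimes>\<^bsub>G\<^esub> s1 \<otimes>\<^bsub>G\<^esub> s2 \<otimes>\<^bsub>G\<^esub> inv\<^bsub>G\<^esub> p \<otimes>\<^bsub>G\<^esub> z \<and>
     inv\<^bsub>G\<^esub> f \<otimes>\<^bsub>G\<^esub> s2 \<otimes>\<^bsub>G\<^esub> q \<otimes>\<^bsub>G\<^esub> f \<otimes>\<^bsub>G\<^esub> s1 \<otimes>\<^bsub>G\<^esub> p
       = s2 \<otimes>\<^bsub>G\<^esub> s1 \<otimes>\<^bsub>G\<^esub> inv\<^bsub>G\<^esub> q \<otimes>\<^bsub>G\<^esub> z \<otimes>\<^bsub>G\<^esub> f"

text \<open>The pentagon relation in a group \<open>G\<close>, where \<open>e \<phi>\<close> is the image of \<open>f\<close> induced by \<open>\<phi>\<close>.\<close>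

definition pentagon ::
  "('a, 'b) monoid_scheme \<Rightarrow> ((nat word set \<Rightarrow> nat word set) \<Rightarrow> 'a) \<Rightarrow> bool" where
  "pentagon G e \<longleftrightarrow>
     e phi_234 \<otimes>\<^bsub>G\<^esub> e phi_1_23_4 \<otimes>\<^bsub>G\<^esub> e phi_123 = e phi_1_2_34 \<otimes>\<^bsub>G\<^esub> e phi_12_3_4"


section \<open>GT-shadows\<close>

definition residue_class :: "nat \<Rightarrow> int \<Rightarrow> int set" where
  "residue_class n m = {m + int n * k | k. True}"

type_synonym shadow = "int set \<times> nat word set set"

definition shadow_class :: "nat word set set \<Rightarrow> int \<Rightarrow> f2 \<Rightarrow> shadow" where
  "shadow_class N m f = (residue_class (N_ord N) m, N_PB3 N #>\<^bsub>PBgrp 3\<^esub> iota f)"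

definition is_GT_pair :: "nat word set set \<Rightarrow> int \<Rightarrow> f2 \<Rightarrow> bool" where
  "is_GT_pair N m f \<longleftrightarrow>
     (let K = N_PB3 N; Q = B 3 Mod K; P = PBgrp 3 Mod K;
          q = (\<lambda>g. K #>\<^bsub>B 3\<^esub> g); p = (\<lambda>g. K #>\<^bsub>PBgrp 3\<^esub> g);
          x12 = xgen 3 1 2; x23 = xgen 3 2 3
      in f \<in> carrier F2 \<and>
         hexagons Q (q (sigma 3 1)) (q (sigma 3 2))
           (q x12 [^]\<^bsub>Q\<^esub> m) (q x23 [^]\<^bsub>Q\<^esub> m) (q cgen [^]\<^bsub>Q\<^esub> m) (q (iota f)) \<and>
         pentagon (PBgrp 4 Mod N) (\<lambda>\<phi>. N #>\<^bsub>PBgrp 4\<^esub> \<phi> (iota f)) \<and>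
         (\<exists>k. ((2 * m + 1) * k) mod int (N_ord N) = 1 mod int (N_ord N)) \<and>
         (\<exists>h \<in> hom (PBgrp 3) P.
            h x12 = p x12 [^]\<^bsub>P\<^esub> (2 * m + 1) \<and>
            h x23 = inv\<^bsub>P\<^esub> (p (iota f)) \<otimes>\<^bsub>P\<^esub> p x23 [^]\<^bsub>P\<^esub> (2 * m + 1) \<otimes>\<^bsub>P\<^esub> p (iota f) \<and>
            h cgen = p cgen [^]\<^bsub>P\<^esub> (2 * m + 1) \<and>
            h ` PB 3 = carrier P))"

definition GT :: "nat word set set \<Rightarrow> shadow set" where
  "GT N = {shadow_class N m f | m f. is_GT_pair N m f}"

definition shadow_reps :: "nat word set set \<Rightarrow> shadow \<Rightarrow> (int \<times> f2) set" where
  "shadow_reps N s = {(m, f). f \<in> carrier F2 \<and> shadow_class N m f = s}"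

definition charming :: "nat word set set \<Rightarrow> shadow \<Rightarrow> bool" where
  "charming N s \<longleftrightarrow> (\<exists>(m, f) \<in> shadow_reps N s.
     N_F2 N #>\<^bsub>F2\<^esub> f \<in> derived (F2 Mod N_F2 N) (carrier (F2 Mod N_F2 N)))"

definition T_B4 :: "nat word set set \<Rightarrow> int \<Rightarrow> f2 \<Rightarrow> nat word set \<Rightarrow> nat word set set" where
  "T_B4 N m f =
     (let Q = B 4 Mod N; q = (\<lambda>g. N #>\<^bsub>B 4\<^esub> g);
          F = q (phi_123 (iota f)); F' = q (phi_12_3_4 (iota f))
      in THE h. h \<in> hom (B 4) Q \<and> h \<in> extensional (carrier (B 4)) \<and>
           h (sigma 4 1) = q (sigma 4 1) [^]\<^bsub>Q\<^esub> (2 * m + 1) \<and>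
           h (sigma 4 2) = inv\<^bsub>Q\<^esub> F \<otimes>\<^bsub>Q\<^esub> q (sigma 4 2) [^]\<^bsub>Q\<^esub> (2 * m + 1) \<otimes>\<^bsub>Q\<^esub> F \<and>
           h (sigma 4 3) = inv\<^bsub>Q\<^esub> F' \<otimes>\<^bsub>Q\<^esub> q (sigma 4 3) [^]\<^bsub>Q\<^esub> (2 * m + 1) \<otimes>\<^bsub>Q\<^esub> F')"

definition source :: "nat word set set \<Rightarrow> shadow \<Rightarrow> nat word set set" where
  "source N s = (THE K. \<exists>(m, f) \<in> shadow_reps N s. K = {g \<in> PB 4. T_B4 N m f g = \<one>\<^bsub>B 4 Mod N\<^esub>})"


section \<open>Categories and functors\<close>

text \<open>\<open>Comp c U V W g f\<close> is the composite of \<open>f : U \<rightarrow> V\<close> with \<open>g : V \<rightarrow> W\<close>.  The records carry the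
  data, not the laws.  Functors are kept extensional (\<open>undefined\<close> outside the objects and arrows of
  their domain), so strict equality of functors is equality in the logic; in particular a composite
  has the intended value on an arrow only if the inner functor sends it to an arrow of the right
  hom-set.\<close>

record ('o, 'a) cat_data =
  Ob :: "'o set"
  Arr :: "'o \<Rightarrow> 'o \<Rightarrow> 'a set"
  Idn :: "'o \<Rightarrow> 'a"
  Comp :: "'o \<Rightarrow> 'o \<Rightarrow> 'o \<Rightarrow> 'a \<Rightarrow> 'a \<Rightarrow> 'a"

definition op_cat :: "('o, 'a) cat_data \<Rightarrow> ('o, 'a) cat_data" where
  "op_cat c = \<lparr> Ob = Ob c, Arr = (\<lambda>U V. Arr c V U), Idn = Idn c,
     Comp = (\<lambda>U V W g f. Comp c W V U f g) \<rparr>"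

record ('o1, 'a1, 'o2, 'a2) functor_data =
  fdom :: "('o1, 'a1) cat_data"
  fcod :: "('o2, 'a2) cat_data"
  fob :: "'o1 \<Rightarrow> 'o2"
  farr :: "'o1 \<Rightarrow> 'o1 \<Rightarrow> 'a1 \<Rightarrow> 'a2"

definition functor_comp ::
  "('o2, 'a2, 'o3, 'a3) functor_data \<Rightarrow> ('o1, 'a1, 'o2, 'a2) functor_data \<Rightarrow> ('o1, 'a1, 'o3, 'a3) functor_data"
  (infixr \<open>\<circ>\<^sub>F\<close> 55) where
  "G \<circ>\<^sub>F F = \<lparr> fdom = fdom F, fcod = fcod G,
     fob = (\<lambda>U \<in> Ob (fdom F). fob G (fob F U)),
     farr = (\<lambda>U V. \<lambda>u \<in> Arr (fdom F) U V. farr G (fob F U) (fob F V) (farr F U V u)) \<rparr>"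


section \<open>The groupoid of charming GT-shadows\<close>

definition shadow_comp ::
  "nat word set set \<Rightarrow> nat word set set \<Rightarrow> shadow \<Rightarrow> shadow \<Rightarrow> shadow" where
  "shadow_comp N1 N2 s1 s2 = (THE s. \<exists>(m1, f1) \<in> shadow_reps N1 s1. \<exists>(m2, f2) \<in> shadow_reps N2 s2.
     s = shadow_class N1 (2 * m1 * m2 + m1 + m2)
       (f1 \<otimes>\<^bsub>F2\<^esub> F2_hom F2 (F2x [^]\<^bsub>F2\<^esub> (2 * m1 + 1))
          (inv\<^bsub>F2\<^esub> f1 \<otimes>\<^bsub>F2\<^esub> F2y [^]\<^bsub>F2\<^esub> (2 * m1 + 1) \<otimes>\<^bsub>F2\<^esub> f1) f2))"

definition GTSh_heart :: "(nat word set set, shadow) cat_data" where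
  "GTSh_heart = \<lparr> Ob = NFI,
     Arr = (\<lambda>U V. {s. U \<in> NFI \<and> V \<in> NFI \<and> s \<in> GT V \<and> charming V s \<and> source V s = U}),
     Idn = (\<lambda>U. shadow_class U 0 \<one>\<^bsub>F2\<^esub>),
     Comp = (\<lambda>U V W s1 s2. shadow_comp W V s1 s2) \<rparr>"


section \<open>Profinite completions\<close>

definition fin_normal :: "('a, 'b) monoid_scheme \<Rightarrow> 'a set set" where
  "fin_normal G = {N. N \<lhd> G \<and> finite (carrier (G Mod N))}"

text \<open>The inverse limit of the finite quotients; a coset of \<open>N\<close> is mapped by the transition map to
  the coset of \<open>M\<close> containing it.\<close>

definition profinite :: "('a, 'b) monoid_scheme \<Rightarrow> ('a set \<Rightarrow> 'a set) monoid" where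
  "profinite G =
    \<lparr> carrier = {u \<in> \<Pi>\<^sub>E N \<in> fin_normal G. carrier (G Mod N).
         \<forall>N \<in> fin_normal G. \<forall>M \<in> fin_normal G. N \<subseteq> M \<longrightarrow> u N \<subseteq> u M},
      monoid.mult = (\<lambda>u v. \<lambda>N \<in> fin_normal G. u N \<otimes>\<^bsub>G Mod N\<^esub> v N),
      one = (\<lambda>N \<in> fin_normal G. \<one>\<^bsub>G Mod N\<^esub>) \<rparr>"

definition profinite_top :: "('a, 'b) monoid_scheme \<Rightarrow> ('a set \<Rightarrow> 'a set) topology" where
  "profinite_top G = subtopology
     (product_topology (\<lambda>N. discrete_topology (carrier (G Mod N))) (fin_normal G))
     (carrier (profinite G))"

definition eta :: "('a, 'b) monoid_scheme \<Rightarrow> 'a \<Rightarrow> 'a set \<Rightarrow> 'a set" where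
  "eta G g = (\<lambda>N \<in> fin_normal G. N #>\<^bsub>G\<^esub> g)"

text \<open>The continuous extension of \<open>h : G \<rightarrow> H\<close> to the profinite completion of \<open>G\<close>, where \<open>\<tau>\<close> is the
  topology of \<open>H\<close>.\<close>

definition cont_ext :: "('a, 'b) monoid_scheme \<Rightarrow> ('c, 'd) monoid_scheme \<Rightarrow> 'c topology \<Rightarrow>
    ('a \<Rightarrow> 'c) \<Rightarrow> ('a set \<Rightarrow> 'a set) \<Rightarrow> 'c" where
  "cont_ext G H \<tau> h = (THE k. k \<in> hom (profinite G) H \<and> k \<in> extensional (carrier (profinite G)) \<and>
     continuous_map (profinite_top G) \<tau> k \<and> (\<forall>g \<in> carrier G. k (eta G g) = h g))"

text \<open>Profinite integers as compatible families of residues modulo all \<open>n > 0\<close>.\<close>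

type_synonym zhat = "nat \<Rightarrow> int"

definition Zhat :: "zhat set" where
  "Zhat = {m \<in> extensional {0<..}. (\<forall>n>0. 0 \<le> m n \<and> m n < int n) \<and>
     (\<forall>n k. 0 < k \<and> n dvd k \<longrightarrow> m k mod int n = m n)}"

definition zhat_zero :: zhat where
  "zhat_zero = (\<lambda>n \<in> {0<..}. 0)"

definition zhat_odd :: "zhat \<Rightarrow> zhat" where  \<comment> \<open>\<open>2 m + 1\<close>\<close>
  "zhat_odd m = (\<lambda>n \<in> {0<..}. (2 * m n + 1) mod int n)"

definition zhat_comp :: "zhat \<Rightarrow> zhat \<Rightarrow> zhat" where  \<comment> \<open>\<open>2 m\<^sub>1 m\<^sub>2 + m\<^sub>1 + m\<^sub>2\<close>\<close>
  "zhat_comp m1 m2 = (\<lambda>n \<in> {0<..}. (2 * m1 n * m2 n + m1 n + m2 n) mod int n)"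

text \<open>Powers with profinite exponents: in a finite group \<open>Q\<close> the power is given by the residue of
  the exponent modulo the order of \<open>Q\<close>.\<close>

definition prof_pow :: "('a, 'b) monoid_scheme \<Rightarrow> ('a set \<Rightarrow> 'a set) \<Rightarrow> zhat \<Rightarrow> 'a set \<Rightarrow> 'a set" where
  "prof_pow G u m = (\<lambda>N \<in> fin_normal G. u N [^]\<^bsub>G Mod N\<^esub> m (order (G Mod N)))"


section \<open>The profinite Grothendieck-Teichmueller group\<close>

type_synonym f2hat = "f2 set \<Rightarrow> f2 set"

abbreviation F2hat :: "f2hat monoid" where "F2hat \<equiv> profinite F2"

definition gt_end :: "zhat \<times> f2hat \<Rightarrow> f2hat \<Rightarrow> f2hat" where
  "gt_end = (\<lambda>(m, f). cont_ext F2 F2hat (profinite_top F2)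
     (F2_hom F2hat (prof_pow F2 (eta F2 F2x) (zhat_odd m))
        (inv\<^bsub>F2hat\<^esub> f \<otimes>\<^bsub>F2hat\<^esub> prof_pow F2 (eta F2 F2y) (zhat_odd m) \<otimes>\<^bsub>F2hat\<^esub> f)))"

definition GThat_pairs :: "(zhat \<times> f2hat) set" where
  "GThat_pairs = {(m, f). m \<in> Zhat \<and> f \<in> carrier F2hat \<and>
     hexagons (profinite (B 3)) (eta (B 3) (sigma 3 1)) (eta (B 3) (sigma 3 2))
       (prof_pow (B 3) (eta (B 3) (xgen 3 1 2)) m)
       (prof_pow (B 3) (eta (B 3) (xgen 3 2 3)) m)
       (prof_pow (B 3) (eta (B 3) cgen) m)
       (cont_ext F2 (profinite (B 3)) (profinite_top (B 3)) (\<lambda>g. eta (B 3) (iota g)) f) \<and>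
     pentagon (profinite (PBgrp 4))
       (\<lambda>\<phi>. cont_ext F2 (profinite (PBgrp 4)) (profinite_top (PBgrp 4))
               (\<lambda>g. eta (PBgrp 4) (\<phi> (iota g))) f)}"

definition GThat_monoid :: "(zhat \<times> f2hat) monoid" where
  "GThat_monoid =
    \<lparr> carrier = GThat_pairs,
      monoid.mult = (\<lambda>(m1, f1) (m2, f2). (zhat_comp m1 m2, f1 \<otimes>\<^bsub>F2hat\<^esub> gt_end (m1, f1) f2)),
      one = (zhat_zero, \<one>\<^bsub>F2hat\<^esub>) \<rparr>"

definition GThat :: "(zhat \<times> f2hat) monoid" where
  "GThat = units_of GThat_monoid"

definition shadow_of :: "nat word set set \<Rightarrow> zhat \<times> f2hat \<Rightarrow> shadow" where
  "shadow_of N = (\<lambda>(m, f).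
     (residue_class (N_ord N) (m (N_ord N)),
      cont_ext F2 (PBgrp 3 Mod N_PB3 N) (discrete_topology (carrier (PBgrp 3 Mod N_PB3 N)))
        (\<lambda>g. N_PB3 N #>\<^bsub>PBgrp 3\<^esub> iota g) f))"

definition GThat_NFI :: "(nat word set set, zhat \<times> f2hat) cat_data" where
  "GThat_NFI = \<lparr> Ob = NFI,
     Arr = (\<lambda>U V. {T. U \<in> NFI \<and> V \<in> NFI \<and> T \<in> carrier GThat \<and> source V (shadow_of V T) = U}),
     Idn = (\<lambda>U. \<one>\<^bsub>GThat\<^esub>),
     Comp = (\<lambda>U V W T1 T2. T1 \<otimes>\<^bsub>GThat\<^esub> T2) \<rparr>"


section \<open>Child's drawings\<close>

definition conj_class :: "nat \<Rightarrow> (f2 \<Rightarrow> nat \<Rightarrow> nat) \<Rightarrow> (f2 \<Rightarrow> nat \<Rightarrow> nat) set" where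
  "conj_class d \<psi> = {(\<lambda>g \<in> carrier F2. p \<otimes>\<^bsub>sym_group d\<^esub> \<psi> g \<otimes>\<^bsub>sym_group d\<^esub> inv\<^bsub>sym_group d\<^esub> p) | p.
     p \<in> carrier (sym_group d)}"

text \<open>A child's drawing is recorded together with its degree.\<close>

type_synonym drawing = "nat \<times> (f2 \<Rightarrow> nat \<Rightarrow> nat) set"

definition transitive_hom :: "nat \<Rightarrow> (f2 \<Rightarrow> nat \<Rightarrow> nat) \<Rightarrow> bool" where
  "transitive_hom d \<psi> \<longleftrightarrow> 1 \<le> d \<and> \<psi> \<in> hom F2 (sym_group d) \<and> \<psi> \<in> extensional (carrier F2) \<and>
     (\<forall>i \<in> {1..d}. \<forall>j \<in> {1..d}. \<exists>g \<in> carrier F2. \<psi> g i = j)"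

definition Dessin :: "nat word set set \<Rightarrow> drawing set" where
  "Dessin N = {(d, conj_class d \<psi>) | d \<psi>.
     transitive_hom d \<psi> \<and> N_F2 N \<subseteq> kernel F2 (sym_group d) \<psi>}"

definition Dessin_cat :: "(nat word set set, drawing \<Rightarrow> drawing) cat_data" where
  "Dessin_cat = \<lparr> Ob = NFI,
     Arr = (\<lambda>U V. {F. U \<in> NFI \<and> V \<in> NFI \<and> F \<in> Dessin U \<rightarrow>\<^sub>E Dessin V}),
     Idn = (\<lambda>U. \<lambda>D \<in> Dessin U. D),
     Comp = (\<lambda>U V W G F. compose (Dessin U) G F) \<rparr>"

text \<open>\<open>\<psi>\<^sup>(\<^sup>m\<^sup>,\<^sup>f\<^sup>)\<close>\<close>

definition shadow_twist :: "nat \<Rightarrow> int \<Rightarrow> f2 \<Rightarrow> (f2 \<Rightarrow> nat \<Rightarrow> nat) \<Rightarrow> f2 \<Rightarrow> nat \<Rightarrow> nat" where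
  "shadow_twist d m f \<psi> = F2_hom (sym_group d) (\<psi> (F2x [^]\<^bsub>F2\<^esub> (2 * m + 1)))
     (\<psi> (inv\<^bsub>F2\<^esub> f \<otimes>\<^bsub>F2\<^esub> F2y [^]\<^bsub>F2\<^esub> (2 * m + 1) \<otimes>\<^bsub>F2\<^esub> f))"

definition hat_ext :: "nat \<Rightarrow> (f2 \<Rightarrow> nat \<Rightarrow> nat) \<Rightarrow> f2hat \<Rightarrow> nat \<Rightarrow> nat" where
  "hat_ext d \<psi> = cont_ext F2 (sym_group d) (discrete_topology (carrier (sym_group d))) \<psi>"

text \<open>The actions on classes are defined as the union of the conjugacy classes obtained from all
  representatives, so no representative is chosen.  The class of a continuous homomorphism on the
  completion is recorded by its restriction along \<open>eta F2\<close>.\<close>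

definition shadow_act :: "nat word set set \<Rightarrow> shadow \<Rightarrow> drawing \<Rightarrow> drawing" where
  "shadow_act N s = (\<lambda>(d, C) \<in> Dessin N.
     (d, \<Union>\<psi>\<in>C. \<Union>(m, f)\<in>shadow_reps N s. conj_class d (shadow_twist d m f \<psi>)))"

definition GThat_act :: "nat word set set \<Rightarrow> zhat \<times> f2hat \<Rightarrow> drawing \<Rightarrow> drawing" where
  "GThat_act N T = (\<lambda>(d, C) \<in> Dessin N.
     (d, \<Union>\<psi>\<in>C. conj_class d (\<lambda>g \<in> carrier F2. hat_ext d \<psi> (gt_end T (eta F2 g)))))"


section \<open>The three functors\<close>

text \<open>A contravariant functor to \<open>Dessin_cat\<close> is a functor to its opposite.\<close>

definition PR :: "(nat word set set, zhat \<times> f2hat, nat word set set, shadow) functor_data" where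
  "PR = \<lparr> fdom = GThat_NFI, fcod = GTSh_heart,
     fob = (\<lambda>U \<in> Ob GThat_NFI. U),
     farr = (\<lambda>U V. \<lambda>T \<in> Arr GThat_NFI U V. shadow_of V T) \<rparr>"

definition \<A> :: "(nat word set set, zhat \<times> f2hat, nat word set set, drawing \<Rightarrow> drawing) functor_data" where
  "\<A> = \<lparr> fdom = GThat_NFI, fcod = op_cat Dessin_cat,
     fob = (\<lambda>U \<in> Ob GThat_NFI. U),
     farr = (\<lambda>U V. \<lambda>T \<in> Arr GThat_NFI U V. GThat_act V T) \<rparr>"

definition \<A>sh :: "(nat word set set, shadow, nat word set set, drawing \<Rightarrow> drawing) functor_data" where
  "\<A>sh = \<lparr> fdom = GTSh_heart, fcod = op_cat Dessin_cat,
     fob = (\<lambda>U \<in> Ob GTSh_heart. U),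
     farr = (\<lambda>U V. \<lambda>s \<in> Arr GTSh_heart U V. shadow_act V s) \<rparr>"

end

(*
The three homomorphisms out of PB_3 that double a strand extend to all of B_3 once the doubled
strand is allowed to move: they are the restrictions of a crossed homomorphism B_3 -> B_4 whose
states are the positions of the doubled strand (the other two homomorphisms phi_123 and phi_234 are
the states in which an extra outer strand is added).  Hence N_PB3 is normal of finite index in B_3,
and the relations satisfied by a pair (m, f) in the profinite groups can be evaluated at N_PB3 and
N.  If f0 in F_2 approximates f modulo N_F2, then T_N is represented by (m mod N_ord, f0).  Its
surjectivity comes from the inverse of (m, f), and it is charming because linking numbers turn the
pentagon relation into the vanishing of the exponent sums of f.  Finally a homomorphism psi that
kills N_F2 only sees m modulo N_ord and f modulo N_F2, so both actions move psi to the same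
homomorphism.
*)

theory Submission
  imports Defs "HOL-Analysis.Abstract_Topological_Spaces"
begin

section \<open>Presented groups and transducers\<close>

text \<open>Functors are extensional here, so the strict equality asks for more than equal actions:
  every T_N must be shown to be an arrow of \<open>GTSh_heart\<close>, that is, a charming
  GT-shadow, since otherwise the composite would be \<open>undefined\<close> at that arrow. The
  source condition passes unchanged from one hom-set to the other. The profinite relations can be
  tested only at normal subgroups of finite index in the group where they hold. The hexagons hold in
  the completion of B_3, and normality of \<open>N_PB3 N\<close> in PB_3 alone would not do; this is
  why strand doubling is extended to B_3. \<open>F2_hom\<close>, \<open>phi_hom\<close> and
  \<open>cont_ext\<close> are definite descriptions, so each calls for existence and uniqueness. For
  groups given by generators and relations a single device serves: homomorphisms into a wreath
  product, checked on relators. With strand positions, pairs of positions, or one fixed state it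
  yields permutations, strand doubling, linking numbers and the freeness of F_2; with the six cosets
  of PB_3 as states it yields Schreier rewriting, hence generators and relations of PB_3.\<close>

lemma words_Nil [simp]: "[] \<in> words S"
  by (simp add: words_def)

lemma words_Cons [simp]: "(s, b) # w \<in> words S \<longleftrightarrow> s \<in> S \<and> w \<in> words S"
  by (auto simp: words_def)

lemma words_append [simp]: "u @ v \<in> words S \<longleftrightarrow> u \<in> words S \<and> v \<in> words S"
  by (auto simp: words_def)

lemma words_UNIV [simp]: "w \<in> words UNIV"
  by (simp add: words_def)

lemma word_cong_words: "(u, v) \<in> word_cong S R \<Longrightarrow> u \<in> words S \<and> v \<in> words S"
  by (induction rule: word_cong.induct) auto

lemma word_cong_context:
  assumes "(u, v) \<in> word_cong S R" "a \<in> words S" "b \<in> words S"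
  shows "(a @ u @ b, a @ v @ b) \<in> word_cong S R"
  using assms
proof (induction rule: word_cong.induct)
  case (cancel u v s c)
  then show ?case
    using word_cong.cancel[of "a @ u" S "v @ b" s c R] by simp
next
  case (relator u v l r)
  then show ?case
    using word_cong.relator[of "a @ u" S "v @ b" l r R] by simp
qed (auto intro: word_cong.refl word_cong.sym word_cong.trans)

lemma equiv_word_cong: "equiv (words S) (word_cong S R)"
  by (rule equivI)
    (auto simp: refl_on_def sym_on_def trans_on_def dest: word_cong_words
      intro: word_cong.refl word_cong.sym word_cong.trans)

lemma word_class_eq_iff:
  "u \<in> words S \<Longrightarrow> v \<in> words S \<Longrightarrow> word_class S R u = word_class S R v \<longleftrightarrow> (u, v) \<in> word_cong S R"
  unfolding word_class_def by (rule eq_equiv_class_iff[OF equiv_word_cong])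

lemma word_class_self: "w \<in> words S \<Longrightarrow> w \<in> word_class S R w"
  by (simp add: word_class_def word_cong.refl)

lemma word_class_append_cong:
  assumes "(a', a) \<in> word_cong S R" "(b', b) \<in> word_cong S R"
  shows "word_class S R (a' @ b') = word_class S R (a @ b)"
proof -
  have w: "a' \<in> words S" "a \<in> words S" "b' \<in> words S" "b \<in> words S"
    using assms word_cong_words by blast+
  have "(a' @ b', a @ b') \<in> word_cong S R"
    using word_cong_context[OF assms(1), of "[]" b'] w by simp
  moreover have "(a @ b', a @ b) \<in> word_cong S R"
    using word_cong_context[OF assms(2), of a "[]"] w by simp
  ultimately show ?thesis
    using w word_class_eq_iff word_cong.trans by (metis words_append)
qed

lemma carrier_presented_group:
  "carrier (presented_group S R) = word_class S R ` words S"
  by (auto simp: presented_group_def quotient_def word_class_def)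

lemma word_class_closed [simp]:
  "w \<in> words S \<Longrightarrow> word_class S R w \<in> carrier (presented_group S R)"
  by (simp add: carrier_presented_group)

lemma presented_group_cases [consumes 1]:
  assumes "g \<in> carrier (presented_group S R)"
  obtains w where "w \<in> words S" "g = word_class S R w"
  using assms by (auto simp: carrier_presented_group)

lemma one_presented_group: "\<one>\<^bsub>presented_group S R\<^esub> = word_class S R []"
  by (simp add: presented_group_def)

text \<open>The product is a union over all pairs of representatives; the congruence makes every
  member the same class, and the index sets are nonempty.\<close>

lemma mult_presented_group:
  assumes "a \<in> words S" "b \<in> words S"
  shows "word_class S R a \<otimes>\<^bsub>presented_group S R\<^esub> word_class S R b = word_class S R (a @ b)"
proof -
  have "(\<Union>a'\<in>word_class S R a. \<Union>b'\<in>word_class S R b. word_class S R (a' @ b'))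
      = (\<Union>a'\<in>word_class S R a. \<Union>b'\<in>word_class S R b. word_class S R (a @ b))"
    by (intro SUP_cong refl word_class_append_cong)
      (auto simp: word_class_def intro: word_cong.sym)
  also have "\<dots> = word_class S R (a @ b)"
    using word_class_self assms by blast
  finally show ?thesis by (simp add: presented_group_def)
qed

definition word_inv :: "'a word \<Rightarrow> 'a word" where
  "word_inv w = rev (map (\<lambda>(s, b). (s, \<not> b)) w)"

lemma word_inv_words [simp]: "w \<in> words S \<Longrightarrow> word_inv w \<in> words S"
  by (auto simp: word_inv_def words_def)

lemma word_inv_cancel: "w \<in> words S \<Longrightarrow> (word_inv w @ w, []) \<in> word_cong S R"
proof (induction w)
  case Nil
  then show ?case by (simp add: word_inv_def word_cong.refl)
next
  case (Cons l w)
  obtain s b where l: "l = (s, b)" by force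
  have w: "s \<in> S" "w \<in> words S" using Cons.prems l by auto
  have "(word_inv w @ [(s, \<not> b), (s, \<not> \<not> b)] @ w, word_inv w @ w) \<in> word_cong S R"
    using w by (intro word_cong.cancel) auto
  then show ?case
    using Cons.IH w by (auto simp: word_inv_def l intro: word_cong.trans)
qed

lemma group_presented_group: "group (presented_group S R)"
proof (rule groupI)
  fix x assume "x \<in> carrier (presented_group S R)"
  then obtain w where w: "w \<in> words S" "x = word_class S R w"
    by (rule presented_group_cases)
  have "word_class S R (word_inv w) \<otimes>\<^bsub>presented_group S R\<^esub> x = \<one>\<^bsub>presented_group S R\<^esub>"
    using w word_inv_cancel
    by (simp add: mult_presented_group one_presented_group word_class_eq_iff)
  then show "\<exists>y\<in>carrier (presented_group S R). y \<otimes>\<^bsub>presented_group S R\<^esub> x = \<one>\<^bsub>presented_group S R\<^esub>"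
    using w by (meson word_class_closed word_inv_words)
qed (auto elim!: presented_group_cases simp: mult_presented_group one_presented_group)

lemma inv_letter_presented_group:
  assumes "s \<in> S"
  shows "word_class S R [(s, False)] = inv\<^bsub>presented_group S R\<^esub> word_class S R [(s, True)]"
proof -
  interpret group "presented_group S R" by (rule group_presented_group)
  have "([(s, False), (s, \<not> False)], []) \<in> word_cong S R"
    using word_cong.cancel[of "[]" S "[]" s False R] assms by simp
  then show ?thesis
    using assms
    by (intro inv_equality[symmetric])
      (auto simp: mult_presented_group one_presented_group word_class_eq_iff)
qed

section \<open>Transducers: homomorphisms into wreath products\<close>

fun trans_word :: "('a \<Rightarrow> 'q \<Rightarrow> 'q) \<Rightarrow> 'a word \<Rightarrow> 'q \<Rightarrow> 'q" where
  "trans_word \<delta> [] q = q"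
| "trans_word \<delta> ((s, b) # w) q = trans_word \<delta> w (\<delta> s q)"

text \<open>A letter s^-1 read in q leads to the state from which s returns to q, so it writes the
  inverse of what s writes there. Because every transition will be an involution, that state is
  again \<open>\<delta> s q\<close>, and the sign does not affect the state.\<close>

fun out_word :: "('h, 'm) monoid_scheme \<Rightarrow> ('a \<Rightarrow> 'q \<Rightarrow> 'q) \<Rightarrow> ('a \<Rightarrow> 'q \<Rightarrow> 'h) \<Rightarrow> 'a word \<Rightarrow> 'q \<Rightarrow> 'h" where
  "out_word H \<delta> v [] q = \<one>\<^bsub>H\<^esub>"
| "out_word H \<delta> v ((s, b) # w) q =
     (if b then v s q else inv\<^bsub>H\<^esub> (v s (\<delta> s q))) \<otimes>\<^bsub>H\<^esub> out_word H \<delta> v w (\<delta> s q)"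

lemma trans_word_append [simp]: "trans_word \<delta> (u @ w) q = trans_word \<delta> w (trans_word \<delta> u q)"
  by (induction \<delta> u q rule: trans_word.induct) auto

text \<open>A transducer is a homomorphism from the presented group to the wreath product of \<open>H\<close> with the
  permutations of the states, a letter \<open>s\<close> read in state \<open>q\<close> being written as \<open>v s q\<close>.  All
  transition maps needed below are involutions.\<close>

locale transducer = H: group H
  for H :: "('h, 'm) monoid_scheme" (structure) +
  fixes S :: "'a set" and R :: "('a word \<times> 'a word) set"
    and \<delta> :: "'a \<Rightarrow> 'q \<Rightarrow> 'q" and v :: "'a \<Rightarrow> 'q \<Rightarrow> 'h"
  assumes invol: "s \<in> S \<Longrightarrow> \<delta> s (\<delta> s q) = q"
    and v_closed: "s \<in> S \<Longrightarrow> v s q \<in> carrier H"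
    and trans_relator: "(l, r) \<in> R \<Longrightarrow> l \<in> words S \<Longrightarrow> r \<in> words S \<Longrightarrow> trans_word \<delta> l q = trans_word \<delta> r q"
    and out_relator: "(l, r) \<in> R \<Longrightarrow> l \<in> words S \<Longrightarrow> r \<in> words S \<Longrightarrow> out_word H \<delta> v l q = out_word H \<delta> v r q"
begin

abbreviation "out \<equiv> out_word H \<delta> v"

lemma out_closed [simp]: "w \<in> words S \<Longrightarrow> out w q \<in> carrier H"
  by (induction w arbitrary: q) (auto simp: v_closed)

lemma out_append:
  "u \<in> words S \<Longrightarrow> w \<in> words S \<Longrightarrow> out (u @ w) q = out u q \<otimes> out w (trans_word \<delta> u q)"
  by (induction u arbitrary: q) (auto simp: v_closed H.m_assoc)

text \<open>A cancelling pair writes an element and then its inverse and returns to the state it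
  started from. A relator can occur in any state, which is why the locale assumptions range over all
  states.\<close>

lemma trans_out_cong:
  assumes "(u, w) \<in> word_cong S R"
  shows "trans_word \<delta> u q = trans_word \<delta> w q \<and> out u q = out w q"
  using assms
proof (induction arbitrary: q rule: word_cong.induct)
  case (cancel u w s b)
  have "v s q' \<otimes> (inv (v s q') \<otimes> h) = h" "inv (v s q') \<otimes> (v s q' \<otimes> h) = h" if "h \<in> carrier H" for q' h
    using that v_closed[OF cancel(3)] by (simp_all add: H.m_assoc[symmetric])
  then show ?case
    using cancel by (simp add: out_append invol)
next
  case (relator u w l r)
  then show ?case
    using trans_relator[of l r] out_relator[of l r] by (simp add: out_append)
qed auto

definition run :: "'q \<Rightarrow> 'a word set \<Rightarrow> 'h" where
  "run q g = out (SOME w. w \<in> g) q"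

definition next_state :: "'q \<Rightarrow> 'a word set \<Rightarrow> 'q" where
  "next_state q g = trans_word \<delta> (SOME w. w \<in> g) q"

lemma run_word_class:
  assumes "w \<in> words S"
  shows "run q (word_class S R w) = out w q" "next_state q (word_class S R w) = trans_word \<delta> w q"
proof -
  have "(SOME w'. w' \<in> word_class S R w) \<in> word_class S R w"
    using word_class_self[OF assms] by (rule someI)
  then have "(w, SOME w'. w' \<in> word_class S R w) \<in> word_cong S R"
    by (simp add: word_class_def)
  then show "run q (word_class S R w) = out w q" "next_state q (word_class S R w) = trans_word \<delta> w q"
    by (simp_all add: run_def next_state_def trans_out_cong)
qed

lemma run_closed [simp]: "g \<in> carrier (presented_group S R) \<Longrightarrow> run q g \<in> carrier H"
  by (erule presented_group_cases) (simp add: run_word_class)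

lemma next_state_mult:
  assumes "g \<in> carrier (presented_group S R)" "g' \<in> carrier (presented_group S R)"
  shows "next_state q (g \<otimes>\<^bsub>presented_group S R\<^esub> g') = next_state (next_state q g) g'"
  using assms by (elim presented_group_cases) (simp add: run_word_class mult_presented_group)

text \<open>On a subgroup whose elements fix q this crossed law turns \<open>run q\<close> into a
  homomorphism. Strand doubling, linking numbers and Schreier rewriting become homomorphisms on pure
  braids in this way.\<close>

lemma run_mult:
  assumes "g \<in> carrier (presented_group S R)" "g' \<in> carrier (presented_group S R)"
  shows "run q (g \<otimes>\<^bsub>presented_group S R\<^esub> g') = run q g \<otimes> run (next_state q g) g'"
  using assms by (elim presented_group_cases) (simp add: run_word_class mult_presented_group out_append)

lemma run_one [simp]: "run q \<one>\<^bsub>presented_group S R\<^esub> = \<one>"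
  and next_state_one [simp]: "next_state q \<one>\<^bsub>presented_group S R\<^esub> = q"
  by (simp_all add: one_presented_group run_word_class)

lemma run_inv:
  assumes g: "g \<in> carrier (presented_group S R)"
  shows "run (next_state q g) (inv\<^bsub>presented_group S R\<^esub> g) = inv (run q g)"
proof -
  interpret G: group "presented_group S R" by (rule group_presented_group)
  have "run q g \<otimes> run (next_state q g) (inv\<^bsub>presented_group S R\<^esub> g) = \<one>"
    using g by (simp flip: run_mult)
  then show ?thesis
    using g by (metis G.inv_closed H.inv_equality H.inv_inv H.inv_closed run_closed)
qed

lemma next_state_inv:
  assumes g: "g \<in> carrier (presented_group S R)"
  shows "next_state (next_state q g) (inv\<^bsub>presented_group S R\<^esub> g) = q"
proof -
  interpret G: group "presented_group S R" by (rule group_presented_group)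
  show ?thesis using g by (simp flip: next_state_mult)
qed

end

lemma presented_group_generated:
  assumes "subgroup K (presented_group S R)" "\<And>s. s \<in> S \<Longrightarrow> word_class S R [(s, True)] \<in> K"
  shows "K = carrier (presented_group S R)"
proof -
  interpret K: subgroup K "presented_group S R" by fact
  interpret G: group "presented_group S R" by (rule group_presented_group)
  have "word_class S R w \<in> K" if "w \<in> words S" for w
    using that
  proof (induction w)
    case Nil
    then show ?case using K.one_closed by (simp add: one_presented_group)
  next
    case (Cons l w)
    obtain s b where l: "l = (s, b)" by force
    have "word_class S R [(s, b)] \<in> K"
      using assms(2)[of s] Cons.prems K.m_inv_closed
      by (cases b) (auto simp: l inv_letter_presented_group)
    then have "word_class S R [(s, b)] \<otimes>\<^bsub>presented_group S R\<^esub> word_class S R w \<in> K"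
      using Cons l by (intro K.m_closed) auto
    then show ?case
      using Cons.prems by (simp add: l mult_presented_group)
  qed
  then show ?thesis
    using K.subset by (auto simp: carrier_presented_group)
qed

lemma hom_eq_on_generators:
  assumes "group G" "group H" "h \<in> hom G H" "k \<in> hom G H" "A \<subseteq> carrier G"
    and "\<And>a. a \<in> A \<Longrightarrow> h a = k a" and "generate G A = carrier G" "g \<in> carrier G"
  shows "h g = k g"
proof -
  interpret h: group_hom G H h using assms by (simp add: group_hom_def group_hom_axioms_def)
  interpret k: group_hom G H k using assms by (simp add: group_hom_def group_hom_axioms_def)
  have "g \<in> generate G A" using assms by simp
  then show ?thesis
  proof induction
    case (eng h1 h2)
    then show ?case using assms(5,7) by simp
  qed (use assms(5,6) in auto)
qed

section \<open>Profinite completions\<close>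

lemma (in group) coset_eq_iff:
  assumes "subgroup N G" "a \<in> carrier G" "b \<in> carrier G"
  shows "N #> a = N #> b \<longleftrightarrow> a \<otimes> inv b \<in> N"
proof
  interpret N: subgroup N G by fact
  assume "N #> a = N #> b"
  then have "a \<in> N #> b" using assms rcos_self by blast
  then show "a \<otimes> inv b \<in> N" using assms(3) N.rcos_module_imp is_group by blast
next
  interpret N: subgroup N G by fact
  assume "a \<otimes> inv b \<in> N"
  then have "a \<in> N #> b" using assms N.rcos_module_rev is_group by blast
  then show "N #> a = N #> b" using assms repr_independence by metis
qed

lemma (in group) mem_coset_iff:
  assumes "subgroup N G" "a \<in> carrier G" "b \<in> carrier G"
  shows "a \<in> N #> b \<longleftrightarrow> N #> a = N #> b"
  using assms by (metis rcos_self repr_independence)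

text \<open>F need not be a homomorphism: each of its fibres lies in a single coset of N, so there
  are at most as many cosets as values of F.\<close>

lemma (in group) fin_normalI:
  assumes "N \<lhd> G" "finite (F ` carrier G)"
    and F: "\<And>a b. a \<in> carrier G \<Longrightarrow> b \<in> carrier G \<Longrightarrow> F a = F b \<Longrightarrow> a \<otimes> inv b \<in> N"
  shows "N \<in> fin_normal G"
proof -
  have N: "subgroup N G" using assms(1) normal_imp_subgroup by blast
  have "(\<lambda>a. N #> a) ` carrier G \<subseteq> (\<lambda>x. N #> (SOME a. a \<in> carrier G \<and> F a = x)) ` F ` carrier G"
  proof clarify
    fix a assume a: "a \<in> carrier G"
    let ?b = "SOME b. b \<in> carrier G \<and> F b = F a"
    have "?b \<in> carrier G \<and> F ?b = F a" by (rule someI[of _ a]) (use a in simp)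
    then have "N #> a = N #> ?b"
      using a F N by (subst coset_eq_iff) auto
    then show "N #> a \<in> (\<lambda>x. N #> (SOME a. a \<in> carrier G \<and> F a = x)) ` F ` carrier G"
      using a by blast
  qed
  then have "finite ((\<lambda>a. N #> a) ` carrier G)"
    by (rule finite_subset) (intro finite_imageI assms(2))
  then show ?thesis
    using assms(1) by (simp add: fin_normal_def carrier_FactGroup)
qed

lemma (in group_hom) kernel_fin_normal:
  assumes "finite (h ` carrier G)"
  shows "kernel G H h \<in> fin_normal G"
  by (rule G.fin_normalI[OF normal_kernel assms]) (simp add: kernel_def)

lemma fin_normalD:
  assumes "N \<in> fin_normal G"
  shows "N \<lhd> G" "finite (carrier (G Mod N))" "subgroup N G" "group (G Mod N)"
  using assms normal_imp_subgroup normal.factorgroup_is_group by (auto simp: fin_normal_def)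

lemma (in group) fin_normal_Int:
  assumes "L \<in> fin_normal G" "M \<in> fin_normal G"
  shows "L \<inter> M \<in> fin_normal G"
proof (rule fin_normalI[where F = "\<lambda>a. (L #> a, M #> a)"])
  show "L \<inter> M \<lhd> G" using assms by (simp add: fin_normalD normal_subgroup_intersect)
  have "(\<lambda>a. (L #> a, M #> a)) ` carrier G \<subseteq> carrier (G Mod L) \<times> carrier (G Mod M)"
    by (auto simp: carrier_FactGroup)
  then show "finite ((\<lambda>a. (L #> a, M #> a)) ` carrier G)"
    using assms by (meson fin_normalD(2) finite_SigmaI finite_subset)
qed (use assms in \<open>simp add: coset_eq_iff fin_normalD(3)\<close>)

lemma (in group) fin_normal_carrier: "carrier G \<in> fin_normal G"
proof -
  have "carrier G \<lhd> G"
    by (simp add: normal_inv_iff subgroup_self)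
  then show ?thesis
    by (rule fin_normalI[where F = "\<lambda>_. ()"]) auto
qed

lemma (in group) fin_normal_lower_bound:
  assumes "finite F" "F \<subseteq> fin_normal G"
  shows "\<exists>L\<in>fin_normal G. \<forall>M\<in>F. L \<subseteq> M"
  using assms
proof induction
  case empty
  then show ?case using fin_normal_carrier by auto
next
  case (insert M F)
  then obtain L where "L \<in> fin_normal G" "\<forall>M\<in>F. L \<subseteq> M" by auto
  with insert.prems show ?case by (intro bexI[of _ "L \<inter> M"]) (auto intro: fin_normal_Int)
qed

section \<open>The inverse limit of the finite quotients as a group\<close>

lemma profinite_coset:
  assumes "u \<in> carrier (profinite G)" "N \<in> fin_normal G"
  obtains g where "g \<in> carrier G" "u N = N #>\<^bsub>G\<^esub> g"
  using assms by (force simp: profinite_def carrier_FactGroup PiE_iff)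

lemma (in group) profinite_rep:
  assumes "u \<in> carrier (profinite G)" "N \<in> fin_normal G"
  obtains g where "g \<in> carrier G" "g \<in> u N"
  using assms by (metis fin_normalD(3) profinite_coset rcos_self)

text \<open>An element picked from the coset at L serves at every larger M, because u L lies in u M
  and distinct cosets of M are disjoint. A single approximation therefore handles several quotients
  at once.\<close>

lemma (in group) profinite_mem:
  assumes u: "u \<in> carrier (profinite G)" and "L \<in> fin_normal G" "M \<in> fin_normal G" "L \<subseteq> M" "g \<in> u L"
  shows "u M = M #> g" "g \<in> carrier G"
proof -
  obtain a where a: "a \<in> carrier G" "u L = L #> a" using profinite_coset assms by metis
  obtain b where b: "b \<in> carrier G" "u M = M #> b" using profinite_coset assms by metis
  show g: "g \<in> carrier G"
    using a assms by (metis fin_normalD(3) r_coset_subset_G subgroup.subset subsetD)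
  have "u L \<subseteq> u M" using assms by (simp add: profinite_def)
  then show "u M = M #> g" using assms b g mem_coset_iff fin_normalD(3) by (metis subsetD)
qed

lemma profinite_carrierI:
  assumes "\<And>N. N \<in> fin_normal G \<Longrightarrow> u N \<in> carrier (G Mod N)"
    and "\<And>N M. N \<in> fin_normal G \<Longrightarrow> M \<in> fin_normal G \<Longrightarrow> N \<subseteq> M \<Longrightarrow> u N \<subseteq> u M"
    and "u \<in> extensional (fin_normal G)"
  shows "u \<in> carrier (profinite G)"
  using assms by (auto simp: profinite_def PiE_iff)

lemma profinite_eval_closed [simp]:
  "u \<in> carrier (profinite G) \<Longrightarrow> N \<in> fin_normal G \<Longrightarrow> u N \<in> carrier (G Mod N)"
  by (auto simp: profinite_def PiE_iff)

lemma profinite_mono: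
  "u \<in> carrier (profinite G) \<Longrightarrow> N \<in> fin_normal G \<Longrightarrow> M \<in> fin_normal G \<Longrightarrow> N \<subseteq> M \<Longrightarrow> u N \<subseteq> u M"
  by (auto simp: profinite_def)

lemma mult_profinite: "u \<otimes>\<^bsub>profinite G\<^esub> w = (\<lambda>N \<in> fin_normal G. u N <#>\<^bsub>G\<^esub> w N)"
  by (simp add: profinite_def)

lemma one_profinite: "\<one>\<^bsub>profinite G\<^esub> = (\<lambda>N \<in> fin_normal G. N)"
  by (simp add: profinite_def)

lemma profinite_extensional: "u \<in> carrier (profinite G) \<Longrightarrow> u \<in> extensional (fin_normal G)"
  unfolding profinite_def partial_object.simps PiE_def by blast

lemma profinite_eqI:
  assumes "u \<in> carrier (profinite G)" "w \<in> carrier (profinite G)"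
    and "\<And>N. N \<in> fin_normal G \<Longrightarrow> u N = w N"
  shows "u = w"
  by (rule extensionalityI[OF assms(1,2)[THEN profinite_extensional] assms(3)])

lemma profinite_l_one:
  "u \<in> carrier (profinite G) \<Longrightarrow> N \<in> fin_normal G \<Longrightarrow> N <#>\<^bsub>G\<^esub> u N = u N"
  using group.is_monoid[OF fin_normalD(4), THEN monoid.l_one, of N G "u N"] by simp

lemma profinite_mult_closed:
  assumes "u \<in> carrier (profinite G)" "w \<in> carrier (profinite G)"
  shows "u \<otimes>\<^bsub>profinite G\<^esub> w \<in> carrier (profinite G)"
proof (rule profinite_carrierI)
  fix N assume N: "N \<in> fin_normal G"
  interpret Q: group "G Mod N" using N by (rule fin_normalD)
  have "u N \<otimes>\<^bsub>G Mod N\<^esub> w N \<in> carrier (G Mod N)"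
    using assms N by (intro Q.m_closed) simp_all
  then show "(u \<otimes>\<^bsub>profinite G\<^esub> w) N \<in> carrier (G Mod N)" using N by (simp add: mult_profinite)
qed (use assms in \<open>auto simp: mult_profinite profinite_mono mono_set_mult\<close>)

lemma group_profinite: "group (profinite G)"
proof (rule groupI)
  show "\<one>\<^bsub>profinite G\<^esub> \<in> carrier (profinite G)"
  proof (rule profinite_carrierI)
    fix N assume N: "N \<in> fin_normal G"
    interpret Q: group "G Mod N" using N by (rule fin_normalD)
    show "\<one>\<^bsub>profinite G\<^esub> N \<in> carrier (G Mod N)"
      using Q.one_closed N by (simp add: one_profinite)
  qed (auto simp: one_profinite)
next
  fix u w z
  assume uwz: "u \<in> carrier (profinite G)" "w \<in> carrier (profinite G)" "z \<in> carrier (profinite G)"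
  show "u \<otimes>\<^bsub>profinite G\<^esub> w \<otimes>\<^bsub>profinite G\<^esub> z = u \<otimes>\<^bsub>profinite G\<^esub> (w \<otimes>\<^bsub>profinite G\<^esub> z)"
  proof (rule profinite_eqI)
    fix N assume N: "N \<in> fin_normal G"
    interpret Q: group "G Mod N" using N by (rule fin_normalD)
    show "(u \<otimes>\<^bsub>profinite G\<^esub> w \<otimes>\<^bsub>profinite G\<^esub> z) N = (u \<otimes>\<^bsub>profinite G\<^esub> (w \<otimes>\<^bsub>profinite G\<^esub> z)) N"
      using Q.m_assoc[of "u N" "w N" "z N"] uwz N by (simp add: mult_profinite)
  qed (use uwz profinite_mult_closed in metis)+
next
  fix u assume u: "u \<in> carrier (profinite G)"
  have "\<one>\<^bsub>profinite G\<^esub> \<otimes>\<^bsub>profinite G\<^esub> u = (\<lambda>N\<in>fin_normal G. u N)"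
    unfolding mult_profinite one_profinite by (rule restrict_ext) (simp add: u profinite_l_one)
  then show "\<one>\<^bsub>profinite G\<^esub> \<otimes>\<^bsub>profinite G\<^esub> u = u"
    using profinite_extensional[OF u] by (simp add: extensional_restrict)
  \<comment> \<open>Elementwise inversion of cosets respects inclusions, which makes the family
    compatible; in each quotient it is the group inverse.\<close>
  let ?i = "\<lambda>N\<in>fin_normal G. set_inv\<^bsub>G\<^esub> (u N)"
  have inv: "set_inv\<^bsub>G\<^esub> (u N) = inv\<^bsub>G Mod N\<^esub> (u N)" if "N \<in> fin_normal G" for N
    using that u by (simp add: normal.inv_FactGroup fin_normalD)
  have "?i \<in> carrier (profinite G)"
  proof (rule profinite_carrierI)
    fix N assume N: "N \<in> fin_normal G"
    interpret Q: group "G Mod N" using N by (rule fin_normalD)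
    show "?i N \<in> carrier (G Mod N)" using N u by (simp add: inv)
  next
    fix N M assume "N \<in> fin_normal G" "M \<in> fin_normal G" "N \<subseteq> M"
    then show "?i N \<subseteq> ?i M" using profinite_mono[OF u, of N M] by (auto simp: SET_INV_def)
  qed auto
  moreover have "?i \<otimes>\<^bsub>profinite G\<^esub> u = \<one>\<^bsub>profinite G\<^esub>"
    unfolding mult_profinite one_profinite
  proof (rule restrict_ext)
    fix N assume N: "N \<in> fin_normal G"
    interpret Q: group "G Mod N" using N by (rule fin_normalD)
    show "?i N <#>\<^bsub>G\<^esub> u N = N" using N u Q.l_inv[of "u N"] by (simp add: inv)
  qed
  ultimately show "\<exists>y\<in>carrier (profinite G). y \<otimes>\<^bsub>profinite G\<^esub> u = \<one>\<^bsub>profinite G\<^esub>" by blast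
qed (rule profinite_mult_closed)

lemma profinite_eval_hom:
  "N \<in> fin_normal G \<Longrightarrow> (\<lambda>u. u N) \<in> hom (profinite G) (G Mod N)"
  by (rule homI) (auto simp: mult_profinite)

lemma profinite_eval_group_hom:
  "N \<in> fin_normal G \<Longrightarrow> group_hom (profinite G) (G Mod N) (\<lambda>u. u N)"
  by (simp add: group_hom_def group_hom_axioms_def group_profinite fin_normalD profinite_eval_hom)

lemma (in group) eta_closed [simp]: "g \<in> carrier G \<Longrightarrow> eta G g \<in> carrier (profinite G)"
  by (rule profinite_carrierI)
    (auto simp: eta_def carrier_FactGroup r_coset_def)

lemma (in group) eta_hom: "eta G \<in> hom G (profinite G)"
proof (rule homI)
  fix a b assume "a \<in> carrier G" "b \<in> carrier G"
  then show "eta G (a \<otimes> b) = eta G a \<otimes>\<^bsub>profinite G\<^esub> eta G b"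
    unfolding mult_profinite by (simp add: eta_def) (rule restrict_ext, simp add: normal.rcos_sum fin_normalD)
qed simp

lemma eta_apply: "N \<in> fin_normal G \<Longrightarrow> eta G g N = N #>\<^bsub>G\<^esub> g"
  by (simp add: eta_def)

lemma (in group) mem_eta: "g \<in> carrier G \<Longrightarrow> N \<in> fin_normal G \<Longrightarrow> g \<in> eta G g N"
  by (simp add: eta_apply fin_normalD rcos_self)

section \<open>Density and continuous extension\<close>

lemma topspace_profinite_top [simp]: "topspace (profinite_top G) = carrier (profinite G)"
  by (auto simp: profinite_top_def profinite_def)

lemma Hausdorff_profinite_top: "Hausdorff_space (profinite_top G)"
  unfolding profinite_top_def
  by (intro Hausdorff_space_subtopology) (simp add: Hausdorff_space_product_topology)

text \<open>A basic neighbourhood of u constrains only finitely many quotients. Some normal subgroup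
  of finite index lies below all the corresponding subgroups, and a representative of u there
  satisfies every constraint.\<close>

lemma (in group) eta_dense:
  "profinite_top G closure_of (eta G ` carrier G) = carrier (profinite G)"
proof
  show "carrier (profinite G) \<subseteq> profinite_top G closure_of (eta G ` carrier G)"
  proof
    fix u assume u: "u \<in> carrier (profinite G)"
    have "\<exists>y\<in>eta G ` carrier G. y \<in> T" if uT: "u \<in> T" and T: "openin (profinite_top G) T" for T
    proof -
      obtain T' where T': "openin (product_topology (\<lambda>N. discrete_topology (carrier (G Mod N))) (fin_normal G)) T'"
        "T = T' \<inter> carrier (profinite G)"
        using T by (auto simp: profinite_top_def openin_subtopology)
      then obtain U where fin: "finite {N \<in> fin_normal G. U N \<noteq> carrier (G Mod N)}"
        and uU: "u \<in> PiE (fin_normal G) U" and UT: "PiE (fin_normal G) U \<subseteq> T'"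
        using uT by (force simp: openin_product_topology_alt)
      obtain L where L: "L \<in> fin_normal G" "\<And>M. M \<in> fin_normal G \<Longrightarrow> U M \<noteq> carrier (G Mod M) \<Longrightarrow> L \<subseteq> M"
        using fin_normal_lower_bound[OF fin] by auto
      obtain g where g: "g \<in> carrier G" "g \<in> u L" using profinite_rep[OF u L(1)] .
      have "eta G g M \<in> U M" if M: "M \<in> fin_normal G" for M
      proof (cases "U M = carrier (G Mod M)")
        case True
        then show ?thesis using g M eta_closed profinite_eval_closed by metis
      next
        case False
        then have "u M = M #> g" using profinite_mem[OF u L(1) M L(2)] M g by simp
        then show ?thesis using PiE_mem[OF uU M] M by (simp add: eta_apply)
      qed
      then have "eta G g \<in> PiE (fin_normal G) U" by (simp add: PiE_iff) (simp add: eta_def)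
      then show ?thesis using UT T' g by auto
    qed
    then show "u \<in> profinite_top G closure_of (eta G ` carrier G)"
      using u by (simp add: in_closure_of)
  qed
qed (use closure_of_subset_topspace in force)

text \<open>Continuous maps into a Hausdorff space that agree on the dense image of G are equal, so
  an admissible k is the one described.\<close>

lemma (in group) cont_ext_eqI:
  assumes "k \<in> hom (profinite G) H" "k \<in> extensional (carrier (profinite G))"
    and "continuous_map (profinite_top G) \<tau> k" "Hausdorff_space \<tau>"
    and "\<And>g. g \<in> carrier G \<Longrightarrow> k (eta G g) = h g"
  shows "cont_ext G H \<tau> h = k"
  unfolding cont_ext_def
proof (rule the_equality)
  fix k' assume k': "k' \<in> hom (profinite G) H \<and> k' \<in> extensional (carrier (profinite G)) \<and>
     continuous_map (profinite_top G) \<tau> k' \<and> (\<forall>g \<in> carrier G. k' (eta G g) = h g)"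
  show "k' = k"
  proof (rule extensionalityI)
    fix u assume "u \<in> carrier (profinite G)"
    then have "u \<in> profinite_top G closure_of (eta G ` carrier G)" by (simp add: eta_dense)
    then show "k' u = k u"
      by (rule forall_in_closure_of_eq) (use assms k' in auto)
  qed (use assms k' in auto)
qed (use assms in auto)

text \<open>A homomorphism into a finite group factors through the quotient by its kernel, so one
  coordinate of u determines the extended value.\<close>

definition fin_ext :: "('a, 'b) monoid_scheme \<Rightarrow> ('c, 'd) monoid_scheme \<Rightarrow> ('a \<Rightarrow> 'c) \<Rightarrow> ('a set \<Rightarrow> 'a set) \<Rightarrow> 'c" where
  "fin_ext G H h u = h (SOME g. g \<in> u (kernel G H h))"

text \<open>The kernel may be replaced by any smaller L of finite index: one approximation modulo L
  evaluates the extensions of all homomorphisms that kill L.\<close>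

lemma (in group_hom) fin_ext_eq:
  assumes fin: "finite (carrier H)"
    and u: "u \<in> carrier (profinite G)" and L: "L \<in> fin_normal G" "L \<subseteq> kernel G H h" and g: "g \<in> u L"
  shows "fin_ext G H h u = h g"
proof -
  have "finite (h ` carrier G)" using fin by (meson finite_subset homh hom_carrier)
  then have K: "kernel G H h \<in> fin_normal G" by (rule kernel_fin_normal)
  let ?a = "SOME a. a \<in> u (kernel G H h)"
  have uK: "u (kernel G H h) = kernel G H h #> g" and gG: "g \<in> carrier G"
    using G.profinite_mem[OF u L(1) K L(2) g] by auto
  then have "g \<in> u (kernel G H h)" using K fin_normalD(3) G.rcos_self by blast
  then have a: "?a \<in> u (kernel G H h)" by (rule someI)
  have aG: "?a \<in> carrier G" using G.profinite_mem(2)[OF u K K _ a] by simp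
  have "?a \<otimes> inv g \<in> kernel G H h"
    using a aG gG uK G.mem_coset_iff G.coset_eq_iff K fin_normalD(3) by metis
  then have "h ?a \<otimes>\<^bsub>H\<^esub> inv\<^bsub>H\<^esub> h g = \<one>\<^bsub>H\<^esub>" using aG gG by (simp add: kernel_def)
  then have "h ?a = h g" using aG gG by (metis H.inv_equality H.inv_inv hom_closed H.inv_closed)
  then show ?thesis by (simp add: fin_ext_def)
qed

lemma (in group_hom)
  assumes fin: "finite (carrier H)"
  shows fin_ext_hom: "fin_ext G H h \<in> hom (profinite G) H"
    and fin_ext_eta: "g \<in> carrier G \<Longrightarrow> fin_ext G H h (eta G g) = h g"
    and fin_ext_continuous:
      "continuous_map (profinite_top G) (discrete_topology (carrier H)) (fin_ext G H h)"
proof -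
  have "finite (h ` carrier G)" using fin by (meson finite_subset homh hom_carrier)
  then have K: "kernel G H h \<in> fin_normal G" by (rule kernel_fin_normal)
  show "fin_ext G H h (eta G g) = h g" if "g \<in> carrier G"
    using that K by (intro fin_ext_eq[OF fin _ K]) (auto simp: G.mem_eta)
  show hom: "fin_ext G H h \<in> hom (profinite G) H"
  proof (rule homI)
    fix u assume u: "u \<in> carrier (profinite G)"
    then obtain g where "g \<in> carrier G" "g \<in> u (kernel G H h)" using K G.profinite_rep by metis
    then show "fin_ext G H h u \<in> carrier H" using fin_ext_eq[OF fin u K] by simp
  next
    fix u w assume u: "u \<in> carrier (profinite G)" and w: "w \<in> carrier (profinite G)"
    obtain a where a: "a \<in> carrier G" "a \<in> u (kernel G H h)" using u K G.profinite_rep by metis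
    obtain b where b: "b \<in> carrier G" "b \<in> w (kernel G H h)" using w K G.profinite_rep by metis
    have "a \<otimes> b \<in> (u \<otimes>\<^bsub>profinite G\<^esub> w) (kernel G H h)"
      using a b K by (auto simp: mult_profinite set_mult_def)
    then have "fin_ext G H h (u \<otimes>\<^bsub>profinite G\<^esub> w) = h (a \<otimes> b)"
      using u w by (intro fin_ext_eq[OF fin _ K]) (auto intro: profinite_mult_closed)
    then show "fin_ext G H h (u \<otimes>\<^bsub>profinite G\<^esub> w) = fin_ext G H h u \<otimes>\<^bsub>H\<^esub> fin_ext G H h w"
      using a b fin_ext_eq[OF fin u K _ a(2)] fin_ext_eq[OF fin w K _ b(2)] by simp
  qed
  have proj: "continuous_map (profinite_top G) (discrete_topology (carrier (G Mod kernel G H h)))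
      (\<lambda>u. u (kernel G H h))"
    unfolding profinite_top_def
    by (intro continuous_map_from_subtopology) (rule continuous_map_product_projection[OF K])
  have "openin (profinite_top G) {u \<in> carrier (profinite G). fin_ext G H h u \<in> V}" for V
  proof -
    \<comment> \<open>The value depends on one coordinate only, so the preimage is pulled back along
      a projection onto a discrete space.\<close>
    have "{u \<in> carrier (profinite G). fin_ext G H h u \<in> V}
        = {u \<in> topspace (profinite_top G). u (kernel G H h) \<in>
            {C \<in> carrier (G Mod kernel G H h). h (SOME g. g \<in> C) \<in> V}}"
      using K by (auto simp: fin_ext_def)
    also have "openin (profinite_top G) \<dots>"
      by (rule openin_continuous_map_preimage[OF proj]) auto
    finally show ?thesis .
  qed
  then show "continuous_map (profinite_top G) (discrete_topology (carrier H)) (fin_ext G H h)"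
    using hom by (auto simp: continuous_map_def hom_def)
qed

lemma (in group_hom) cont_ext_finite:
  assumes fin: "finite (carrier H)"
  shows "cont_ext G H (discrete_topology (carrier H)) h = restrict (fin_ext G H h) (carrier (profinite G))"
proof (rule G.cont_ext_eqI)
  show "restrict (fin_ext G H h) (carrier (profinite G)) \<in> hom (profinite G) H"
    using fin_ext_hom[OF fin] profinite_mult_closed by (fastforce simp: hom_def)
  show "continuous_map (profinite_top G) (discrete_topology (carrier H)) (restrict (fin_ext G H h) (carrier (profinite G)))"
    by (rule continuous_map_eq[OF fin_ext_continuous[OF fin]]) simp
qed (use fin_ext_eta[OF fin] in auto)

lemma (in group_hom) cont_ext_finite_hom:
  "finite (carrier H) \<Longrightarrow> cont_ext G H (discrete_topology (carrier H)) h \<in> hom (profinite G) H"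
  using fin_ext_hom profinite_mult_closed by (fastforce simp: hom_def cont_ext_finite)

lemma (in group_hom) cont_ext_finite_eq:
  assumes "finite (carrier H)" "u \<in> carrier (profinite G)" "L \<in> fin_normal G" "L \<subseteq> kernel G H h" "g \<in> u L"
  shows "cont_ext G H (discrete_topology (carrier H)) h u = h g"
  using assms fin_ext_eq by (simp add: cont_ext_finite)

text \<open>A homomorphism into an inverse limit is a compatible family of homomorphisms into finite
  groups, and \<open>fin_ext\<close> extends each component. The last conclusion computes the
  component at M from an approximation modulo any L that h makes trivial at M.\<close>

lemma cont_ext_profinite:
  assumes G: "group G" and h: "h \<in> hom G (profinite H)"
  defines "k \<equiv> cont_ext G (profinite H) (profinite_top H) h"
  shows cont_ext_profinite_hom: "k \<in> hom (profinite G) (profinite H)"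
    and cont_ext_profinite_eta: "\<And>g. g \<in> carrier G \<Longrightarrow> k (eta G g) = h g"
    and cont_ext_profinite_eq: "\<And>u L M g. u \<in> carrier (profinite G) \<Longrightarrow> L \<in> fin_normal G \<Longrightarrow>
      M \<in> fin_normal H \<Longrightarrow> (\<And>a. a \<in> L \<Longrightarrow> h a M = M) \<Longrightarrow> g \<in> u L \<Longrightarrow> k u M = h g M"
proof -
  interpret G: group G by fact
  have gh: "group_hom G (H Mod M) (\<lambda>g. h g M)" if "M \<in> fin_normal H" for M
  proof -
    have "(\<lambda>u. u M) \<circ> h \<in> hom G (H Mod M)"
      using h profinite_eval_hom[OF that] by (rule hom_compose)
    then show ?thesis
      using that G by (simp add: group_hom_def group_hom_axioms_def fin_normalD o_def)
  qed
  define e where "e u = (\<lambda>M\<in>fin_normal H. fin_ext G (H Mod M) (\<lambda>g. h g M) u)" for u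
  have e_eq: "e u M = h g M"
    if "u \<in> carrier (profinite G)" "L \<in> fin_normal G" "M \<in> fin_normal H"
      "\<And>a. a \<in> L \<Longrightarrow> h a M = M" "g \<in> u L" for u L M g
  proof -
    have "L \<subseteq> kernel G (H Mod M) (\<lambda>g. h g M)"
      using that fin_normalD(3)[OF that(2)] by (auto simp: kernel_def subgroup.mem_carrier)
    then show ?thesis
      using that group_hom.fin_ext_eq[OF gh _ that(1,2)] by (simp add: e_def fin_normalD)
  qed
  have e_closed: "e u \<in> carrier (profinite H)" if u: "u \<in> carrier (profinite G)" for u
  proof (rule profinite_carrierI)
    fix M assume M: "M \<in> fin_normal H"
    show "e u M \<in> carrier (H Mod M)"
      using hom_in_carrier[OF group_hom.fin_ext_hom[OF gh[OF M]] u] M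
      by (simp add: e_def fin_normalD)
  next
    fix M M' assume M: "M \<in> fin_normal H" "M' \<in> fin_normal H" "M \<subseteq> M'"
    \<comment> \<open>Two components are compared on an element that represents u modulo both
      kernels and so computes both at once.\<close>
    let ?K = "kernel G (H Mod M) (\<lambda>g. h g M)" and ?K' = "kernel G (H Mod M') (\<lambda>g. h g M')"
    have fin: "finite ((\<lambda>g. h g M) ` carrier G)" "finite ((\<lambda>g. h g M') ` carrier G)"
      using finite_subset[OF hom_carrier[OF group_hom.homh[OF gh]] fin_normalD(2)] M by blast+
    then have K: "?K \<in> fin_normal G" "?K' \<in> fin_normal G"
      using group_hom.kernel_fin_normal gh M by blast+
    then have "?K \<inter> ?K' \<in> fin_normal G" by (rule G.fin_normal_Int)
    moreover obtain g where "g \<in> carrier G" "g \<in> u (?K \<inter> ?K')"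
      using G.profinite_rep[OF u calculation] .
    ultimately have "e u M = h g M" "e u M' = h g M'" "g \<in> carrier G"
      using e_eq[OF u, of "?K \<inter> ?K'"] M by (auto simp: kernel_def)
    then show "e u M \<subseteq> e u M'"
      using M profinite_mono hom_in_carrier[OF h] by metis
  qed (simp add: e_def)
  have e_eta: "e (eta G g) = h g" if g: "g \<in> carrier G" for g
  proof (rule profinite_eqI)
    show "e (eta G g) M = h g M" if M: "M \<in> fin_normal H" for M
      using group_hom.fin_ext_eta[OF gh[OF M] _ g] M by (simp add: e_def fin_normalD)
  qed (use g e_closed hom_in_carrier[OF h] in auto)
  have e_mult: "e (u \<otimes>\<^bsub>profinite G\<^esub> w) = e u \<otimes>\<^bsub>profinite H\<^esub> e w"
    if uw: "u \<in> carrier (profinite G)" "w \<in> carrier (profinite G)" for u w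
  proof (rule profinite_eqI)
    show "e (u \<otimes>\<^bsub>profinite G\<^esub> w) M = (e u \<otimes>\<^bsub>profinite H\<^esub> e w) M" if M: "M \<in> fin_normal H" for M
      using hom_mult[OF group_hom.fin_ext_hom[OF gh[OF M]] uw] M by (simp add: e_def fin_normalD mult_profinite)
  qed (use uw e_closed profinite_mult_closed in metis)+
  have cont: "continuous_map (profinite_top G) (profinite_top H) e"
  proof -
    have "continuous_map (profinite_top G) (discrete_topology (carrier (H Mod M))) (\<lambda>u. e u M)"
      if M: "M \<in> fin_normal H" for M
      using group_hom.fin_ext_continuous[OF gh[OF M]] M by (simp add: e_def fin_normalD)
    then have "continuous_map (profinite_top G)
        (product_topology (\<lambda>N. discrete_topology (carrier (H Mod N))) (fin_normal H)) e"
      by (subst continuous_map_componentwise) (auto simp: e_def)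
    then show ?thesis
      unfolding profinite_top_def[of H] using e_closed by (auto simp: continuous_map_in_subtopology)
  qed
  have k: "k = restrict e (carrier (profinite G))"
    unfolding k_def
  proof (rule G.cont_ext_eqI)
    show "restrict e (carrier (profinite G)) \<in> hom (profinite G) (profinite H)"
      using e_closed e_mult by (auto simp: hom_def profinite_mult_closed)
    show "continuous_map (profinite_top G) (profinite_top H) (restrict e (carrier (profinite G)))"
      by (rule continuous_map_eq[OF cont]) simp
  qed (use e_eta Hausdorff_profinite_top in auto)
  show "k \<in> hom (profinite G) (profinite H)"
    using e_closed e_mult by (auto simp: k hom_def profinite_mult_closed)
  show "k (eta G g) = h g" if "g \<in> carrier G" for g
    using that e_eta by (simp add: k)
  show "k u M = h g M"
    if "u \<in> carrier (profinite G)" "L \<in> fin_normal G" "M \<in> fin_normal H"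
      "\<And>a. a \<in> L \<Longrightarrow> h a M = M" "g \<in> u L" for u L M g
    using e_eq[OF that] that by (simp add: k)
qed

section \<open>Profinite integers as exponents\<close>

lemma zhat_mod: "m \<in> Zhat \<Longrightarrow> 0 < k \<Longrightarrow> n dvd k \<Longrightarrow> m k mod int n = m n"
  by (auto simp: Zhat_def)

lemma zhat_odd_closed: "m \<in> Zhat \<Longrightarrow> zhat_odd m \<in> Zhat"
proof -
  assume m: "m \<in> Zhat"
  have "(2 * m k + 1) mod int k mod int n = (2 * m n + 1) mod int n" if "0 < k" "n dvd k" for n k
  proof -
    have "(2 * m k + 1) mod int k mod int n = (2 * m k + 1) mod int n"
      using that by (simp add: mod_mod_cancel)
    also have "\<dots> = (2 * (m k mod int n) + 1) mod int n"
      by (metis mod_add_left_eq mod_mult_right_eq)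
    finally show ?thesis using zhat_mod[OF m that] by simp
  qed
  then show ?thesis
    by (auto simp: Zhat_def zhat_odd_def dvd_pos_nat)
qed

text \<open>The order of x divides a and b, and both residues reduce to the residue of m modulo that
  order.\<close>

lemma (in group) zhat_pow_eq:
  assumes m: "m \<in> Zhat" and x: "x \<in> carrier G"
    and "x [^] a = \<one>" "x [^] b = \<one>" "0 < a" "0 < (b::nat)"
  shows "x [^] m a = x [^] m b"
proof -
  have d: "ord x dvd a" "ord x dvd b" using assms pow_eq_id by auto
  then have "m a mod int (ord x) = m b mod int (ord x)"
    using m assms by (simp add: zhat_mod)
  then show ?thesis
    using x by (simp add: int_pow_eq mod_eq_dvd_iff dvd_diff_commute)
qed

lemma (in group) FactGroup_pow_eq_one:
  assumes "N \<in> fin_normal G" "g \<in> carrier G"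
  shows "0 < order (G Mod N)" "g [^] order (G Mod N) \<in> N"
proof -
  interpret N: normal N G using assms(1) by (rule fin_normalD)
  interpret Q: group "G Mod N" by (rule N.factorgroup_is_group)
  show "0 < order (G Mod N)" using assms fin_normalD(2) Q.order_gt_0_iff_finite by blast
  have "(N #> g) [^]\<^bsub>G Mod N\<^esub> order (G Mod N) = N"
    using Q.pow_order_eq_1[of "N #> g"] assms by (simp add: carrier_FactGroup)
  then have "N #> (g [^] order (G Mod N)) = N" using assms N.FactGroup_pow by simp
  then show "g [^] order (G Mod N) \<in> N"
    using assms by (metis N.subgroup_axioms nat_pow_closed rcos_self)
qed

text \<open>\<open>prof_pow\<close> takes the residue of m modulo the order of the quotient. Here it
  is exchanged for the residue modulo any annihilating exponent k, later
  \<open>N_ord N\<close>.\<close>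

lemma (in group) prof_pow_eta_eq:
  assumes m: "m \<in> Zhat" and N: "N \<in> fin_normal G" and g: "g \<in> carrier G" "g [^] k \<in> N" "0 < (k::nat)"
  shows "prof_pow G (eta G g) m N = N #> (g [^] m k)"
proof -
  interpret N: normal N G using N by (rule fin_normalD)
  interpret Q: group "G Mod N" by (rule N.factorgroup_is_group)
  have "(N #> g) [^]\<^bsub>G Mod N\<^esub> m (order (G Mod N)) = (N #> g) [^]\<^bsub>G Mod N\<^esub> m k"
    using g FactGroup_pow_eq_one[OF N] m
    by (intro Q.zhat_pow_eq) (auto simp: carrier_FactGroup N.FactGroup_pow coset_join2 N.subgroup_axioms)
  then show ?thesis
    using g N by (simp add: prof_pow_def eta_apply N.FactGroup_int_pow)
qed

lemma (in group) prof_pow_closed: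
  assumes "m \<in> Zhat" "g \<in> carrier G"
  shows "prof_pow G (eta G g) m \<in> carrier (profinite G)"
proof (rule profinite_carrierI)
  fix N assume N: "N \<in> fin_normal G"
  show "prof_pow G (eta G g) m N \<in> carrier (G Mod N)"
    using prof_pow_eta_eq[OF assms(1) N assms(2) _ _] FactGroup_pow_eq_one[OF N assms(2)] assms(2)
    by (auto simp: carrier_FactGroup)
next
  fix N M assume NM: "N \<in> fin_normal G" "M \<in> fin_normal G" "N \<subseteq> M"
  \<comment> \<open>The order of the finer quotient annihilates g in both quotients, so both powers
    can use the same exponent.\<close>
  let ?k = "order (G Mod N)"
  have "prof_pow G (eta G g) m N = N #> (g [^] m ?k)" "prof_pow G (eta G g) m M = M #> (g [^] m ?k)"
    using prof_pow_eta_eq[OF assms(1) _ assms(2)] FactGroup_pow_eq_one[OF NM(1) assms(2)] NM by blast+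
  then show "prof_pow G (eta G g) m N \<subseteq> prof_pow G (eta G g) m M"
    using NM by (auto simp: r_coset_def)
qed (simp add: prof_pow_def)

section \<open>Braid groups\<close>

text \<open>Keeps the index 1 from becoming \<open>Suc 0\<close>, so that equations about
  \<open>sigma 4 1\<close> or \<open>xgen 3 1 2\<close> keep matching.\<close>

declare One_nat_def [simp del]

lemma (in group) cancel_left [simp]:
  assumes "x \<in> carrier G" "z \<in> carrier G"
  shows "x \<otimes> (inv x \<otimes> z) = z" "inv x \<otimes> (x \<otimes> z) = z"
  using assms by (simp_all flip: m_assoc)

section \<open>Consequences of a braid relation in an arbitrary group\<close>

context group
begin

context
  fixes a b
  assumes ab: "a \<in> carrier G" "b \<in> carrier G" "a \<otimes> (b \<otimes> a) = b \<otimes> (a \<otimes> b)"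
begin

text \<open>The tail z allows rewriting inside right-associated products; the two conjugation rules
  that follow carry it for the same reason.\<close>

lemma braid_assoc: "z \<in> carrier G \<Longrightarrow> a \<otimes> (b \<otimes> (a \<otimes> z)) = b \<otimes> (a \<otimes> (b \<otimes> z))"
  using ab by (metis m_assoc m_closed)

lemma braid_conj: "z \<in> carrier G \<Longrightarrow> b \<otimes> (a \<otimes> (inv b \<otimes> z)) = inv a \<otimes> (b \<otimes> (a \<otimes> z))"
proof -
  assume z: "z \<in> carrier G"
  have "inv a \<otimes> (a \<otimes> (b \<otimes> (a \<otimes> (inv b \<otimes> z)))) = inv a \<otimes> (b \<otimes> (a \<otimes> (b \<otimes> (inv b \<otimes> z))))"
    using z ab by (subst braid_assoc) auto
  then show ?thesis using z ab by simp
qed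

lemma braid_conj': "z \<in> carrier G \<Longrightarrow> inv b \<otimes> (a \<otimes> (b \<otimes> z)) = a \<otimes> (b \<otimes> (inv a \<otimes> z))"
proof -
  assume z: "z \<in> carrier G"
  have "inv b \<otimes> (b \<otimes> (a \<otimes> (b \<otimes> (inv a \<otimes> z)))) = inv b \<otimes> (a \<otimes> (b \<otimes> (a \<otimes> (inv a \<otimes> z))))"
    using z ab by (subst braid_assoc[symmetric]) auto
  then show ?thesis using z ab by simp
qed

lemma braid_inv: "inv a \<otimes> (inv b \<otimes> inv a) = inv b \<otimes> (inv a \<otimes> inv b)"
proof -
  have "inv (a \<otimes> (b \<otimes> a)) = inv (b \<otimes> (a \<otimes> b))" by (simp only: ab(3))
  then show ?thesis using ab(1,2) by (simp add: inv_mult_group m_assoc)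
qed

text \<open>The braid relation says b a b^-1 = a^-1 b a, and this is its square: the passage between
  the two usual words for x_13.\<close>

lemma braid_square_conj: "b \<otimes> (a \<otimes> (a \<otimes> (inv b))) = inv a \<otimes> (b \<otimes> (b \<otimes> a))"
proof -
  have "b \<otimes> (a \<otimes> (a \<otimes> inv b)) = b \<otimes> (a \<otimes> (inv b \<otimes> (b \<otimes> (a \<otimes> (inv b \<otimes> \<one>)))))"
    using ab by simp
  also have "\<dots> = b \<otimes> (a \<otimes> (inv b \<otimes> (inv a \<otimes> (b \<otimes> a))))"
    using ab by (subst (2) braid_conj) auto
  also have "\<dots> = inv a \<otimes> (b \<otimes> (b \<otimes> a))"
    using ab by (subst braid_conj) auto
  finally show ?thesis .
qed

lemma braid_square_conj_assoc:
  "z \<in> carrier G \<Longrightarrow> b \<otimes> (a \<otimes> (a \<otimes> (inv b \<otimes> z))) = inv a \<otimes> (b \<otimes> (b \<otimes> (a \<otimes> z)))"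
  using braid_square_conj ab by (simp flip: m_assoc)

end

end

section \<open>Artin braid groups\<close>

lemma B_group [simp]: "group (B n)"
  by (simp add: B_def group_presented_group)

interpretation B: group "B n" for n
  by simp

lemma braid_closed [simp]: "w \<in> words {1..<n} \<Longrightarrow> braid n w \<in> carrier (B n)"
  by (simp add: B_def braid_def)

lemma braid_append:
  "u \<in> words {1..<n} \<Longrightarrow> w \<in> words {1..<n} \<Longrightarrow> braid n (u @ w) = braid n u \<otimes>\<^bsub>B n\<^esub> braid n w"
  by (simp add: B_def braid_def mult_presented_group)

lemma braid_Nil: "braid n [] = \<one>\<^bsub>B n\<^esub>"
  by (simp add: B_def braid_def one_presented_group)

lemma sigma_closed [simp]: "1 \<le> k \<Longrightarrow> k < n \<Longrightarrow> sigma n k \<in> carrier (B n)"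
  by (simp add: sigma_def)

lemma braid_Cons:
  assumes "k \<in> {1..<n}" "w \<in> words {1..<n}"
  shows "braid n ((k, b) # w) = (if b then sigma n k else inv\<^bsub>B n\<^esub> sigma n k) \<otimes>\<^bsub>B n\<^esub> braid n w"
  using assms braid_append[of "[(k, b)]" n w] inv_letter_presented_group[of k "{1..<n}" "braid_rels n"]
  by (auto simp: sigma_def braid_def B_def)

lemma braid_singleton:
  assumes "k \<in> {1..<n}"
  shows "braid n [(k, b)] = (if b then sigma n k else inv\<^bsub>B n\<^esub> sigma n k)"
  using braid_Cons[OF assms, of "[]" b] assms by (auto simp: braid_Nil)

lemma braid_eq_of_rel:
  assumes "(l, r) \<in> braid_rels n" "l \<in> words {1..<n}" "r \<in> words {1..<n}"
  shows "braid n l = braid n r"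
  using word_cong.relator[of "[]" "{1..<n}" "[]" l r "braid_rels n"] assms
  by (simp add: braid_def word_class_eq_iff)

lemma sigma_braid:
  assumes "1 \<le> k" "k + 1 < n"
  shows "sigma n k \<otimes>\<^bsub>B n\<^esub> (sigma n (k + 1) \<otimes>\<^bsub>B n\<^esub> sigma n k)
       = sigma n (k + 1) \<otimes>\<^bsub>B n\<^esub> (sigma n k \<otimes>\<^bsub>B n\<^esub> sigma n (k + 1))"
proof -
  have "braid n [(k, True), (k + 1, True), (k, True)] = braid n [(k + 1, True), (k, True), (k + 1, True)]"
    using assms by (intro braid_eq_of_rel) (auto simp: braid_rels_def)
  then show ?thesis using assms by (simp add: braid_Cons braid_Nil)
qed

lemma sigma_commute:
  assumes "1 \<le> i" "i + 2 \<le> j" "j < n"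
  shows "sigma n i \<otimes>\<^bsub>B n\<^esub> sigma n j = sigma n j \<otimes>\<^bsub>B n\<^esub> sigma n i"
proof -
  have "braid n [(i, True), (j, True)] = braid n [(j, True), (i, True)]"
    using assms by (intro braid_eq_of_rel) (auto simp: braid_rels_def)
  then show ?thesis using assms by (simp add: braid_Cons braid_Nil)
qed

lemma braid_rels_3: "braid_rels 3 =
    {([(1, True), (2, True), (1, True)], [(2, True), (1, True), (2, True)])}"
  by (auto simp: braid_rels_def)

lemma braid_rels_4: "braid_rels 4 =
    {([(1, True), (3, True)], [(3, True), (1, True)]),
     ([(1, True), (2, True), (1, True)], [(2, True), (1, True), (2, True)]),
     ([(2, True), (3, True), (2, True)], [(3, True), (2, True), (3, True)])}"
proof -
  have rel: "1 \<le> i \<and> i + 2 \<le> j \<and> j < 4 \<longleftrightarrow> i = 1 \<and> j = 3" "1 \<le> i \<and> i + 1 < 4 \<longleftrightarrow> i = 1 \<or> i = 2" for i j :: nat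
    by auto
  show ?thesis unfolding braid_rels_def rel by auto
qed

section \<open>Permutations and pure braids\<close>

abbreviation swap :: "nat \<Rightarrow> nat \<Rightarrow> nat" where
  "swap k \<equiv> Transposition.transpose k (Suc k)"

text \<open>The output is constantly zero, so all information sits in the states, which follow the
  position of a strand.\<close>

interpretation pos: transducer integer_group "{1..<n}" "braid_rels n" swap "\<lambda>_ _. 0" for n
proof (intro transducer.intro transducer_axioms.intro group_integer_group)
  fix l r q assume "(l, r) \<in> braid_rels n"
  then show "trans_word swap l q = trans_word swap r q"
    "out_word integer_group swap (\<lambda>_ _. 0) l q = out_word integer_group swap (\<lambda>_ _. 0) r q"
    by (auto simp: braid_rels_def Transposition.transpose_def)
qed auto

text \<open>\<open>word_perm\<close> applies the transpositions from the last letter to the first,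
  hence inverts the reading of the word from left to right.\<close>

lemma word_perm_trans_word: "word_perm w (trans_word swap w q) = q"
  by (induction swap w q rule: trans_word.induct) (auto simp: word_perm_def)

lemma word_perm_eq_id_iff: "word_perm w = id \<longleftrightarrow> (\<forall>q. trans_word swap w q = q)"
proof
  assume w: "\<forall>q. trans_word swap w q = q"
  show "word_perm w = id"
  proof
    show "word_perm w q = id q" for q using word_perm_trans_word[of w q] w by simp
  qed
qed (metis word_perm_trans_word id_apply)

text \<open>\<open>PB\<close> speaks of all words in a class, but congruent words move the states
  alike. As a state condition, purity inherits closure and normality from the laws for
  \<open>next_state\<close>.\<close>

lemma PB_iff: "g \<in> PB n \<longleftrightarrow> g \<in> carrier (B n) \<and> (\<forall>q. pos.next_state q g = q)"
proof (cases "g \<in> carrier (B n)")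
  case True
  then obtain w where w: "w \<in> words {1..<n}" "g = word_class {1..<n} (braid_rels n) w"
    unfolding B_def by (rule presented_group_cases)
  have "word_perm w' = id \<longleftrightarrow> word_perm w = id" if "w' \<in> g" for w'
  proof -
    have "(w, w') \<in> word_cong {1..<n} (braid_rels n)"
      using that by (simp add: w(2) word_class_def)
    then have "trans_word swap w q = trans_word swap w' q" for q
      by (rule pos.trans_out_cong[THEN conjunct1])
    then show ?thesis by (simp add: word_perm_eq_id_iff)
  qed
  moreover have "w \<in> g" using w word_class_self by blast
  ultimately have "g \<in> PB n \<longleftrightarrow> word_perm w = id"
    unfolding PB_def using True by blast
  moreover have "pos.next_state q g = trans_word swap w q" for q
    unfolding w(2) by (rule pos.run_word_class(2)[OF w(1)])
  ultimately show ?thesis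
    using True by (simp add: word_perm_eq_id_iff)
qed (simp add: PB_def)

lemma PB_subset: "PB n \<subseteq> carrier (B n)"
  by (auto simp: PB_def)

lemma PBD: "g \<in> PB n \<Longrightarrow> g \<in> carrier (B n)" "g \<in> PB n \<Longrightarrow> pos.next_state q g = q"
  by (auto simp: PB_iff)

lemma pos_mult:
  "g \<in> carrier (B n) \<Longrightarrow> h \<in> carrier (B n) \<Longrightarrow>
    pos.next_state q (g \<otimes>\<^bsub>B n\<^esub> h) = pos.next_state (pos.next_state q g) h"
  unfolding B_def by (rule pos.next_state_mult)

lemma pos_inv:
  "g \<in> carrier (B n) \<Longrightarrow> pos.next_state (pos.next_state q g) (inv\<^bsub>B n\<^esub> g) = q"
  unfolding B_def by (rule pos.next_state_inv)

lemma pos_one: "pos.next_state q \<one>\<^bsub>B n\<^esub> = q"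
  unfolding B_def by (rule pos.next_state_one)

lemma PB_subgroup: "subgroup (PB n) (B n)"
proof
  fix g assume g: "g \<in> PB n"
  have "pos.next_state q (inv\<^bsub>B n\<^esub> g) = q" for q
    using pos_inv[OF PBD(1)[OF g], of q] by (simp only: PBD(2)[OF g])
  then show "inv\<^bsub>B n\<^esub> g \<in> PB n"
    using PBD(1)[OF g] by (simp add: PB_iff)
next
  show "\<one>\<^bsub>B n\<^esub> \<in> PB n" by (simp add: PB_iff pos_one)
qed (use PB_subset in \<open>auto simp: PB_iff pos_mult\<close>)

lemma PB_normal: "PB n \<lhd> B n"
  unfolding B.normal_inv_iff
proof (intro conjI ballI PB_subgroup)
  fix x h assume x: "x \<in> carrier (B n)" and h: "h \<in> PB n"
  have "pos.next_state q (x \<otimes>\<^bsub>B n\<^esub> h \<otimes>\<^bsub>B n\<^esub> inv\<^bsub>B n\<^esub> x) = q" for q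
    using x PBD[OF h] by (simp add: pos_mult pos_inv)
  then show "x \<otimes>\<^bsub>B n\<^esub> h \<otimes>\<^bsub>B n\<^esub> inv\<^bsub>B n\<^esub> x \<in> PB n"
    using x PBD(1)[OF h] by (simp add: PB_iff)
qed

lemma PBgrp_group [simp]: "group (PBgrp n)"
  unfolding PBgrp_def by (rule subgroup.subgroup_is_group[OF PB_subgroup]) simp

interpretation PB: group "PBgrp n" for n
  by simp

lemma PBgrp_simps [simp]:
  "carrier (PBgrp n) = PB n" "x \<otimes>\<^bsub>PBgrp n\<^esub> y = x \<otimes>\<^bsub>B n\<^esub> y" "\<one>\<^bsub>PBgrp n\<^esub> = \<one>\<^bsub>B n\<^esub>"
  "N #>\<^bsub>PBgrp n\<^esub> x = N #>\<^bsub>B n\<^esub> x" "N <#>\<^bsub>PBgrp n\<^esub> M = N <#>\<^bsub>B n\<^esub> M"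
  by (auto simp: PBgrp_def r_coset_def set_mult_def)

lemma inv_PBgrp [simp]: "x \<in> PB n \<Longrightarrow> inv\<^bsub>PBgrp n\<^esub> x = inv\<^bsub>B n\<^esub> x"
  unfolding PBgrp_def by (rule B.m_inv_consistent[OF PB_subgroup])

lemma pos_braid: "w \<in> words {1..<n} \<Longrightarrow> pos.next_state q (braid n w) = trans_word swap w q"
  unfolding braid_def by (rule pos.run_word_class)

lemma braid_PB: "w \<in> words {1..<n} \<Longrightarrow> word_perm w = id \<Longrightarrow> braid n w \<in> PB n"
  by (simp only: PB_iff pos_braid word_perm_eq_id_iff braid_closed) blast

lemma xgen_braid:
  "xgen n 1 2 = braid n [(1, True), (1, True)]"
  "xgen n 2 3 = braid n [(2, True), (2, True)]"
  "xgen n 3 4 = braid n [(3, True), (3, True)]"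
  "xgen n 1 3 = braid n [(2, True), (1, True), (1, True), (2, False)]"
  "xgen n 2 4 = braid n [(3, True), (2, True), (2, True), (3, False)]"
  "xgen n 1 4 = braid n [(3, True), (2, True), (1, True), (1, True), (2, False), (3, False)]"
  by (simp_all add: xgen_def upt_rec numeral_eq_Suc One_nat_def)

lemma xgen_3:
  "xgen 3 1 2 = sigma 3 1 \<otimes>\<^bsub>B 3\<^esub> sigma 3 1"
  "xgen 3 2 3 = sigma 3 2 \<otimes>\<^bsub>B 3\<^esub> sigma 3 2"
  "xgen 3 1 3 = sigma 3 2 \<otimes>\<^bsub>B 3\<^esub> (sigma 3 1 \<otimes>\<^bsub>B 3\<^esub> (sigma 3 1 \<otimes>\<^bsub>B 3\<^esub> inv\<^bsub>B 3\<^esub> sigma 3 2))"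
  by (simp_all add: xgen_braid braid_Cons braid_Nil)

lemma xgen_4:
  "xgen 4 1 2 = sigma 4 1 \<otimes>\<^bsub>B 4\<^esub> sigma 4 1"
  "xgen 4 2 3 = sigma 4 2 \<otimes>\<^bsub>B 4\<^esub> sigma 4 2"
  "xgen 4 3 4 = sigma 4 3 \<otimes>\<^bsub>B 4\<^esub> sigma 4 3"
  "xgen 4 1 3 = sigma 4 2 \<otimes>\<^bsub>B 4\<^esub> (sigma 4 1 \<otimes>\<^bsub>B 4\<^esub> (sigma 4 1 \<otimes>\<^bsub>B 4\<^esub> inv\<^bsub>B 4\<^esub> sigma 4 2))"
  "xgen 4 2 4 = sigma 4 3 \<otimes>\<^bsub>B 4\<^esub> (sigma 4 2 \<otimes>\<^bsub>B 4\<^esub> (sigma 4 2 \<otimes>\<^bsub>B 4\<^esub> inv\<^bsub>B 4\<^esub> sigma 4 3))"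
  "xgen 4 1 4 = sigma 4 3 \<otimes>\<^bsub>B 4\<^esub> (sigma 4 2 \<otimes>\<^bsub>B 4\<^esub> (sigma 4 1 \<otimes>\<^bsub>B 4\<^esub> (sigma 4 1 \<otimes>\<^bsub>B 4\<^esub>
     (inv\<^bsub>B 4\<^esub> sigma 4 2 \<otimes>\<^bsub>B 4\<^esub> inv\<^bsub>B 4\<^esub> sigma 4 3))))"
  by (simp_all add: xgen_braid braid_Cons braid_Nil)

lemma xgen_3_PB [simp]: "xgen 3 1 2 \<in> PB 3" "xgen 3 2 3 \<in> PB 3" "xgen 3 1 3 \<in> PB 3"
  by (auto intro!: braid_PB simp: xgen_braid word_perm_eq_id_iff Transposition.transpose_def)

lemma xgen_4_PB [simp]: "xgen 4 1 2 \<in> PB 4" "xgen 4 2 3 \<in> PB 4" "xgen 4 3 4 \<in> PB 4"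
  "xgen 4 1 3 \<in> PB 4" "xgen 4 2 4 \<in> PB 4" "xgen 4 1 4 \<in> PB 4"
  by (auto intro!: braid_PB simp: xgen_braid word_perm_eq_id_iff Transposition.transpose_def)

lemma cgen_PB [simp]: "cgen \<in> PB 3"
  unfolding cgen_def by (simp add: subgroup.m_closed[OF PB_subgroup])

lemma B_generated:
  assumes "subgroup K (B n)" "\<And>k. 1 \<le> k \<Longrightarrow> k < n \<Longrightarrow> sigma n k \<in> K"
  shows "K = carrier (B n)"
  using presented_group_generated[of K "{1..<n}" "braid_rels n"] assms
  by (auto simp: B_def sigma_def braid_def)

text \<open>The full twist. Writing x_13 as sigma_1^-1 sigma_2^2 sigma_1 cancels against x_12 and
  leaves b b a b b a, which the braid relation turns into (b a)^3.\<close>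

lemma cgen_eq: "cgen = sigma 3 2 \<otimes>\<^bsub>B 3\<^esub> (sigma 3 1 \<otimes>\<^bsub>B 3\<^esub> (sigma 3 2 \<otimes>\<^bsub>B 3\<^esub>
    (sigma 3 1 \<otimes>\<^bsub>B 3\<^esub> (sigma 3 2 \<otimes>\<^bsub>B 3\<^esub> sigma 3 1))))"
proof -
  define a b where "a = sigma 3 1" "b = sigma 3 2"
  have ab: "a \<in> carrier (B 3)" "b \<in> carrier (B 3)"
    "a \<otimes>\<^bsub>B 3\<^esub> (b \<otimes>\<^bsub>B 3\<^esub> a) = b \<otimes>\<^bsub>B 3\<^esub> (a \<otimes>\<^bsub>B 3\<^esub> b)"
    using sigma_braid[of 1 3] by (auto simp: a_b_def)
  note assoc = B.braid_assoc[OF ab] 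
  have "cgen = b \<otimes>\<^bsub>B 3\<^esub> (b \<otimes>\<^bsub>B 3\<^esub> (a \<otimes>\<^bsub>B 3\<^esub> (b \<otimes>\<^bsub>B 3\<^esub> (b \<otimes>\<^bsub>B 3\<^esub> a))))"
    using ab by (simp add: cgen_def xgen_3 B.m_assoc B.braid_square_conj[OF ab] flip: a_b_def)
  also have "\<dots> = b \<otimes>\<^bsub>B 3\<^esub> (a \<otimes>\<^bsub>B 3\<^esub> (b \<otimes>\<^bsub>B 3\<^esub> (a \<otimes>\<^bsub>B 3\<^esub> (b \<otimes>\<^bsub>B 3\<^esub> a))))"
    using ab assoc[of "b \<otimes>\<^bsub>B 3\<^esub> a"] by simp
  finally show ?thesis by (simp add: a_b_def)
qed

text \<open>The full twist is both (b a)^3 and (a b)^3, so a (b a)^3 = (a b)^3 a and b (a b)^3 = (b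
  a)^3 b. Both generators thus lie in its centralizer, which is a subgroup.\<close>

lemma cgen_central: "g \<in> carrier (B 3) \<Longrightarrow> g \<otimes>\<^bsub>B 3\<^esub> cgen = cgen \<otimes>\<^bsub>B 3\<^esub> g"
proof -
  define a b where "a = sigma 3 1" "b = sigma 3 2"
  have ab: "a \<in> carrier (B 3)" "b \<in> carrier (B 3)"
    "a \<otimes>\<^bsub>B 3\<^esub> (b \<otimes>\<^bsub>B 3\<^esub> a) = b \<otimes>\<^bsub>B 3\<^esub> (a \<otimes>\<^bsub>B 3\<^esub> b)"
    using sigma_braid[of 1 3] by (auto simp: a_b_def)
  note assoc = B.braid_assoc[OF ab] 
  have c: "cgen = b \<otimes>\<^bsub>B 3\<^esub> (a \<otimes>\<^bsub>B 3\<^esub> (b \<otimes>\<^bsub>B 3\<^esub> (a \<otimes>\<^bsub>B 3\<^esub> (b \<otimes>\<^bsub>B 3\<^esub> a))))"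
    by (simp add: cgen_eq a_b_def)
  have c_alt: "cgen = a \<otimes>\<^bsub>B 3\<^esub> (b \<otimes>\<^bsub>B 3\<^esub> (a \<otimes>\<^bsub>B 3\<^esub> (b \<otimes>\<^bsub>B 3\<^esub> (a \<otimes>\<^bsub>B 3\<^esub> b))))"
    unfolding c using ab(1,2) assoc[of "b \<otimes>\<^bsub>B 3\<^esub> (a \<otimes>\<^bsub>B 3\<^esub> b)"] by (simp add: ab(3))
  let ?K = "{g \<in> carrier (B 3). g \<otimes>\<^bsub>B 3\<^esub> cgen = cgen \<otimes>\<^bsub>B 3\<^esub> g}"
  have cB: "cgen \<in> carrier (B 3)" using cgen_PB PB_subset by blast
  have "subgroup ?K (B 3)"
  proof
    fix x y assume "x \<in> ?K" "y \<in> ?K"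
    then show "x \<otimes>\<^bsub>B 3\<^esub> y \<in> ?K" using cB by simp (metis B.m_assoc)
  next
    fix x assume "x \<in> ?K"
    then show "inv\<^bsub>B 3\<^esub> x \<in> ?K" using cB
      by simp (metis B.inv_closed B.inv_solve_left B.inv_solve_right B.m_assoc B.m_closed)
  qed (use cB in auto)
  moreover have "a \<in> ?K"
  proof -
    have "a \<otimes>\<^bsub>B 3\<^esub> cgen = cgen \<otimes>\<^bsub>B 3\<^esub> a"
      by (subst c, subst c_alt) (use ab(1,2) in \<open>simp add: B.m_assoc\<close>)
    then show ?thesis using ab by simp
  qed
  moreover have "b \<in> ?K"
  proof -
    have "b \<otimes>\<^bsub>B 3\<^esub> cgen = cgen \<otimes>\<^bsub>B 3\<^esub> b"
      by (subst c_alt, subst c) (use ab(1,2) in \<open>simp add: B.m_assoc\<close>)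
    then show ?thesis using ab by simp
  qed
  ultimately have "?K = carrier (B 3)"
  proof (intro B_generated)
    fix k :: nat assume "1 \<le> k" "k < 3"
    then consider "k = 1" | "k = 2" by linarith
    then show "sigma 3 k \<in> ?K"
      using \<open>a \<in> ?K\<close> \<open>b \<in> ?K\<close> by cases (simp_all add: a_b_def)
  qed
  then show "g \<in> carrier (B 3) \<Longrightarrow> g \<otimes>\<^bsub>B 3\<^esub> cgen = cgen \<otimes>\<^bsub>B 3\<^esub> g" by blast
qed

text \<open>Doubling the strand at position \<open>p\<close>.  For \<open>p = 0\<close> and \<open>p = 4\<close> an outer strand is added,
  so that the five homomorphisms become \<open>\<phi>\<^sub>2\<^sub>3\<^sub>4\<close>, \<open>\<phi>\<^sub>1\<^sub>2\<^sub>,\<^sub>3\<^sub>,\<^sub>4\<close>, \<open>\<phi>\<^sub>1\<^sub>,\<^sub>2\<^sub>3\<^sub>,\<^sub>4\<close>, \<open>\<phi>\<^sub>1\<^sub>,\<^sub>2\<^sub>,\<^sub>3\<^sub>4\<close>,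
  \<open>\<phi>\<^sub>1\<^sub>2\<^sub>3\<close> for \<open>p = 0, 1, 2, 3, 4\<close>, and they are permuted by conjugation in the braid group.\<close>

definition cab_out :: "nat \<Rightarrow> nat \<Rightarrow> nat word set" where
  "cab_out k p =
    (if p < k then sigma 4 (k + 1)
     else if p = k then sigma 4 (k + 1) \<otimes>\<^bsub>B 4\<^esub> sigma 4 k
     else if p = k + 1 then sigma 4 k \<otimes>\<^bsub>B 4\<^esub> sigma 4 (k + 1)
     else sigma 4 k)"

lemma sigma_4_rels:
  "sigma 4 1 \<otimes>\<^bsub>B 4\<^esub> (sigma 4 2 \<otimes>\<^bsub>B 4\<^esub> sigma 4 1) = sigma 4 2 \<otimes>\<^bsub>B 4\<^esub> (sigma 4 1 \<otimes>\<^bsub>B 4\<^esub> sigma 4 2)"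
  "sigma 4 2 \<otimes>\<^bsub>B 4\<^esub> (sigma 4 3 \<otimes>\<^bsub>B 4\<^esub> sigma 4 2) = sigma 4 3 \<otimes>\<^bsub>B 4\<^esub> (sigma 4 2 \<otimes>\<^bsub>B 4\<^esub> sigma 4 3)"
  "sigma 4 1 \<otimes>\<^bsub>B 4\<^esub> sigma 4 3 = sigma 4 3 \<otimes>\<^bsub>B 4\<^esub> sigma 4 1"
  using sigma_braid[of 1 4] sigma_braid[of 2 4] sigma_commute[of 1 3 4] by simp_all

text \<open>The first three identities are the braid relation as read by \<open>cab_out\<close> from
  the states 1, 2, 3. The last three give the values of strand doubling on x_12 in state 2 and on
  x_23 and x_13 in state 3.\<close>

lemma (in group) cable_identities:
  assumes abc: "a \<in> carrier G" "b \<in> carrier G" "c \<in> carrier G"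
    and ab: "a \<otimes> (b \<otimes> a) = b \<otimes> (a \<otimes> b)" and bc: "b \<otimes> (c \<otimes> b) = c \<otimes> (b \<otimes> c)"
    and ac: "a \<otimes> c = c \<otimes> a"
  shows "b \<otimes> (a \<otimes> (c \<otimes> (b \<otimes> a))) = c \<otimes> (b \<otimes> (a \<otimes> (c \<otimes> b)))"
    and "a \<otimes> (b \<otimes> (c \<otimes> (b \<otimes> a))) = c \<otimes> (b \<otimes> (a \<otimes> (b \<otimes> c)))"
    and "a \<otimes> (b \<otimes> (c \<otimes> (a \<otimes> b))) = b \<otimes> (c \<otimes> (a \<otimes> (b \<otimes> c)))"
    and "a \<otimes> (b \<otimes> (b \<otimes> a)) = a \<otimes> (a \<otimes> (b \<otimes> (a \<otimes> (a \<otimes> inv b))))"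
    and "b \<otimes> (c \<otimes> (c \<otimes> b)) = b \<otimes> (b \<otimes> (c \<otimes> (b \<otimes> (b \<otimes> inv c))))"
    and "b \<otimes> (c \<otimes> (a \<otimes> (b \<otimes> (b \<otimes> (a \<otimes> (inv c \<otimes> inv b)))))) =
      b \<otimes> (a \<otimes> (a \<otimes> (inv b \<otimes> (c \<otimes> (b \<otimes> (a \<otimes> (a \<otimes> (inv b \<otimes> inv c))))))))"
proof -
  note AB = braid_assoc[OF abc(1,2) ab] and BC = braid_assoc[OF abc(2,3) bc]
  have AC: "a \<otimes> (c \<otimes> z) = c \<otimes> (a \<otimes> z)" if "z \<in> carrier G" for z
    using that abc ac by (metis m_assoc)
  have AC': "a \<otimes> (inv c \<otimes> z) = inv c \<otimes> (a \<otimes> z)" if "z \<in> carrier G" for z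
  proof -
    have "inv c \<otimes> (a \<otimes> (c \<otimes> (inv c \<otimes> z))) = inv c \<otimes> (c \<otimes> (a \<otimes> (inv c \<otimes> z)))"
      using that abc by (subst AC) auto
    then show ?thesis using that abc by simp
  qed
  show "b \<otimes> (a \<otimes> (c \<otimes> (b \<otimes> a))) = c \<otimes> (b \<otimes> (a \<otimes> (c \<otimes> b)))"
  proof -
    have "b \<otimes> (a \<otimes> (c \<otimes> (b \<otimes> a))) = b \<otimes> (c \<otimes> (b \<otimes> (a \<otimes> b)))"
      using abc by (simp add: AC ab)
    also have "\<dots> = c \<otimes> (b \<otimes> (a \<otimes> (c \<otimes> b)))"
      using abc by (simp add: BC AC)
    finally show ?thesis .
  qed
  show "a \<otimes> (b \<otimes> (c \<otimes> (b \<otimes> a))) = c \<otimes> (b \<otimes> (a \<otimes> (b \<otimes> c)))"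
  proof -
    have "c \<otimes> (b \<otimes> (a \<otimes> (b \<otimes> c))) = c \<otimes> (a \<otimes> (b \<otimes> (a \<otimes> c)))"
      using abc by (simp add: AB)
    also have "\<dots> = a \<otimes> (c \<otimes> (b \<otimes> (c \<otimes> a)))"
      using abc by (simp add: AC ac)
    also have "\<dots> = a \<otimes> (b \<otimes> (c \<otimes> (b \<otimes> a)))"
      using abc by (simp add: BC)
    finally show ?thesis by simp
  qed
  show "a \<otimes> (b \<otimes> (c \<otimes> (a \<otimes> b))) = b \<otimes> (c \<otimes> (a \<otimes> (b \<otimes> c)))"
  proof -
    have "a \<otimes> (b \<otimes> (c \<otimes> (a \<otimes> b))) = a \<otimes> (b \<otimes> (a \<otimes> (c \<otimes> b)))"
      using abc by (simp add: AC)
    also have "\<dots> = b \<otimes> (a \<otimes> (c \<otimes> (b \<otimes> c)))"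
      using abc by (simp add: AB bc)
    also have "\<dots> = b \<otimes> (c \<otimes> (a \<otimes> (b \<otimes> c)))"
      using abc by (simp add: AC)
    finally show ?thesis .
  qed
  show "a \<otimes> (b \<otimes> (b \<otimes> a)) = a \<otimes> (a \<otimes> (b \<otimes> (a \<otimes> (a \<otimes> inv b))))"
    using abc by (simp add: braid_square_conj[OF abc(1,2) ab])
  show "b \<otimes> (c \<otimes> (c \<otimes> b)) = b \<otimes> (b \<otimes> (c \<otimes> (b \<otimes> (b \<otimes> inv c))))"
    using abc by (simp add: braid_square_conj[OF abc(2,3) bc])
  show "b \<otimes> (c \<otimes> (a \<otimes> (b \<otimes> (b \<otimes> (a \<otimes> (inv c \<otimes> inv b)))))) =
      b \<otimes> (a \<otimes> (a \<otimes> (inv b \<otimes> (c \<otimes> (b \<otimes> (a \<otimes> (a \<otimes> (inv b \<otimes> inv c))))))))"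
  proof -
    have "b \<otimes> (a \<otimes> (a \<otimes> (inv b \<otimes> (c \<otimes> (b \<otimes> (a \<otimes> (a \<otimes> (inv b \<otimes> inv c))))))))
        = b \<otimes> (a \<otimes> (a \<otimes> (c \<otimes> (b \<otimes> (inv c \<otimes> (a \<otimes> (a \<otimes> (inv b \<otimes> inv c))))))))"
      using abc by (simp add: braid_conj'[OF abc(3,2) bc[symmetric]])
    also have "\<dots> = b \<otimes> (c \<otimes> (a \<otimes> (a \<otimes> (b \<otimes> (a \<otimes> (a \<otimes> (inv c \<otimes> (inv b \<otimes> inv c))))))))"
      using abc by (simp add: AC AC')
    also have "inv c \<otimes> (inv b \<otimes> inv c) = inv b \<otimes> (inv c \<otimes> inv b)"
      using braid_inv[OF abc(2,3) bc] by simp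
    also have "b \<otimes> (a \<otimes> (a \<otimes> (inv b \<otimes> (inv c \<otimes> inv b)))) = inv a \<otimes> (b \<otimes> (b \<otimes> (a \<otimes> (inv c \<otimes> inv b))))"
      using abc by (simp add: braid_square_conj_assoc[OF abc(1,2) ab])
    finally show ?thesis using abc by simp
  qed
qed

lemmas cable_identities_4 = B.cable_identities[of "sigma 4 1" 4 "sigma 4 2" "sigma 4 3",
    OF _ _ _ sigma_4_rels, simplified]

interpretation cab: transducer "B 4" "{1..<3}" "braid_rels 3" swap cab_out
proof (intro transducer.intro transducer_axioms.intro)
  fix s q assume "s \<in> {1..<3::nat}"
  then show "cab_out s q \<in> carrier (B 4)"
    by (auto simp: cab_out_def)
next
  fix l r q assume lr: "(l, r) \<in> braid_rels 3"
  then show "trans_word swap l q = trans_word swap r q"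
    by (auto simp: braid_rels_3 Transposition.transpose_def)
  \<comment> \<open>The state 0 and the states from 4 on never move and meet an ordinary braid
    relation of B_4; only the states 1, 2, 3 need \<open>cable_identities_4\<close>.\<close>
  consider "q = 0" | "q = 1" | "q = 2" | "q = 3" | "4 \<le> q" by linarith
  then show "out_word (B 4) swap cab_out l q = out_word (B 4) swap cab_out r q"
    using lr cable_identities_4(1-3) sigma_4_rels
    by cases (simp_all add: braid_rels_3 Transposition.transpose_def cab_out_def B.m_assoc)
qed auto

lemma cab_xgen:
  "cab.run 0 (xgen 3 1 2) = xgen 4 2 3" "cab.run 0 (xgen 3 2 3) = xgen 4 3 4" "cab.run 0 (xgen 3 1 3) = xgen 4 2 4"
  "cab.run 1 (xgen 3 1 2) = xgen 4 1 3 \<otimes>\<^bsub>B 4\<^esub> xgen 4 2 3" "cab.run 1 (xgen 3 2 3) = xgen 4 3 4"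
  "cab.run 1 (xgen 3 1 3) = xgen 4 1 4 \<otimes>\<^bsub>B 4\<^esub> xgen 4 2 4"
  "cab.run 2 (xgen 3 1 2) = xgen 4 1 2 \<otimes>\<^bsub>B 4\<^esub> xgen 4 1 3"
  "cab.run 2 (xgen 3 2 3) = xgen 4 2 4 \<otimes>\<^bsub>B 4\<^esub> xgen 4 3 4" "cab.run 2 (xgen 3 1 3) = xgen 4 1 4"
  "cab.run 3 (xgen 3 1 2) = xgen 4 1 2" "cab.run 3 (xgen 3 2 3) = xgen 4 2 3 \<otimes>\<^bsub>B 4\<^esub> xgen 4 2 4"
  "cab.run 3 (xgen 3 1 3) = xgen 4 1 3 \<otimes>\<^bsub>B 4\<^esub> xgen 4 1 4"
  "cab.run 4 (xgen 3 1 2) = xgen 4 1 2" "cab.run 4 (xgen 3 2 3) = xgen 4 2 3" "cab.run 4 (xgen 3 1 3) = xgen 4 1 3"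
proof -
  have run: "cab.run p (xgen 3 1 2) = out_word (B 4) swap cab_out [(1, True), (1, True)] p"
    "cab.run p (xgen 3 2 3) = out_word (B 4) swap cab_out [(2, True), (2, True)] p"
    "cab.run p (xgen 3 1 3) = out_word (B 4) swap cab_out [(2, True), (1, True), (1, True), (2, False)] p" for p
    unfolding xgen_braid braid_def by (rule cab.run_word_class(1); simp)+
  note [simp] = run xgen_4 Transposition.transpose_def cab_out_def B.m_assoc B.inv_mult_group
  show "cab.run 0 (xgen 3 1 2) = xgen 4 2 3" "cab.run 0 (xgen 3 2 3) = xgen 4 3 4" "cab.run 0 (xgen 3 1 3) = xgen 4 2 4"
    "cab.run 1 (xgen 3 1 2) = xgen 4 1 3 \<otimes>\<^bsub>B 4\<^esub> xgen 4 2 3" "cab.run 1 (xgen 3 2 3) = xgen 4 3 4"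
    "cab.run 1 (xgen 3 1 3) = xgen 4 1 4 \<otimes>\<^bsub>B 4\<^esub> xgen 4 2 4"
    "cab.run 2 (xgen 3 2 3) = xgen 4 2 4 \<otimes>\<^bsub>B 4\<^esub> xgen 4 3 4" "cab.run 2 (xgen 3 1 3) = xgen 4 1 4"
    "cab.run 3 (xgen 3 1 2) = xgen 4 1 2" 
    "cab.run 4 (xgen 3 1 2) = xgen 4 1 2" "cab.run 4 (xgen 3 2 3) = xgen 4 2 3" "cab.run 4 (xgen 3 1 3) = xgen 4 1 3"
    by simp_all
  show "cab.run 2 (xgen 3 1 2) = xgen 4 1 2 \<otimes>\<^bsub>B 4\<^esub> xgen 4 1 3"
    "cab.run 3 (xgen 3 2 3) = xgen 4 2 3 \<otimes>\<^bsub>B 4\<^esub> xgen 4 2 4"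
    "cab.run 3 (xgen 3 1 3) = xgen 4 1 3 \<otimes>\<^bsub>B 4\<^esub> xgen 4 1 4"
    using cable_identities_4(4-6) by simp_all
qed

lemma cab_mult: "g \<in> carrier (B 3) \<Longrightarrow> h \<in> carrier (B 3) \<Longrightarrow>
    cab.run p (g \<otimes>\<^bsub>B 3\<^esub> h) = cab.run p g \<otimes>\<^bsub>B 4\<^esub> cab.run (pos.next_state p g) h"
  unfolding B_def[of 3] by (rule cab.run_mult)

lemma cab_inv: "g \<in> carrier (B 3) \<Longrightarrow>
    cab.run (pos.next_state p g) (inv\<^bsub>B 3\<^esub> g) = inv\<^bsub>B 4\<^esub> cab.run p g"
  unfolding B_def[of 3] by (rule cab.run_inv)

lemma cab_closed: "g \<in> carrier (B 3) \<Longrightarrow> cab.run p g \<in> carrier (B 4)"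
  unfolding B_def[of 3] by (rule cab.run_closed)

lemma cab_hom_B4: "cab.run p \<in> hom (PBgrp 3) (B 4)"
  by (rule homI) (auto simp: PBD cab_closed cab_mult)

section \<open>Generators and homomorphisms of the pure braid group on three strands\<close>

text \<open>One constructor for each coset of PB_3 in B_3, named by a reduced positive word. These
  six words are closed under prefixes, as a Schreier transversal must be.\<close>

datatype coset = Q0 | Q1 | Q2 | Q12 | Q21 | Q121

fun coset_word :: "coset \<Rightarrow> nat word" where
  "coset_word Q0 = []"
| "coset_word Q1 = [(1, True)]"
| "coset_word Q2 = [(2, True)]"
| "coset_word Q12 = [(1, True), (2, True)]"
| "coset_word Q21 = [(2, True), (1, True)]"
| "coset_word Q121 = [(1, True), (2, True), (1, True)]"

text \<open>Right multiplication by a transposition in the symmetric group on three letters, where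
  \<open>Q121\<close> stands for both words of length three.\<close>

definition coset_step :: "nat \<Rightarrow> coset \<Rightarrow> coset" where
  "coset_step k q = (if k = 1
    then (case q of Q0 \<Rightarrow> Q1 | Q1 \<Rightarrow> Q0 | Q2 \<Rightarrow> Q21 | Q21 \<Rightarrow> Q2 | Q12 \<Rightarrow> Q121 | Q121 \<Rightarrow> Q12)
    else (case q of Q0 \<Rightarrow> Q2 | Q2 \<Rightarrow> Q0 | Q1 \<Rightarrow> Q12 | Q12 \<Rightarrow> Q1 | Q21 \<Rightarrow> Q121 | Q121 \<Rightarrow> Q21))"

text \<open>The Schreier rewriting process for the transversal \<open>coset_word\<close>, with \<open>a\<close>, \<open>b\<close>, \<open>d\<close> in place
  of \<open>x\<^sub>1\<^sub>2\<close>, \<open>x\<^sub>2\<^sub>3\<close>, \<open>x\<^sub>1\<^sub>3\<close>.\<close>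

definition schreier :: "('h, 'm) monoid_scheme \<Rightarrow> 'h \<Rightarrow> 'h \<Rightarrow> 'h \<Rightarrow> nat \<Rightarrow> coset \<Rightarrow> 'h" where
  "schreier H a b d k q = (if k = 1
    then (case q of Q1 \<Rightarrow> a | Q21 \<Rightarrow> d | Q121 \<Rightarrow> b | _ \<Rightarrow> \<one>\<^bsub>H\<^esub>)
    else (case q of Q2 \<Rightarrow> b | Q12 \<Rightarrow> inv\<^bsub>H\<^esub> b \<otimes>\<^bsub>H\<^esub> (d \<otimes>\<^bsub>H\<^esub> b) | Q121 \<Rightarrow> a | _ \<Rightarrow> \<one>\<^bsub>H\<^esub>))"

text \<open>The braid relation has content only in the states \<open>Q12\<close> and
  \<open>Q121\<close>, where it becomes b a d = d b a and d b a = a d b. So the hypotheses ask that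
  b a d be invariant under cyclic rotation, which are the relations of PB_3.\<close>

lemma schreier_transducer:
  assumes "group H" "a \<in> carrier H" "b \<in> carrier H" "d \<in> carrier H"
    and dba: "d \<otimes>\<^bsub>H\<^esub> (b \<otimes>\<^bsub>H\<^esub> a) = b \<otimes>\<^bsub>H\<^esub> (a \<otimes>\<^bsub>H\<^esub> d)"
    and adb: "a \<otimes>\<^bsub>H\<^esub> (d \<otimes>\<^bsub>H\<^esub> b) = b \<otimes>\<^bsub>H\<^esub> (a \<otimes>\<^bsub>H\<^esub> d)"
  shows "transducer H {1..<3} (braid_rels 3) coset_step (schreier H a b d)"
proof -
  interpret H: group H by fact
  show ?thesis
  proof (intro transducer.intro transducer_axioms.intro)
    fix l r q assume lr: "(l, r) \<in> braid_rels 3"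
    then show "trans_word coset_step l q = trans_word coset_step r q"
      by (cases q) (auto simp: braid_rels_3 coset_step_def)
    show "out_word H coset_step (schreier H a b d) l q = out_word H coset_step (schreier H a b d) r q"
      using lr assms(2-4) dba adb
      by (cases q) (auto simp: braid_rels_3 coset_step_def schreier_def H.m_assoc)
  qed (use assms in \<open>auto simp: coset_step_def schreier_def split: coset.split\<close>)
qed

lemma (in transducer) out_mem_subgroup:
  assumes "subgroup K H" "\<And>s q. s \<in> S \<Longrightarrow> v s q \<in> K" "w \<in> words S"
  shows "out w q \<in> K"
  using assms(3)
proof (induction w arbitrary: q)
  case Nil
  then show ?case using assms(1) by (simp add: subgroup.one_closed)
next
  case (Cons l w)
  then show ?case
    using assms(1,2) by (cases l) (simp add: subgroup.m_closed subgroup.m_inv_closed)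
qed

text \<open>The product x_23 x_12 x_13 is the central element c; commuting it with x_13 and with
  x_23 and cancelling gives the two rotations.\<close>

lemma PB3_central_form:
  "xgen 3 1 3 \<otimes>\<^bsub>B 3\<^esub> (xgen 3 2 3 \<otimes>\<^bsub>B 3\<^esub> xgen 3 1 2) = xgen 3 2 3 \<otimes>\<^bsub>B 3\<^esub> (xgen 3 1 2 \<otimes>\<^bsub>B 3\<^esub> xgen 3 1 3)"
  "xgen 3 1 2 \<otimes>\<^bsub>B 3\<^esub> (xgen 3 1 3 \<otimes>\<^bsub>B 3\<^esub> xgen 3 2 3) = xgen 3 2 3 \<otimes>\<^bsub>B 3\<^esub> (xgen 3 1 2 \<otimes>\<^bsub>B 3\<^esub> xgen 3 1 3)"
proof -
  define a b d where "a = xgen 3 1 2" "b = xgen 3 2 3" "d = xgen 3 1 3"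
  have abd: "a \<in> carrier (B 3)" "b \<in> carrier (B 3)" "d \<in> carrier (B 3)"
    unfolding a_b_d_def by (simp_all add: PBD)
  have c: "cgen = b \<otimes>\<^bsub>B 3\<^esub> (a \<otimes>\<^bsub>B 3\<^esub> d)"
    using abd by (simp add: cgen_def B.m_assoc flip: a_b_d_def)
  have "d \<otimes>\<^bsub>B 3\<^esub> cgen = cgen \<otimes>\<^bsub>B 3\<^esub> d"
    using abd(3) by (rule cgen_central)
  then have "d \<otimes>\<^bsub>B 3\<^esub> (b \<otimes>\<^bsub>B 3\<^esub> a) \<otimes>\<^bsub>B 3\<^esub> d = b \<otimes>\<^bsub>B 3\<^esub> (a \<otimes>\<^bsub>B 3\<^esub> d) \<otimes>\<^bsub>B 3\<^esub> d"
    using abd by (simp add: c B.m_assoc)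
  moreover have "b \<otimes>\<^bsub>B 3\<^esub> cgen = cgen \<otimes>\<^bsub>B 3\<^esub> b"
    using abd(2) by (rule cgen_central)
  then have "b \<otimes>\<^bsub>B 3\<^esub> (a \<otimes>\<^bsub>B 3\<^esub> (d \<otimes>\<^bsub>B 3\<^esub> b)) = b \<otimes>\<^bsub>B 3\<^esub> (b \<otimes>\<^bsub>B 3\<^esub> (a \<otimes>\<^bsub>B 3\<^esub> d))"
    using abd by (simp add: c B.m_assoc)
  ultimately show "xgen 3 1 3 \<otimes>\<^bsub>B 3\<^esub> (xgen 3 2 3 \<otimes>\<^bsub>B 3\<^esub> xgen 3 1 2) = xgen 3 2 3 \<otimes>\<^bsub>B 3\<^esub> (xgen 3 1 2 \<otimes>\<^bsub>B 3\<^esub> xgen 3 1 3)"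
    "xgen 3 1 2 \<otimes>\<^bsub>B 3\<^esub> (xgen 3 1 3 \<otimes>\<^bsub>B 3\<^esub> xgen 3 2 3) = xgen 3 2 3 \<otimes>\<^bsub>B 3\<^esub> (xgen 3 1 2 \<otimes>\<^bsub>B 3\<^esub> xgen 3 1 3)"
    unfolding a_b_d_def[symmetric] using abd by (metis B.r_cancel B.m_closed, metis B.l_cancel B.m_closed)
qed

interpretation rewrite: transducer "PBgrp 3" "{1..<3}" "braid_rels 3" coset_step
  "schreier (PBgrp 3) (xgen 3 1 2) (xgen 3 2 3) (xgen 3 1 3)"
  by (rule schreier_transducer) (simp_all add: PB3_central_form)

lemma coset_word_words [simp]: "coset_word q \<in> words {1..<3}"
  by (cases q) auto

lemma coset_word_PB: "braid 3 (coset_word q) \<in> PB 3 \<Longrightarrow> q = Q0"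
proof -
  assume "braid 3 (coset_word q) \<in> PB 3"
  then have "trans_word swap (coset_word q) p = p" for p
    using PBD(2) pos_braid[OF coset_word_words] by metis
  from this[of 1] this[of 2] show "q = Q0"
    by (cases q) (auto simp: Transposition.transpose_def)
qed

text \<open>A letter either moves along the transversal or splits off a pure braid. The only one
  that is not a generator is sigma_1 sigma_2^2 sigma_1^-1 = x_23^-1 x_13 x_23, in state
  \<open>Q12\<close>.\<close>

lemma schreier_step:
  assumes "k \<in> {1..<3}"
  defines "v \<equiv> schreier (PBgrp 3) (xgen 3 1 2) (xgen 3 2 3) (xgen 3 1 3)"
  shows "braid 3 (coset_word q) \<otimes>\<^bsub>B 3\<^esub> sigma 3 k = v k q \<otimes>\<^bsub>B 3\<^esub> braid 3 (coset_word (coset_step k q))"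
proof -
  define a b where "a = sigma 3 1" "b = sigma 3 2"
  have ab: "a \<in> carrier (B 3)" "b \<in> carrier (B 3)" and
    rel: "a \<otimes>\<^bsub>B 3\<^esub> (b \<otimes>\<^bsub>B 3\<^esub> a) = b \<otimes>\<^bsub>B 3\<^esub> (a \<otimes>\<^bsub>B 3\<^esub> b)"
    using sigma_braid[of 1 3] by (auto simp: a_b_def)
  have x: "xgen 3 1 2 = a \<otimes>\<^bsub>B 3\<^esub> a" "xgen 3 2 3 = b \<otimes>\<^bsub>B 3\<^esub> b"
    "xgen 3 1 3 = b \<otimes>\<^bsub>B 3\<^esub> (a \<otimes>\<^bsub>B 3\<^esub> (a \<otimes>\<^bsub>B 3\<^esub> inv\<^bsub>B 3\<^esub> b))"
    by (simp_all add: xgen_3 a_b_def)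
  have inv_b2: "inv\<^bsub>PBgrp 3\<^esub> (b \<otimes>\<^bsub>B 3\<^esub> b) = inv\<^bsub>B 3\<^esub> b \<otimes>\<^bsub>B 3\<^esub> inv\<^bsub>B 3\<^esub> b"
  proof -
    have "inv\<^bsub>PBgrp 3\<^esub> xgen 3 2 3 = inv\<^bsub>B 3\<^esub> xgen 3 2 3" by (rule inv_PBgrp) simp
    then show ?thesis using ab by (simp add: x B.inv_mult_group del: inv_PBgrp)
  qed
  have conj: "inv\<^bsub>B 3\<^esub> b \<otimes>\<^bsub>B 3\<^esub> (a \<otimes>\<^bsub>B 3\<^esub> (a \<otimes>\<^bsub>B 3\<^esub> (b \<otimes>\<^bsub>B 3\<^esub> a))) = a \<otimes>\<^bsub>B 3\<^esub> (b \<otimes>\<^bsub>B 3\<^esub> b)"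
  proof -
    have "inv\<^bsub>B 3\<^esub> b \<otimes>\<^bsub>B 3\<^esub> (a \<otimes>\<^bsub>B 3\<^esub> (a \<otimes>\<^bsub>B 3\<^esub> (b \<otimes>\<^bsub>B 3\<^esub> a)))
        = inv\<^bsub>B 3\<^esub> b \<otimes>\<^bsub>B 3\<^esub> (a \<otimes>\<^bsub>B 3\<^esub> (b \<otimes>\<^bsub>B 3\<^esub> (a \<otimes>\<^bsub>B 3\<^esub> b)))"
      by (simp add: rel)
    also have "\<dots> = a \<otimes>\<^bsub>B 3\<^esub> (b \<otimes>\<^bsub>B 3\<^esub> b)"
      using ab B.braid_assoc[OF ab rel, of b] by simp
    finally show ?thesis .
  qed
  have k: "k = 1 \<or> k = 2" using assms(1) by auto
  have v1: "v 1 q = (case q of Q1 \<Rightarrow> a \<otimes>\<^bsub>B 3\<^esub> a | Q21 \<Rightarrow> xgen 3 1 3 | Q121 \<Rightarrow> b \<otimes>\<^bsub>B 3\<^esub> b | _ \<Rightarrow> \<one>\<^bsub>B 3\<^esub>)" for q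
    by (simp add: v_def schreier_def x(1,2) split: coset.split)
  have v2: "v 2 q = (case q of Q2 \<Rightarrow> b \<otimes>\<^bsub>B 3\<^esub> b
      | Q12 \<Rightarrow> inv\<^bsub>B 3\<^esub> b \<otimes>\<^bsub>B 3\<^esub> inv\<^bsub>B 3\<^esub> b \<otimes>\<^bsub>B 3\<^esub> (xgen 3 1 3 \<otimes>\<^bsub>B 3\<^esub> (b \<otimes>\<^bsub>B 3\<^esub> b))
      | Q121 \<Rightarrow> a \<otimes>\<^bsub>B 3\<^esub> a | _ \<Rightarrow> \<one>\<^bsub>B 3\<^esub>)" for q
    by (simp add: v_def schreier_def x(1,2) inv_b2 split: coset.split)
  show ?thesis
    using k ab rel conj B.braid_assoc[OF ab rel, of a] B.braid_assoc[OF ab rel, of b]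
    by (cases q) (auto simp: coset_step_def v1 v2 braid_Cons braid_Nil B.m_assoc x(3) simp flip: a_b_def)
qed

text \<open>\<open>schreier_step\<close> carried along the word, with PB_3 itself as output group.
  For an inverse letter the step is read backwards from the state it leads to.\<close>

lemma schreier_rewriting:
  defines "v \<equiv> schreier (PBgrp 3) (xgen 3 1 2) (xgen 3 2 3) (xgen 3 1 3)"
  assumes "w \<in> words {1..<3}"
  shows "braid 3 (coset_word q) \<otimes>\<^bsub>B 3\<^esub> braid 3 w
    = out_word (PBgrp 3) coset_step v w q \<otimes>\<^bsub>B 3\<^esub> braid 3 (coset_word (trans_word coset_step w q))"
  using assms(2)
proof (induction w arbitrary: q)
  case Nil
  then show ?case by (simp add: braid_Nil)
next
  case (Cons l w)
  obtain k b where l: "l = (k, b)" by force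
  have k: "k \<in> {1..<3}" and w: "w \<in> words {1..<3}" using Cons.prems l by auto
  let ?q = "coset_step k q" and ?r = "\<lambda>q. braid 3 (coset_word q)"
  let ?v = "if b then v k q else inv\<^bsub>PBgrp 3\<^esub> (v k ?q)"
  have vPB: "v k q \<in> PB 3" for q
    using rewrite.v_closed[OF k] by (simp add: v_def)
  then have vB: "v k q \<in> carrier (B 3)" for q by (simp add: PBD)
  have s: "sigma 3 k \<in> carrier (B 3)" using k by simp
  have out: "out_word (PBgrp 3) coset_step v w ?q \<in> carrier (B 3)"
    using rewrite.out_closed[OF w] by (simp add: v_def PBD)
  have step: "?r q \<otimes>\<^bsub>B 3\<^esub> sigma 3 k = v k q \<otimes>\<^bsub>B 3\<^esub> ?r (coset_step k q)" for q
    using schreier_step[OF k] by (simp add: v_def)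
  have letter: "?r q \<otimes>\<^bsub>B 3\<^esub> braid 3 [l] = ?v \<otimes>\<^bsub>B 3\<^esub> ?r ?q"
  proof (cases b)
    case True
    then show ?thesis using step k by (simp add: l braid_singleton)
  next
    case False
    have "?r ?q \<otimes>\<^bsub>B 3\<^esub> sigma 3 k = v k ?q \<otimes>\<^bsub>B 3\<^esub> ?r q"
      using step[of ?q] rewrite.invol[OF k] by simp
    then have "inv\<^bsub>B 3\<^esub> (v k ?q) \<otimes>\<^bsub>B 3\<^esub> ?r ?q \<otimes>\<^bsub>B 3\<^esub> sigma 3 k = ?r q"
      using vB s by (simp add: B.m_assoc)
    then have "?r q \<otimes>\<^bsub>B 3\<^esub> inv\<^bsub>B 3\<^esub> sigma 3 k = inv\<^bsub>B 3\<^esub> (v k ?q) \<otimes>\<^bsub>B 3\<^esub> ?r ?q"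
      using vB s by (metis B.inv_closed B.inv_solve_right B.m_closed braid_closed coset_word_words)
    then show ?thesis
      using False k vPB by (simp add: l braid_singleton)
  qed
  have vB': "?v \<in> carrier (B 3)" using vB vPB by simp
  have "?r q \<otimes>\<^bsub>B 3\<^esub> braid 3 (l # w) = ?r q \<otimes>\<^bsub>B 3\<^esub> braid 3 [l] \<otimes>\<^bsub>B 3\<^esub> braid 3 w"
    using braid_append[of "[l]" 3 w] k w l by (simp add: B.m_assoc)
  also have "\<dots> = ?v \<otimes>\<^bsub>B 3\<^esub> (?r ?q \<otimes>\<^bsub>B 3\<^esub> braid 3 w)"
    unfolding letter using vB' w by (simp add: B.m_assoc del: if_split)
  also have "\<dots> = ?v \<otimes>\<^bsub>B 3\<^esub> out_word (PBgrp 3) coset_step v w ?q \<otimes>\<^bsub>B 3\<^esub> ?r (trans_word coset_step w ?q)"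
    unfolding Cons.IH[OF w] using vB' out by (simp add: B.m_assoc del: if_split)
  finally show ?case by (simp add: l)
qed

text \<open>The final transversal word differs from the given pure braid by the pure output, so it
  is pure itself, and only the empty transversal word is.\<close>

lemma coset_trans_PB:
  assumes "w \<in> words {1..<3}" "braid 3 w \<in> PB 3"
  shows "trans_word coset_step w Q0 = Q0"
proof -
  let ?o = "out_word (PBgrp 3) coset_step (schreier (PBgrp 3) (xgen 3 1 2) (xgen 3 2 3) (xgen 3 1 3)) w Q0"
  let ?r = "braid 3 (coset_word (trans_word coset_step w Q0))"
  have o: "?o \<in> PB 3" using rewrite.out_closed[OF assms(1)] by simp
  have "braid 3 w = ?o \<otimes>\<^bsub>B 3\<^esub> ?r"
    using schreier_rewriting[OF assms(1), of Q0] assms by (simp add: braid_Nil)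
  then have "inv\<^bsub>B 3\<^esub> ?o \<otimes>\<^bsub>B 3\<^esub> braid 3 w = ?r"
    using o by (simp add: PBD)
  moreover have "inv\<^bsub>B 3\<^esub> ?o \<otimes>\<^bsub>B 3\<^esub> braid 3 w \<in> PB 3"
    using o assms(2) PB_subgroup by (meson subgroup.m_closed subgroup.m_inv_closed)
  ultimately show ?thesis using coset_word_PB by metis
qed

lemma B3_cases:
  assumes "g \<in> carrier (B 3)"
  obtains w where "w \<in> words {1..<3}" "g = braid 3 w"
proof -
  have "g \<in> carrier (presented_group {1..<3} (braid_rels 3))" using assms unfolding B_def .
  then show ?thesis by (rule presented_group_cases) (use that in \<open>simp add: braid_def\<close>)
qed

text \<open>Rewriting a pure braid from \<open>Q0\<close> ends in \<open>Q0\<close>, so the output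
  is the braid itself, spelled in the generators. This gives the uniqueness behind
  \<open>phi_hom\<close>.\<close>

lemma PB3_generated:
  "generate (PBgrp 3) {xgen 3 1 2, xgen 3 2 3, xgen 3 1 3} = PB 3"
proof
  let ?X = "{xgen 3 1 2, xgen 3 2 3, xgen 3 1 3}"
  let ?v = "schreier (PBgrp 3) (xgen 3 1 2) (xgen 3 2 3) (xgen 3 1 3)"
  have X: "?X \<subseteq> carrier (PBgrp 3)" by simp
  then show "generate (PBgrp 3) ?X \<subseteq> PB 3"
    using PB.generate_incl[OF X] by simp
  interpret K: subgroup "generate (PBgrp 3) ?X" "PBgrp 3"
    by (rule PB.generate_is_subgroup[OF X])
  have gen: "x \<in> ?X \<Longrightarrow> x \<in> generate (PBgrp 3) ?X" for x by (rule generate.incl)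
  have v: "?v k q \<in> generate (PBgrp 3) ?X" for k q
    using gen K.one_closed K.m_inv_closed K.m_closed
    by (auto simp: schreier_def simp del: PBgrp_simps inv_PBgrp split: coset.split)
  show "PB 3 \<subseteq> generate (PBgrp 3) ?X"
  proof
    fix g assume g: "g \<in> PB 3"
    obtain w where w: "w \<in> words {1..<3}" "g = braid 3 w" using PBD(1)[OF g] by (rule B3_cases)
    have o: "out_word (PBgrp 3) coset_step ?v w Q0 \<in> generate (PBgrp 3) ?X"
      using K.subgroup_axioms v w(1) by (rule rewrite.out_mem_subgroup)
    then have "out_word (PBgrp 3) coset_step ?v w Q0 \<in> carrier (B 3)"
      using K.subset PBD(1) by auto
    then have "g = out_word (PBgrp 3) coset_step ?v w Q0"
      using schreier_rewriting[OF w(1), of Q0] coset_trans_PB[OF w(1)] g w by (simp add: braid_Nil)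
    then show "g \<in> generate (PBgrp 3) ?X" using o by simp
  qed
qed

lemma PB3_hom_eq:
  assumes "group H" "h \<in> hom (PBgrp 3) H" "k \<in> hom (PBgrp 3) H"
    and "h (xgen 3 1 2) = k (xgen 3 1 2)" "h (xgen 3 2 3) = k (xgen 3 2 3)" "h (xgen 3 1 3) = k (xgen 3 1 3)"
    and "g \<in> PB 3"
  shows "h g = k g"
  by (rule hom_eq_on_generators[of "PBgrp 3" H h k "{xgen 3 1 2, xgen 3 2 3, xgen 3 1 3}"])
    (use assms PB3_generated in auto)

text \<open>The universal property of F_2 times the infinite cyclic group of c, obtained by Schreier
  rewriting into H; pure braids fix the state \<open>Q0\<close>. It supplies the homomorphism of
  condition (iv).\<close>

lemma PB3_hom_exists:
  assumes "group H" "a \<in> carrier H" "b \<in> carrier H" "c \<in> carrier H"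
    and ac: "a \<otimes>\<^bsub>H\<^esub> c = c \<otimes>\<^bsub>H\<^esub> a" and bc: "b \<otimes>\<^bsub>H\<^esub> c = c \<otimes>\<^bsub>H\<^esub> b"
  shows "\<exists>h\<in>hom (PBgrp 3) H. h (xgen 3 1 2) = a \<and> h (xgen 3 2 3) = b \<and> h cgen = c"
proof -
  interpret H: group H by fact
  \<comment> \<open>The value on x_13 forced by c = x_23 x_12 x_13.\<close>
  define d where "d = inv\<^bsub>H\<^esub> a \<otimes>\<^bsub>H\<^esub> (inv\<^bsub>H\<^esub> b \<otimes>\<^bsub>H\<^esub> c)"
  have d: "d \<in> carrier H" using assms by (simp add: d_def)
  have bad: "b \<otimes>\<^bsub>H\<^esub> (a \<otimes>\<^bsub>H\<^esub> d) = c" using assms(2-4) by (simp add: d_def)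
  have "c \<otimes>\<^bsub>H\<^esub> (b \<otimes>\<^bsub>H\<^esub> a) = b \<otimes>\<^bsub>H\<^esub> (a \<otimes>\<^bsub>H\<^esub> c)"
    using assms(2-4) ac bc by (metis H.m_assoc)
  then have dba: "d \<otimes>\<^bsub>H\<^esub> (b \<otimes>\<^bsub>H\<^esub> a) = b \<otimes>\<^bsub>H\<^esub> (a \<otimes>\<^bsub>H\<^esub> d)"
    unfolding bad using assms(2-4) by (simp add: d_def H.m_assoc)
  have adb: "a \<otimes>\<^bsub>H\<^esub> (d \<otimes>\<^bsub>H\<^esub> b) = b \<otimes>\<^bsub>H\<^esub> (a \<otimes>\<^bsub>H\<^esub> d)"
    unfolding bad using assms(2-4) bc[symmetric] by (simp add: d_def H.m_assoc)
  interpret T: transducer H "{1..<3}" "braid_rels 3" coset_step "schreier H a b d"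
    using assms d dba adb by (intro schreier_transducer)
  have state: "T.next_state Q0 g = Q0" if g: "g \<in> PB 3" for g
  proof -
    obtain w where w: "w \<in> words {1..<3}" "g = braid 3 w" using PBD(1)[OF g] by (rule B3_cases)
    then show ?thesis
      using T.run_word_class(2)[OF w(1)] coset_trans_PB[OF w(1)] g by (simp add: braid_def)
  qed
  have B3: "g \<in> carrier (presented_group {1..<3} (braid_rels 3))" if "g \<in> PB 3" for g
    using PBD(1)[OF that] unfolding B_def .
  have hom: "T.run Q0 \<in> hom (PBgrp 3) H"
  proof (rule homI)
    fix x y assume "x \<in> carrier (PBgrp 3)" "y \<in> carrier (PBgrp 3)"
    then show "T.run Q0 (x \<otimes>\<^bsub>PBgrp 3\<^esub> y) = T.run Q0 x \<otimes>\<^bsub>H\<^esub> T.run Q0 y"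
      using T.run_mult[of x y Q0] state B3 by (simp add: B_def)
  qed (use B3 in auto)
  have val: "T.run Q0 (xgen 3 1 2) = out_word H coset_step (schreier H a b d) [(1, True), (1, True)] Q0"
    "T.run Q0 (xgen 3 2 3) = out_word H coset_step (schreier H a b d) [(2, True), (2, True)] Q0"
    "T.run Q0 (xgen 3 1 3) = out_word H coset_step (schreier H a b d) [(2, True), (1, True), (1, True), (2, False)] Q0"
    unfolding xgen_braid braid_def by (rule T.run_word_class(1); simp)+
  then have "T.run Q0 (xgen 3 1 2) = a" "T.run Q0 (xgen 3 2 3) = b" "T.run Q0 (xgen 3 1 3) = d"
    using assms(2-4) d by (simp_all add: coset_step_def schreier_def)
  moreover from this have "T.run Q0 cgen = c"
    using hom_mult[OF hom] bad d assms(2-4) subgroup.m_closed[OF PB_subgroup]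
    by (simp add: cgen_def H.m_assoc)
  ultimately show ?thesis using hom by blast
qed

lemma cab_PB4: "g \<in> PB 3 \<Longrightarrow> p \<le> 4 \<Longrightarrow> cab.run p g \<in> PB 4"
proof -
  assume g: "g \<in> PB 3" and p: "p \<le> 4"
  interpret h: group_hom "PBgrp 3" "B 4" "cab.run p"
    by (simp add: group_hom_def group_hom_axioms_def cab_hom_B4)
  have sub: "subgroup {g \<in> carrier (PBgrp 3). cab.run p g \<in> PB 4} (PBgrp 3)"
  proof
    fix x assume "x \<in> {g \<in> carrier (PBgrp 3). cab.run p g \<in> PB 4}"
    then show "inv\<^bsub>PBgrp 3\<^esub> x \<in> {g \<in> carrier (PBgrp 3). cab.run p g \<in> PB 4}"
      using h.hom_inv[of x] subgroup.m_inv_closed[OF PB_subgroup[of 4]] PB.inv_closed[of x 3]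
      by (simp del: inv_PBgrp)
  next
    fix x y
    assume "x \<in> {g \<in> carrier (PBgrp 3). cab.run p g \<in> PB 4}" "y \<in> {g \<in> carrier (PBgrp 3). cab.run p g \<in> PB 4}"
    then show "x \<otimes>\<^bsub>PBgrp 3\<^esub> y \<in> {g \<in> carrier (PBgrp 3). cab.run p g \<in> PB 4}"
      using h.hom_mult[of x y] subgroup.m_closed[OF PB_subgroup[of 4]] PB.m_closed[of x 3 y] by simp
  qed (use subgroup.one_closed[OF PB_subgroup] h.hom_one in auto)
  have "p = 0 \<or> p = 1 \<or> p = 2 \<or> p = 3 \<or> p = 4" using p by linarith
  then have "{xgen 3 1 2, xgen 3 2 3, xgen 3 1 3} \<subseteq> {g \<in> carrier (PBgrp 3). cab.run p g \<in> PB 4}"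
    using subgroup.m_closed[OF PB_subgroup[of 4]] by (auto simp: cab_xgen)
  from PB.generate_subgroup_incl[OF this sub] show ?thesis
    using g by (auto simp: PB3_generated)
qed

lemma cab_hom: "p \<le> 4 \<Longrightarrow> cab.run p \<in> hom (PBgrp 3) (PBgrp 4)"
  using cab_hom_B4[of p] cab_PB4 by (auto simp: hom_def)

lemma phi_hom_eq:
  assumes "h \<in> hom (PBgrp 3) (PBgrp 4)"
  shows "phi_hom (h (xgen 3 1 2)) (h (xgen 3 2 3)) (h (xgen 3 1 3)) = restrict h (PB 3)"
  unfolding phi_hom_def
proof (rule the_equality)
  have "restrict h (PB 3) \<in> hom (PBgrp 3) (PBgrp 4)"
    using PB.hom_restrict[OF assms, of "restrict h (PB 3)"] by simp
  then show "restrict h (PB 3) \<in> hom (PBgrp 3) (PBgrp 4) \<and> restrict h (PB 3) \<in> extensional (PB 3) \<and>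
     restrict h (PB 3) (xgen 3 1 2) = h (xgen 3 1 2) \<and> restrict h (PB 3) (xgen 3 2 3) = h (xgen 3 2 3) \<and>
     restrict h (PB 3) (xgen 3 1 3) = h (xgen 3 1 3)"
    by simp
  fix k assume k: "k \<in> hom (PBgrp 3) (PBgrp 4) \<and> k \<in> extensional (PB 3) \<and>
     k (xgen 3 1 2) = h (xgen 3 1 2) \<and> k (xgen 3 2 3) = h (xgen 3 2 3) \<and> k (xgen 3 1 3) = h (xgen 3 1 3)"
  show "k = restrict h (PB 3)"
    by (rule extensionalityI[of _ "PB 3"]) (use k PB3_hom_eq[of "PBgrp 4" k h] assms in auto)
qed

lemma phi_eq:
  assumes "g \<in> PB 3"
  shows "phi_234 g = cab.run 0 g" "phi_12_3_4 g = cab.run 1 g" "phi_1_23_4 g = cab.run 2 g"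
    "phi_1_2_34 g = cab.run 3 g" "phi_123 g = cab.run 4 g"
  using phi_hom_eq[OF cab_hom, of 0] phi_hom_eq[OF cab_hom, of 1] phi_hom_eq[OF cab_hom, of 2]
    phi_hom_eq[OF cab_hom, of 3] phi_hom_eq[OF cab_hom, of 4] assms
  by (simp_all add: cab_xgen phi_234_def phi_12_3_4_def phi_1_23_4_def phi_1_2_34_def phi_123_def)

section \<open>Linking numbers\<close>

definition pair_swap :: "nat \<Rightarrow> nat \<times> nat \<Rightarrow> nat \<times> nat" where
  "pair_swap k = map_prod (swap k) (swap k)"

text \<open>Half of the crossings of two strands suffice to compute the linking number of a pure braid.\<close>

definition link_out :: "nat \<Rightarrow> nat \<times> nat \<Rightarrow> int" where
  "link_out k = (\<lambda>(p, q). if p = k \<and> q = k + 1 then 1 else 0)"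

interpretation link: transducer integer_group "{1..<4}" "braid_rels 4" pair_swap link_out
proof (intro transducer.intro transducer_axioms.intro group_integer_group)
  fix l r and q :: "nat \<times> nat" assume lr: "(l, r) \<in> braid_rels 4"
  obtain i j where q: "q = (i, j)" by force
  \<comment> \<open>Positions outside 1 to 4 all behave alike, so five cases for each entry
    suffice.\<close>
  have i: "i = 1 \<or> i = 2 \<or> i = 3 \<or> i = 4 \<or> i \<noteq> 1 \<and> i \<noteq> 2 \<and> i \<noteq> 3 \<and> i \<noteq> 4"
    and j: "j = 1 \<or> j = 2 \<or> j = 3 \<or> j = 4 \<or> j \<noteq> 1 \<and> j \<noteq> 2 \<and> j \<noteq> 3 \<and> j \<noteq> 4" by blast+
  define P where "P l r \<longleftrightarrow> trans_word pair_swap l (i, j) = trans_word pair_swap r (i, j) \<and>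
      out_word integer_group pair_swap link_out l (i, j) = out_word integer_group pair_swap link_out r (i, j)"
    for l r
  have "P [(1, True), (3, True)] [(3, True), (1, True)]"
    using i j unfolding P_def
    by (elim disjE; simp add: pair_swap_def link_out_def Transposition.transpose_def)
  moreover have "P [(1, True), (2, True), (1, True)] [(2, True), (1, True), (2, True)]"
    using i j unfolding P_def
    by (elim disjE; simp add: pair_swap_def link_out_def Transposition.transpose_def)
  moreover have "P [(2, True), (3, True), (2, True)] [(3, True), (2, True), (3, True)]"
    using i j unfolding P_def
    by (elim disjE; simp add: pair_swap_def link_out_def Transposition.transpose_def)
  ultimately have "P l r" using lr unfolding braid_rels_4 by blast
  then show "trans_word pair_swap l q = trans_word pair_swap r q"
    "out_word integer_group pair_swap link_out l q = out_word integer_group pair_swap link_out r q"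
    unfolding P_def q by blast+
qed (auto simp: pair_swap_def)

lemma trans_word_pair_swap: "trans_word pair_swap w (p, q) = (trans_word swap w p, trans_word swap w q)"
  by (induction w arbitrary: p q) (auto simp: pair_swap_def)

lemma link_hom: "link.run (i, j) \<in> hom (PBgrp 4) integer_group"
proof (rule homI)
  fix x y assume xy: "x \<in> carrier (PBgrp 4)" "y \<in> carrier (PBgrp 4)"
  then have B4: "x \<in> carrier (presented_group {1..<4} (braid_rels 4))"
    "y \<in> carrier (presented_group {1..<4} (braid_rels 4))"
    using PBD(1) unfolding PBgrp_simps B_def by blast+
  obtain w where w: "w \<in> words {1..<4}" "x = braid 4 w"
    using B4(1) unfolding braid_def by (rule presented_group_cases)
  have "link.next_state (i, j) x = (i, j)"
    using link.run_word_class(2)[OF w(1)] PBD(2)[of x 4] pos_braid[OF w(1)] xy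
    by (simp add: w(2) trans_word_pair_swap braid_def)
  then show "link.run (i, j) (x \<otimes>\<^bsub>PBgrp 4\<^esub> y) = link.run (i, j) x \<otimes>\<^bsub>integer_group\<^esub> link.run (i, j) y"
    using link.run_mult[OF B4, of "(i, j)"] by (simp add: B_def)
qed simp

lemma link_xgen:
  "link.run (1, 2) (xgen 4 1 2) = 1" "link.run (1, 2) (xgen 4 2 3) = 0" "link.run (1, 2) (xgen 4 3 4) = 0"
  "link.run (1, 2) (xgen 4 1 3) = 0" "link.run (1, 2) (xgen 4 2 4) = 0" "link.run (1, 2) (xgen 4 1 4) = 0"
  "link.run (3, 4) (xgen 4 1 2) = 0" "link.run (3, 4) (xgen 4 2 3) = 0" "link.run (3, 4) (xgen 4 3 4) = 1"
  "link.run (3, 4) (xgen 4 1 3) = 0" "link.run (3, 4) (xgen 4 2 4) = 0" "link.run (3, 4) (xgen 4 1 4) = 0"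
  unfolding xgen_braid braid_def
  by (subst link.run_word_class; simp add: pair_swap_def link_out_def Transposition.transpose_def)+

section \<open>The free group of rank 2\<close>

lemma F2_group [simp]: "group F2"
  by (simp add: F2_def group_presented_group)

interpretation F2: group F2
  by simp

lemma F2_gen_closed [simp]: "F2x \<in> carrier F2" "F2y \<in> carrier F2"
  by (simp_all add: F2_def F2x_def F2y_def)

lemma F2_generated: "generate F2 {F2x, F2y} = carrier F2"
proof -
  have "word_class UNIV {} [(s, True)] \<in> generate F2 {F2x, F2y}" for s
    by (cases s) (auto simp: F2x_def F2y_def intro: generate.incl)
  moreover have "subgroup (generate F2 {F2x, F2y}) F2"
    by (rule F2.generate_is_subgroup) simp
  ultimately show ?thesis
    using presented_group_generated[of "generate F2 {F2x, F2y}" UNIV "{}"] by (simp add: F2_def)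
qed

lemma F2_hom_unique:
  assumes "group H" "h \<in> hom F2 H" "k \<in> hom F2 H" "h F2x = k F2x" "h F2y = k F2y" "g \<in> carrier F2"
  shows "h g = k g"
  by (rule hom_eq_on_generators[of F2 H h k "{F2x, F2y}"]) (use assms F2_generated in auto)

lemma F2_hom_eqI:
  assumes "group H" "h \<in> hom F2 H" "h \<in> extensional (carrier F2)" "h F2x = a" "h F2y = b"
  shows "F2_hom H a b = h"
  unfolding F2_hom_def
proof (rule the_equality)
  fix k assume k: "k \<in> hom F2 H \<and> k \<in> extensional (carrier F2) \<and> k F2x = a \<and> k F2y = b"
  then show "k = h"
    using assms F2_hom_unique[of H k h] by (intro extensionalityI[of k "carrier F2"]) auto
qed (use assms in auto)

lemma F2_hom_props:
  assumes "group H" "a \<in> carrier H" "b \<in> carrier H"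
  shows "F2_hom H a b \<in> hom F2 H" "F2_hom H a b \<in> extensional (carrier F2)"
    "F2_hom H a b F2x = a" "F2_hom H a b F2y = b"
proof -
  interpret H: group H by fact
  \<comment> \<open>No state ever changes, so this transducer is an ordinary homomorphism; the state
    0 used below is an arbitrary choice.\<close>
  define v where "v s = (\<lambda>_ :: nat. case s of GenX \<Rightarrow> a | GenY \<Rightarrow> b)" for s
  interpret T: transducer H UNIV "{}" "\<lambda>_ q. q" v
    by (intro transducer.intro transducer_axioms.intro)
      (use assms in \<open>auto simp: v_def split: f2gen.split\<close>)
  define h where "h = restrict (T.run 0) (carrier F2)"
  have "trans_word (\<lambda>_ q. q) w q = q" for w :: "f2gen word" and q :: nat
    by (induction w) auto
  then have state: "T.next_state q g = q" for q g by (simp add: T.next_state_def)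
  have hom: "h \<in> hom F2 H"
  proof (rule homI)
    fix x y assume xy: "x \<in> carrier F2" "y \<in> carrier F2"
    have "T.run 0 (x \<otimes>\<^bsub>F2\<^esub> y) = T.run 0 x \<otimes>\<^bsub>H\<^esub> T.run 0 y"
      using T.run_mult[of x y 0] xy by (simp add: F2_def state)
    then show "h (x \<otimes>\<^bsub>F2\<^esub> y) = h x \<otimes>\<^bsub>H\<^esub> h y"
      using xy by (simp add: h_def)
  next
    fix x assume "x \<in> carrier F2"
    then show "h x \<in> carrier H"
      using T.run_closed[of x 0] by (simp add: h_def F2_def)
  qed
  have "T.run 0 F2x = a" "T.run 0 F2y = b"
    using assms by (simp_all add: F2x_def F2y_def T.run_word_class v_def)
  then have "h F2x = a" "h F2y = b" by (simp_all add: h_def)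
  moreover have "h \<in> extensional (carrier F2)" by (simp add: h_def)
  ultimately show "F2_hom H a b \<in> hom F2 H" "F2_hom H a b \<in> extensional (carrier F2)"
    "F2_hom H a b F2x = a" "F2_hom H a b F2y = b"
    using F2_hom_eqI[OF assms(1) hom] hom by simp_all
qed

lemma iota_hom: "iota \<in> hom F2 (PBgrp 3)"
  and iota_gen [simp]: "iota F2x = xgen 3 1 2" "iota F2y = xgen 3 2 3"
  using F2_hom_props[of "PBgrp 3" "xgen 3 1 2" "xgen 3 2 3"] by (simp_all add: iota_def)

lemma iota_closed [simp]: "f \<in> carrier F2 \<Longrightarrow> iota f \<in> PB 3"
  using hom_in_carrier[OF iota_hom] by simp

definition expo_x :: "f2 \<Rightarrow> int" where "expo_x = F2_hom integer_group 1 0"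
definition expo_y :: "f2 \<Rightarrow> int" where "expo_y = F2_hom integer_group 0 1"

lemma expo_hom: "expo_x \<in> hom F2 integer_group" "expo_y \<in> hom F2 integer_group"
  and expo_gen [simp]: "expo_x F2x = 1" "expo_x F2y = 0" "expo_y F2x = 0" "expo_y F2y = 1"
  using F2_hom_props[of integer_group 1 0] F2_hom_props[of integer_group 0 1]
  by (simp_all add: expo_x_def expo_y_def)

text \<open>Each value is a homomorphism in f, so x and y decide. For the pairs (1, 2) and (3, 4) an
  exponent sum occurs twice on the left of the pentagon and once on the right.\<close>

lemma link_cab_iota:
  assumes f: "f \<in> carrier F2"
  shows "link.run (1, 2) (cab.run 0 (iota f)) = 0" "link.run (1, 2) (cab.run 1 (iota f)) = 0"
    "link.run (1, 2) (cab.run 2 (iota f)) = expo_x f" "link.run (1, 2) (cab.run 3 (iota f)) = expo_x f"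
    "link.run (1, 2) (cab.run 4 (iota f)) = expo_x f"
    "link.run (3, 4) (cab.run 0 (iota f)) = expo_y f" "link.run (3, 4) (cab.run 1 (iota f)) = expo_y f"
    "link.run (3, 4) (cab.run 2 (iota f)) = expo_y f" "link.run (3, 4) (cab.run 3 (iota f)) = 0"
    "link.run (3, 4) (cab.run 4 (iota f)) = 0"
proof -
  have hom: "(\<lambda>g. link.run ij (cab.run p (iota g))) \<in> hom F2 integer_group" if "p \<le> 4" for p ij
    using hom_compose[OF hom_compose[OF iota_hom cab_hom[OF that]] link_hom[of "fst ij" "snd ij"]]
    by (simp add: o_def)
  have zero: "(\<lambda>_. 0) \<in> hom F2 integer_group" by (rule homI) auto
  have eq: "link.run ij (cab.run p (iota f)) = h f"
    if "p \<le> 4" "h \<in> hom F2 integer_group"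
      "link.run ij (cab.run p (xgen 3 1 2)) = h F2x" "link.run ij (cab.run p (xgen 3 2 3)) = h F2y" for p ij h
    by (rule F2_hom_unique[OF _ hom[OF that(1)] that(2) _ _ f]) (use that in simp_all)
  have mult: "link.run ij (x \<otimes>\<^bsub>B 4\<^esub> y) = link.run ij x + link.run ij y" if "x \<in> PB 4" "y \<in> PB 4" for ij x y
    using hom_mult[OF link_hom[of "fst ij" "snd ij"], of x y] that by simp
  show "link.run (1, 2) (cab.run 0 (iota f)) = 0" "link.run (1, 2) (cab.run 1 (iota f)) = 0"
    "link.run (3, 4) (cab.run 3 (iota f)) = 0" "link.run (3, 4) (cab.run 4 (iota f)) = 0"
    by (rule eq[OF _ zero]; simp add: cab_xgen link_xgen mult)+
  show "link.run (1, 2) (cab.run 2 (iota f)) = expo_x f" "link.run (1, 2) (cab.run 3 (iota f)) = expo_x f"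
    "link.run (1, 2) (cab.run 4 (iota f)) = expo_x f"
    by (rule eq[OF _ expo_hom(1)]; simp add: cab_xgen link_xgen mult)+
  show "link.run (3, 4) (cab.run 0 (iota f)) = expo_y f" "link.run (3, 4) (cab.run 1 (iota f)) = expo_y f"
    "link.run (3, 4) (cab.run 2 (iota f)) = expo_y f"
    by (rule eq[OF _ expo_hom(2)]; simp add: cab_xgen link_xgen mult)+
qed

section \<open>The subgroups attached to an object\<close>

lemma PBgrp_nat_pow [simp]: "x [^]\<^bsub>PBgrp n\<^esub> (k :: nat) = x [^]\<^bsub>B n\<^esub> k"
  by (induction k) auto

lemma trans_word_swap_le: "w \<in> words {1..<3} \<Longrightarrow> p \<le> 4 \<Longrightarrow> trans_word swap w p \<le> 4"
  by (induction w arbitrary: p) (auto simp: Transposition.transpose_def)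

lemma trans_word_swap_gt: "w \<in> words {1..<3} \<Longrightarrow> 4 < p \<Longrightarrow> trans_word swap w p = p"
  by (induction w arbitrary: p) (auto simp: Transposition.transpose_def)

lemma pos_3:
  assumes "g \<in> carrier (B 3)"
  shows "p \<le> 4 \<Longrightarrow> pos.next_state p g \<le> 4" "4 < p \<Longrightarrow> pos.next_state p g = p"
  using assms by (auto elim!: B3_cases simp: pos_braid trans_word_swap_le trans_word_swap_gt)

context
  fixes N assumes NFI: "N \<in> NFI"
begin

lemma N_normal: "N \<lhd> B 4" and N_PB: "N \<subseteq> PB 4" and N_finite: "finite (carrier (B 4 Mod N))"
  using NFI by (auto simp: NFI_def)

lemma N_subgroup: "subgroup N (B 4)"
  using N_normal by (rule normal_imp_subgroup)

lemma N_PB3_eq: "N_PB3 N = {g \<in> PB 3. \<forall>p\<le>4. cab.run p g \<in> N}"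
proof -
  have "p \<le> 4 \<longleftrightarrow> p = 0 \<or> p = 1 \<or> p = 2 \<or> p = 3 \<or> p = 4" for p :: nat
    by linarith
  then have all: "(\<forall>p\<le>4. P p) \<longleftrightarrow> P 0 \<and> P 1 \<and> P 2 \<and> P 3 \<and> P 4" for P :: "nat \<Rightarrow> bool"
    by (simp only: imp_disjL all_conj_distrib simp_thms)
  show ?thesis
  proof (rule Set.set_eqI)
    fix g
    show "g \<in> N_PB3 N \<longleftrightarrow> g \<in> {g \<in> PB 3. \<forall>p\<le>4. cab.run p g \<in> N}"
    proof (cases "g \<in> PB 3")
      case True
      then show ?thesis unfolding all N_PB3_def mem_Collect_eq phi_eq[OF True] by blast
    qed (simp add: N_PB3_def)
  qed
qed

lemma N_PB3_sub: "N_PB3 N \<subseteq> PB 3"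
  by (auto simp: N_PB3_def)

lemma N_PB3_normal: "N_PB3 N \<lhd> B 3"
  unfolding B.normal_inv_iff
proof (intro conjI ballI)
  interpret N: normal N "B 4" by (rule N_normal)
  show "subgroup (N_PB3 N) (B 3)"
  proof
    fix x y assume "x \<in> N_PB3 N" "y \<in> N_PB3 N"
    then show "x \<otimes>\<^bsub>B 3\<^esub> y \<in> N_PB3 N"
      by (auto simp: N_PB3_eq cab_mult PBD subgroup.m_closed[OF PB_subgroup])
  next
    fix x assume x: "x \<in> N_PB3 N"
    then have "x \<in> PB 3" "x \<in> carrier (B 3)" by (auto simp: N_PB3_eq PBD)
    moreover from this have "cab.run p (inv\<^bsub>B 3\<^esub> x) = inv\<^bsub>B 4\<^esub> cab.run p x" for p
      using cab_inv[of x p] by (simp add: PBD)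
    ultimately show "inv\<^bsub>B 3\<^esub> x \<in> N_PB3 N"
      using x by (auto simp: N_PB3_eq subgroup.m_inv_closed[OF PB_subgroup])
  next
    have "cab.run p \<one>\<^bsub>B 3\<^esub> = \<one>\<^bsub>B 4\<^esub>" for p
      using hom_one[OF cab_hom_B4[of p]] by simp
    then show "\<one>\<^bsub>B 3\<^esub> \<in> N_PB3 N"
      by (auto simp: N_PB3_eq subgroup.one_closed[OF PB_subgroup])
  qed (use N_PB3_sub PB_subset in blast)
  fix x h assume x: "x \<in> carrier (B 3)" and h: "h \<in> N_PB3 N"
  then have hPB: "h \<in> PB 3" by (simp add: N_PB3_eq)
  then have "x \<otimes>\<^bsub>B 3\<^esub> h \<otimes>\<^bsub>B 3\<^esub> inv\<^bsub>B 3\<^esub> x \<in> PB 3"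
    using PB_normal[of 3] x by (simp add: B.normal_inv_iff)
  moreover have "cab.run p (x \<otimes>\<^bsub>B 3\<^esub> h \<otimes>\<^bsub>B 3\<^esub> inv\<^bsub>B 3\<^esub> x) \<in> N" if p: "p \<le> 4" for p
  proof -
    \<comment> \<open>Conjugation by x turns the condition at p into the condition at the state that
      x leads to, which is again at most 4; h is pure and stays there.\<close>
    have "cab.run (pos.next_state p x) h \<in> N"
      using h pos_3(1)[OF x p] by (simp add: N_PB3_eq)
    then have "cab.run p x \<otimes>\<^bsub>B 4\<^esub> cab.run (pos.next_state p x) h \<otimes>\<^bsub>B 4\<^esub> inv\<^bsub>B 4\<^esub> cab.run p x \<in> N"
      using x by (intro N.inv_op_closed2) (simp_all add: cab_closed)
    then show ?thesis
      using x hPB by (simp add: cab_mult cab_inv pos_mult PBD)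
  qed
  ultimately show "x \<otimes>\<^bsub>B 3\<^esub> h \<otimes>\<^bsub>B 3\<^esub> inv\<^bsub>B 3\<^esub> x \<in> N_PB3 N"
    by (simp add: N_PB3_eq)
qed

lemma N_PB3_subgroup: "subgroup (N_PB3 N) (B 3)"
  using N_PB3_normal by (rule normal_imp_subgroup)

text \<open>A braid is recorded by its doublings modulo N together with the states they end in. If a
  and b have the same record, the inverse of b leads back to p, and the doubling of a b^-1 is the
  quotient of the two doublings.\<close>

lemma N_PB3_fin_normal: "N_PB3 N \<in> fin_normal (B 3)"
proof (rule B.fin_normalI[OF N_PB3_normal])
  let ?F = "\<lambda>g. \<lambda>p\<in>{..4}. (N #>\<^bsub>B 4\<^esub> cab.run p g, pos.next_state p g)"
  have "?F ` carrier (B 3) \<subseteq> (\<Pi>\<^sub>E p\<in>{..4}. carrier (B 4 Mod N) \<times> {..4})"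
  proof (intro image_subsetI restrict_PiE_iff[THEN iffD2] ballI SigmaI)
    fix g p assume g: "g \<in> carrier (B 3)" and p: "p \<in> {..4::nat}"
    show "N #>\<^bsub>B 4\<^esub> cab.run p g \<in> carrier (B 4 Mod N)"
      unfolding carrier_FactGroup using cab_closed[OF g] by (rule imageI)
    show "pos.next_state p g \<in> {..4}" using pos_3(1)[OF g] p by simp
  qed
  moreover have "finite (\<Pi>\<^sub>E p\<in>{..4::nat}. carrier (B 4 Mod N) \<times> {..4::nat})"
    using N_finite by (intro finite_PiE) auto
  ultimately show "finite (?F ` carrier (B 3))" by (rule finite_subset)
  fix a b assume ab: "a \<in> carrier (B 3)" "b \<in> carrier (B 3)" and F: "?F a = ?F b"
  have eq: "N #>\<^bsub>B 4\<^esub> cab.run p a = N #>\<^bsub>B 4\<^esub> cab.run p b" "pos.next_state p a = pos.next_state p b"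
    if "p \<le> 4" for p
    using fun_cong[OF F, of p] that by auto
  have "pos.next_state p (a \<otimes>\<^bsub>B 3\<^esub> inv\<^bsub>B 3\<^esub> b) = p" for p
  proof (cases "p \<le> 4")
    case True
    then show ?thesis using ab eq(2)[OF True] by (simp add: pos_mult pos_inv)
  next
    case False
    then show ?thesis using ab pos_3(2) by (simp add: pos_mult)
  qed
  then have "a \<otimes>\<^bsub>B 3\<^esub> inv\<^bsub>B 3\<^esub> b \<in> PB 3" using ab by (simp add: PB_iff)
  moreover have "cab.run p (a \<otimes>\<^bsub>B 3\<^esub> inv\<^bsub>B 3\<^esub> b) \<in> N" if p: "p \<le> 4" for p
  proof -
    have "cab.run p (a \<otimes>\<^bsub>B 3\<^esub> inv\<^bsub>B 3\<^esub> b) = cab.run p a \<otimes>\<^bsub>B 4\<^esub> inv\<^bsub>B 4\<^esub> cab.run p b"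
      using ab eq(2)[OF p] by (simp add: cab_mult cab_inv)
    then show ?thesis
      using eq(1)[OF p] ab B.coset_eq_iff[OF N_subgroup] by (simp add: cab_closed)
  qed
  ultimately show "a \<otimes>\<^bsub>B 3\<^esub> inv\<^bsub>B 3\<^esub> b \<in> N_PB3 N" by (simp add: N_PB3_eq)
qed

lemma fin_normal_PBgrp:
  assumes "M \<in> fin_normal (B n)" "M \<subseteq> PB n"
  shows "M \<in> fin_normal (PBgrp n)"
proof -
  have "M \<lhd> PBgrp n"
    unfolding PBgrp_def using assms by (intro B.normal_restrict_supergroup PB_subgroup fin_normalD)
  moreover have "carrier (PBgrp n Mod M) \<subseteq> carrier (B n Mod M)"
    using PB_subset by (auto simp: carrier_FactGroup)
  ultimately show ?thesis
    using assms(1) finite_subset fin_normalD(2) unfolding fin_normal_def by blast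
qed

lemma N_fin_normal_PB: "N \<in> fin_normal (PBgrp 4)"
  using N_normal N_finite N_PB by (intro fin_normal_PBgrp) (simp_all add: fin_normal_def)

lemma N_PB3_fin_normal_PB: "N_PB3 N \<in> fin_normal (PBgrp 3)"
  using N_PB3_fin_normal N_PB3_sub by (rule fin_normal_PBgrp)

text \<open>Finiteness of the quotient makes the three orders, hence their least common multiple,
  nonzero, so \<open>N_ord N\<close> is a legitimate index for profinite integers.\<close>

lemma N_ord_pos: "0 < N_ord N"
  and N_ord_pow: "g \<in> {xgen 3 1 2, xgen 3 2 3, cgen} \<Longrightarrow> g [^]\<^bsub>B 3\<^esub> N_ord N \<in> N_PB3 N"
proof -
  interpret K: normal "N_PB3 N" "PBgrp 3" using N_PB3_fin_normal_PB by (rule fin_normalD)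
  interpret Q: group "PBgrp 3 Mod N_PB3 N" by (rule K.factorgroup_is_group)
  let ?o = "\<lambda>g. Q.ord (N_PB3 N #>\<^bsub>PBgrp 3\<^esub> g)"
  have fin: "finite (carrier (PBgrp 3 Mod N_PB3 N))" using N_PB3_fin_normal_PB by (rule fin_normalD)
  have pos: "?o g > 0" if "g \<in> PB 3" for g
    using Q.ord_ge_1[OF fin, of "N_PB3 N #>\<^bsub>PBgrp 3\<^esub> g"] that
    by (auto simp: carrier_FactGroup)
  have "(LCM g \<in> {xgen 3 1 2, xgen 3 2 3, cgen}. ?o g) \<noteq> 0"
  proof -
    have "0 \<notin> ?o ` {xgen 3 1 2, xgen 3 2 3, cgen}"
      using pos[of "xgen 3 1 2"] pos[of "xgen 3 2 3"] pos[of cgen] by (auto simp del: PBgrp_simps)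
    then show ?thesis by (simp add: lcm_pos_nat)
  qed
  then show "0 < N_ord N" by (simp add: N_ord_def lcm_pos_nat)
  assume g: "g \<in> {xgen 3 1 2, xgen 3 2 3, cgen}"
  then have gPB: "g \<in> PB 3" by auto
  have "?o g dvd N_ord N"
    unfolding N_ord_def using g by (intro dvd_Lcm) blast
  then have "(N_PB3 N #>\<^bsub>PBgrp 3\<^esub> g) [^]\<^bsub>PBgrp 3 Mod N_PB3 N\<^esub> N_ord N = N_PB3 N"
    using Q.pow_eq_id[of "N_PB3 N #>\<^bsub>PBgrp 3\<^esub> g" "N_ord N"] gPB by (auto simp: carrier_FactGroup)
  then have "N_PB3 N #>\<^bsub>B 3\<^esub> (g [^]\<^bsub>B 3\<^esub> N_ord N) = N_PB3 N"
    using K.FactGroup_pow[of g "N_ord N"] gPB by simp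
  then show "g [^]\<^bsub>B 3\<^esub> N_ord N \<in> N_PB3 N"
    using B.rcos_self[OF _ N_PB3_subgroup, of "g [^]\<^bsub>B 3\<^esub> N_ord N"] gPB by (simp add: PBD)
qed

lemma quot_iota_hom: "(\<lambda>f. N_PB3 N #>\<^bsub>PBgrp 3\<^esub> iota f) \<in> hom F2 (PBgrp 3 Mod N_PB3 N)"
  using hom_compose[OF iota_hom normal.r_coset_hom_Mod[OF fin_normalD(1)[OF N_PB3_fin_normal_PB]]]
  by (simp add: o_def)

lemma quot_iota_group_hom: "group_hom F2 (PBgrp 3 Mod N_PB3 N) (\<lambda>f. N_PB3 N #>\<^bsub>PBgrp 3\<^esub> iota f)"
  unfolding group_hom_def group_hom_axioms_def
  using quot_iota_hom fin_normalD(4)[OF N_PB3_fin_normal_PB] by simp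

lemma N_F2_kernel: "N_F2 N = kernel F2 (PBgrp 3 Mod N_PB3 N) (\<lambda>f. N_PB3 N #>\<^bsub>PBgrp 3\<^esub> iota f)"
proof -
  have "N_PB3 N #>\<^bsub>B 3\<^esub> iota f = N_PB3 N \<longleftrightarrow> iota f \<in> N_PB3 N" if "f \<in> carrier F2" for f
    using that B.rcos_self[OF _ N_PB3_subgroup] B.coset_join2[OF _ N_PB3_subgroup]
    by (metis PBD(1) iota_closed)
  then show ?thesis by (auto simp: N_F2_def kernel_def)
qed

lemma N_F2_fin_normal: "N_F2 N \<in> fin_normal F2"
  unfolding N_F2_kernel
proof (rule group_hom.kernel_fin_normal[OF quot_iota_group_hom])
  show "finite ((\<lambda>f. N_PB3 N #>\<^bsub>PBgrp 3\<^esub> iota f) ` carrier F2)"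
    using hom_carrier[OF quot_iota_hom] fin_normalD(2)[OF N_PB3_fin_normal_PB] by (rule finite_subset)
qed

lemma N_PB3_phi: "g \<in> N_PB3 N \<Longrightarrow> p \<le> 4 \<Longrightarrow> cab.run p g \<in> N"
  by (simp add: N_PB3_eq)

end

section \<open>Shadows of elements of the profinite group\<close>

text \<open>At k the family \<open>zhat_odd m\<close> holds 2 m + 1 reduced modulo k, and the
  reduction is invisible because k annihilates the coset of g.\<close>

lemma (in group) prof_pow_odd_eq:
  assumes m: "m \<in> Zhat" and N: "N \<in> fin_normal G" and g: "g \<in> carrier G" "g [^] k \<in> N" "0 < (k::nat)"
  shows "prof_pow G (eta G g) (zhat_odd m) N = N #> (g [^] (2 * m k + 1))"
proof -
  interpret N: normal N G using N by (rule fin_normalD)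
  interpret Q: group "G Mod N" by (rule N.factorgroup_is_group)
  let ?a = "2 * m k + 1" and ?x = "N #> g"
  have x: "?x \<in> carrier (G Mod N)" using g by (auto simp: carrier_FactGroup)
  have "?x [^]\<^bsub>G Mod N\<^esub> k = \<one>\<^bsub>G Mod N\<^esub>"
    using g by (simp add: N.FactGroup_pow coset_join2 N.subgroup_axioms)
  then have "int (Q.ord ?x) dvd int k" using Q.pow_eq_id x by simp
  then have "int (Q.ord ?x) dvd ?a - ?a mod int k"
    by (metis dvd_minus_mod dvd_trans)
  then have "?x [^]\<^bsub>G Mod N\<^esub> (?a mod int k) = ?x [^]\<^bsub>G Mod N\<^esub> ?a"
    using Q.int_pow_eq x by simp
  then show ?thesis
    using prof_pow_eta_eq[OF zhat_odd_closed[OF m] N g] g by (simp add: zhat_odd_def N.FactGroup_int_pow)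
qed

lemma (in group) int_pow_commute:
  assumes "x \<in> carrier G" "y \<in> carrier G" "x \<otimes> y = y \<otimes> x"
  shows "x [^] (k :: int) \<otimes> y = y \<otimes> x [^] k"
proof -
  have "x \<otimes> inv y = inv y \<otimes> x"
    using assms by (metis inv_closed inv_solve_left inv_solve_right m_assoc m_closed)
  have "group_hom G G (\<lambda>t. y \<otimes> t \<otimes> inv y)"
    using assms(2) by (auto simp: group_hom_def group_hom_axioms_def hom_def m_assoc is_group)
  then have "y \<otimes> (x [^] k) \<otimes> inv y = (y \<otimes> x \<otimes> inv y) [^] k"
    using assms(1) by (rule group_hom.hom_int_pow)
  also have "y \<otimes> x \<otimes> inv y = x" using assms by (metis inv_solve_right' m_closed)
  finally show ?thesis using assms by (metis inv_solve_right' int_pow_closed m_closed)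
qed

lemma hexagons_hom:
  assumes "group_hom G H h" "hexagons G s1 s2 p q z f"
    and "s1 \<in> carrier G" "s2 \<in> carrier G" "p \<in> carrier G" "q \<in> carrier G" "z \<in> carrier G" "f \<in> carrier G"
  shows "hexagons H (h s1) (h s2) (h p) (h q) (h z) (h f)"
proof -
  interpret group_hom G H h by fact
  have "h (s1 \<otimes>\<^bsub>G\<^esub> p \<otimes>\<^bsub>G\<^esub> inv\<^bsub>G\<^esub> f \<otimes>\<^bsub>G\<^esub> s2 \<otimes>\<^bsub>G\<^esub> q \<otimes>\<^bsub>G\<^esub> f)
       = h (inv\<^bsub>G\<^esub> f \<otimes>\<^bsub>G\<^esub> s1 \<otimes>\<^bsub>G\<^esub> s2 \<otimes>\<^bsub>G\<^esub> inv\<^bsub>G\<^esub> p \<otimes>\<^bsub>G\<^esub> z)"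
    "h (inv\<^bsub>G\<^esub> f \<otimes>\<^bsub>G\<^esub> s2 \<otimes>\<^bsub>G\<^esub> q \<otimes>\<^bsub>G\<^esub> f \<otimes>\<^bsub>G\<^esub> s1 \<otimes>\<^bsub>G\<^esub> p)
       = h (s2 \<otimes>\<^bsub>G\<^esub> s1 \<otimes>\<^bsub>G\<^esub> inv\<^bsub>G\<^esub> q \<otimes>\<^bsub>G\<^esub> z \<otimes>\<^bsub>G\<^esub> f)"
    using assms(2) by (simp_all only: hexagons_def)
  then show ?thesis
    using assms(3-) by (simp add: hexagons_def)
qed

lemma (in group) fin_normal_dvd:
  assumes "h \<in> hom G integer_group" "k \<in> hom G integer_group" "0 < n"
  shows "{g \<in> carrier G. int n dvd h g \<and> int n dvd k g} \<in> fin_normal G"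
proof (rule fin_normalI[where F = "\<lambda>g. (h g mod int n, k g mod int n)"])
  interpret h: group_hom G integer_group h
    by (simp add: group_hom_def group_hom_axioms_def assms is_group)
  interpret k: group_hom G integer_group k
    by (simp add: group_hom_def group_hom_axioms_def assms is_group)
  let ?M = "{g \<in> carrier G. int n dvd h g \<and> int n dvd k g}"
  have "subgroup ?M G"
    by standard auto
  then show "?M \<lhd> G"
    by (auto simp: normal_inv_iff)
  have "(\<lambda>g. (h g mod int n, k g mod int n)) ` carrier G \<subseteq> {0..<int n} \<times> {0..<int n}"
    using assms(3) by auto
  then show "finite ((\<lambda>g. (h g mod int n, k g mod int n)) ` carrier G)"
    by (rule finite_subset) simp
  fix a b assume "a \<in> carrier G" "b \<in> carrier G" "(h a mod int n, k a mod int n) = (h b mod int n, k b mod int n)"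
  then show "a \<otimes> inv b \<in> ?M" by (auto simp: mod_eq_dvd_iff)
qed

text \<open>In the abelianization of F_2 / M the class of g is a product of powers of the classes of
  x and y, with the exponent sums as exponents; multiples of the group order kill both
  factors.\<close>

lemma F2_mod_derived:
  assumes M: "M \<in> fin_normal F2" and g: "g \<in> carrier F2"
    and "int (order (F2 Mod M)) dvd expo_x g" "int (order (F2 Mod M)) dvd expo_y g"
  shows "M #>\<^bsub>F2\<^esub> g \<in> derived (F2 Mod M) (carrier (F2 Mod M))"
proof -
  let ?Q = "F2 Mod M"
  interpret M: normal M F2 using M by (rule fin_normalD)
  interpret Q: group ?Q by (rule M.factorgroup_is_group)
  let ?D = "derived ?Q (carrier ?Q)"
  interpret D: normal ?D ?Q by (rule Q.derived_self_is_normal)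
  interpret A: comm_group "?Q Mod ?D" by (rule Q.derived_quot_is_comm_group)
  define \<zeta> where "\<zeta> a = ?D #>\<^bsub>?Q\<^esub> (M #>\<^bsub>F2\<^esub> a)" for a
  have \<zeta>: "\<zeta> \<in> hom F2 (?Q Mod ?D)"
    using hom_compose[OF M.r_coset_hom_Mod D.r_coset_hom_Mod] by (simp add: o_def \<zeta>_def[abs_def])
  \<comment> \<open>Being a homomorphism depends on the target being commutative, which is why the
    quotient by the derived subgroup is taken first.\<close>
  define \<xi> where "\<xi> a = (\<zeta> F2x [^]\<^bsub>?Q Mod ?D\<^esub> expo_x a) \<otimes>\<^bsub>?Q Mod ?D\<^esub> (\<zeta> F2y [^]\<^bsub>?Q Mod ?D\<^esub> expo_y a)" for a
  have c: "\<zeta> F2x \<in> carrier (?Q Mod ?D)" "\<zeta> F2y \<in> carrier (?Q Mod ?D)"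
    using hom_in_carrier[OF \<zeta>] by simp_all
  have "\<xi> \<in> hom F2 (?Q Mod ?D)"
    unfolding \<xi>_def
    using hom_compose[OF expo_hom(1) A.hom_integer_group_pow[OF c(1)]]
      hom_compose[OF expo_hom(2) A.hom_integer_group_pow[OF c(2)]]
    by (intro A.hom_group_mult) (simp_all add: o_def)
  moreover have "\<zeta> F2x = \<xi> F2x" "\<zeta> F2y = \<xi> F2y"
    unfolding \<xi>_def expo_gen int_pow_0 A.int_pow_1[OF c(1)] A.int_pow_1[OF c(2)] A.r_one[OF c(1)] A.l_one[OF c(2)]
    by simp_all
  ultimately have eq: "\<zeta> g = \<xi> g"
    using g by (rule F2_hom_unique[OF A.is_group \<zeta>])
  have pow: "\<zeta> a [^]\<^bsub>?Q Mod ?D\<^esub> k = \<one>\<^bsub>?Q Mod ?D\<^esub>"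
    if a: "a \<in> carrier F2" and k: "int (order ?Q) dvd k" for a k
  proof -
    have Ma: "M #>\<^bsub>F2\<^esub> a \<in> carrier ?Q" using a by (auto simp: carrier_FactGroup)
    then have "int (Q.ord (M #>\<^bsub>F2\<^esub> a)) dvd k"
      using Q.ord_dvd_group_order k by (meson dvd_trans int_dvd_int_iff)
    then have "(M #>\<^bsub>F2\<^esub> a) [^]\<^bsub>?Q\<^esub> k = \<one>\<^bsub>?Q\<^esub>"
      using Q.int_pow_eq_id[OF Ma] by blast
    then show ?thesis
      using D.FactGroup_int_pow[OF Ma, of k] Q.coset_mult_one[OF D.subset] by (simp add: \<zeta>_def)
  qed
  have "\<xi> g = \<one>\<^bsub>?Q Mod ?D\<^esub>"
    unfolding \<xi>_def pow[OF F2_gen_closed(1) assms(3)] pow[OF F2_gen_closed(2) assms(4)] by (rule A.l_one[OF A.one_closed])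
  then have "?D #>\<^bsub>?Q\<^esub> (M #>\<^bsub>F2\<^esub> g) = ?D" using eq by (simp add: \<zeta>_def)
  moreover have "M #>\<^bsub>F2\<^esub> g \<in> carrier ?Q" using g by (auto simp: carrier_FactGroup)
  ultimately show ?thesis
    using Q.rcos_self[OF _ D.subgroup_axioms] by metis
qed

section \<open>An element of the profinite group at a fixed object\<close>

context
  fixes N m f assumes NFI: "N \<in> NFI" and T: "(m, f) \<in> carrier GThat"
begin

lemma gt_pair: "m \<in> Zhat" "f \<in> carrier F2hat"
  "hexagons (profinite (B 3)) (eta (B 3) (sigma 3 1)) (eta (B 3) (sigma 3 2))
     (prof_pow (B 3) (eta (B 3) (xgen 3 1 2)) m) (prof_pow (B 3) (eta (B 3) (xgen 3 2 3)) m)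
     (prof_pow (B 3) (eta (B 3) cgen) m)
     (cont_ext F2 (profinite (B 3)) (profinite_top (B 3)) (\<lambda>g. eta (B 3) (iota g)) f)"
  "pentagon (profinite (PBgrp 4))
     (\<lambda>\<phi>. cont_ext F2 (profinite (PBgrp 4)) (profinite_top (PBgrp 4))
             (\<lambda>g. eta (PBgrp 4) (\<phi> (iota g))) f)"
  using T by (auto simp: GThat_def units_of_def Units_def GThat_monoid_def GThat_pairs_def)

lemma inverse_pair:
  obtains m' f' where "m' \<in> Zhat" "f' \<in> carrier F2hat" "zhat_comp m m' = zhat_zero"
    "f \<otimes>\<^bsub>F2hat\<^esub> gt_end (m, f) f' = \<one>\<^bsub>F2hat\<^esub>"
  using T that by (fastforce simp: GThat_def units_of_def Units_def GThat_monoid_def GThat_pairs_def)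

definition theta :: "f2 \<Rightarrow> f2hat" where
  "theta = F2_hom F2hat (prof_pow F2 (eta F2 F2x) (zhat_odd m))
     (inv\<^bsub>F2hat\<^esub> f \<otimes>\<^bsub>F2hat\<^esub> prof_pow F2 (eta F2 F2y) (zhat_odd m) \<otimes>\<^bsub>F2hat\<^esub> f)"

interpretation F2hat: group F2hat
  by (rule group_profinite)

lemma theta_props: "theta \<in> hom F2 F2hat"
  "theta F2x = prof_pow F2 (eta F2 F2x) (zhat_odd m)"
  "theta F2y = inv\<^bsub>F2hat\<^esub> f \<otimes>\<^bsub>F2hat\<^esub> prof_pow F2 (eta F2 F2y) (zhat_odd m) \<otimes>\<^bsub>F2hat\<^esub> f"
proof -
  have "prof_pow F2 (eta F2 F2x) (zhat_odd m) \<in> carrier F2hat"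
    "inv\<^bsub>F2hat\<^esub> f \<otimes>\<^bsub>F2hat\<^esub> prof_pow F2 (eta F2 F2y) (zhat_odd m) \<otimes>\<^bsub>F2hat\<^esub> f \<in> carrier F2hat"
    using gt_pair(2) F2.prof_pow_closed[OF zhat_odd_closed[OF gt_pair(1)]] by simp_all
  from F2_hom_props[OF F2hat.is_group this] show "theta \<in> hom F2 F2hat"
    "theta F2x = prof_pow F2 (eta F2 F2x) (zhat_odd m)"
    "theta F2y = inv\<^bsub>F2hat\<^esub> f \<otimes>\<^bsub>F2hat\<^esub> prof_pow F2 (eta F2 F2y) (zhat_odd m) \<otimes>\<^bsub>F2hat\<^esub> f"
    by (simp_all add: theta_def)
qed

lemma gt_end_eq: "gt_end (m, f) = cont_ext F2 F2hat (profinite_top F2) theta"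
  by (simp add: gt_end_def theta_def)

lemma F2_gen_pow_N_ord: "g \<in> {F2x, F2y} \<Longrightarrow> g [^]\<^bsub>F2\<^esub> N_ord N \<in> N_F2 N"
proof -
  assume g: "g \<in> {F2x, F2y}"
  then have gF: "g \<in> carrier F2" by auto
  have "iota (g [^]\<^bsub>F2\<^esub> N_ord N) = iota g [^]\<^bsub>B 3\<^esub> N_ord N"
    using hom_nat_pow[OF iota_hom gF, of "N_ord N"] by simp
  also have "\<dots> \<in> N_PB3 N"
    using g by (intro N_ord_pow[OF NFI]) auto
  finally show ?thesis using gF by (simp add: N_F2_def)
qed

abbreviation e :: int where "e \<equiv> 2 * m (N_ord N) + 1"

text \<open>Both sides are homomorphisms of F_2, compared on x and y, where the approximations
  \<open>e\<close> and f0 can be substituted. With H a symmetric group it compares the actions on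
  drawings; with H the quotient of PB_3 it enters the surjectivity proof.\<close>

lemma ext_theta:
  assumes \<psi>: "group_hom F2 H \<psi>" "finite (carrier H)" "N_F2 N \<subseteq> kernel F2 H \<psi>"
    and f0: "f0 \<in> f (N_F2 N)" and g: "g \<in> carrier F2"
  shows "cont_ext F2 H (discrete_topology (carrier H)) \<psi> (theta g) =
    F2_hom H (\<psi> (F2x [^]\<^bsub>F2\<^esub> e)) (\<psi> (inv\<^bsub>F2\<^esub> f0 \<otimes>\<^bsub>F2\<^esub> F2y [^]\<^bsub>F2\<^esub> e \<otimes>\<^bsub>F2\<^esub> f0)) g"
proof -
  interpret \<psi>: group_hom F2 H \<psi> by fact
  let ?L = "N_F2 N" and ?k = "cont_ext F2 H (discrete_topology (carrier H)) \<psi>"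
  have L: "?L \<in> fin_normal F2" using NFI by (rule N_F2_fin_normal)
  have k: "?k \<in> hom F2hat H" using \<psi>(2) by (rule \<psi>.cont_ext_finite_hom)
  interpret k: group_hom F2hat H ?k by (simp add: group_hom_def group_hom_axioms_def k F2hat.is_group \<psi>.H.is_group)
  note k_eq = \<psi>.cont_ext_finite_eq[OF \<psi>(2) _ L \<psi>(3)]
  have f0F: "f0 \<in> carrier F2" using F2.profinite_mem(2)[OF gt_pair(2) L L _ f0] by simp
  have pow: "?k (prof_pow F2 (eta F2 a) (zhat_odd m)) = \<psi> (a [^]\<^bsub>F2\<^esub> e)" if a: "a \<in> {F2x, F2y}" for a
  proof (rule k_eq)
    have aF: "a \<in> carrier F2" using a by auto
    show "prof_pow F2 (eta F2 a) (zhat_odd m) \<in> carrier F2hat"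
      using aF by (intro F2.prof_pow_closed zhat_odd_closed gt_pair)
    show "a [^]\<^bsub>F2\<^esub> e \<in> prof_pow F2 (eta F2 a) (zhat_odd m) ?L"
      unfolding F2.prof_pow_odd_eq[OF gt_pair(1) L aF F2_gen_pow_N_ord[OF a] N_ord_pos[OF NFI]]
      using aF fin_normalD(3)[OF L] by (intro F2.rcos_self) auto
  qed
  let ?h = "restrict (\<lambda>g. ?k (theta g)) (carrier F2)"
  have "(\<lambda>g. ?k (theta g)) \<in> hom F2 H"
    using hom_compose[OF theta_props(1) k] by (simp add: o_def)
  then have h: "?h \<in> hom F2 H" by (auto simp: hom_def)
  have "?h F2y = inv\<^bsub>H\<^esub> \<psi> f0 \<otimes>\<^bsub>H\<^esub> \<psi> (F2y [^]\<^bsub>F2\<^esub> e) \<otimes>\<^bsub>H\<^esub> \<psi> f0"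
    using pow[of F2y] k_eq[OF gt_pair(2) f0] gt_pair(2) F2.prof_pow_closed[OF zhat_odd_closed[OF gt_pair(1)]]
    by (simp add: theta_props(3))
  then have "F2_hom H (\<psi> (F2x [^]\<^bsub>F2\<^esub> e)) (\<psi> (inv\<^bsub>F2\<^esub> f0 \<otimes>\<^bsub>F2\<^esub> F2y [^]\<^bsub>F2\<^esub> e \<otimes>\<^bsub>F2\<^esub> f0)) = ?h"
    using h pow[of F2x] f0F by (intro F2_hom_eqI) (simp_all add: theta_props(2))
  then show ?thesis using g by simp
qed

text \<open>M is left free because two quotients are needed: M = N gives the pentagon condition on
  the shadow, and linking numbers modulo n give the charming property.\<close>

lemma pentagon_quotient:
  assumes M: "M \<in> fin_normal (PBgrp 4)" and L: "L \<in> fin_normal F2"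
    and LM: "\<And>a p. a \<in> L \<Longrightarrow> p \<le> 4 \<Longrightarrow> cab.run p (iota a) \<in> M" and f1: "f1 \<in> f L"
  shows "M #>\<^bsub>B 4\<^esub> (cab.run 0 (iota f1) \<otimes>\<^bsub>B 4\<^esub> cab.run 2 (iota f1) \<otimes>\<^bsub>B 4\<^esub> cab.run 4 (iota f1))
    = M #>\<^bsub>B 4\<^esub> (cab.run 3 (iota f1) \<otimes>\<^bsub>B 4\<^esub> cab.run 1 (iota f1))"
proof -
  interpret M: normal M "PBgrp 4" using M by (rule fin_normalD)
  have f1F: "f1 \<in> carrier F2" using F2.profinite_mem(2)[OF gt_pair(2) L L _ f1] by simp
  let ?e = "\<lambda>\<phi>. cont_ext F2 (profinite (PBgrp 4)) (profinite_top (PBgrp 4)) (\<lambda>g. eta (PBgrp 4) (\<phi> (iota g))) f"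
  have eval: "?e \<phi> M = M #>\<^bsub>PBgrp 4\<^esub> cab.run p (iota f1)"
    if p: "p \<le> 4" and \<phi>: "\<And>g. g \<in> PB 3 \<Longrightarrow> \<phi> g = cab.run p g" for \<phi> p
  proof -
    let ?h = "\<lambda>g. eta (PBgrp 4) (\<phi> (iota g))"
    have c: "cab.run p (iota g) \<in> PB 4" if "g \<in> carrier F2" for g
      using that p by (simp add: cab_PB4)
    have h: "?h \<in> hom F2 (profinite (PBgrp 4))"
    proof (rule homI)
      fix x y assume xy: "x \<in> carrier F2" "y \<in> carrier F2"
      have "\<phi> (iota (x \<otimes>\<^bsub>F2\<^esub> y)) = cab.run p (iota x) \<otimes>\<^bsub>PBgrp 4\<^esub> cab.run p (iota y)"
        using xy hom_mult[OF hom_compose[OF iota_hom cab_hom[OF p]], of x y] \<phi> by simp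
      then show "?h (x \<otimes>\<^bsub>F2\<^esub> y) = ?h x \<otimes>\<^bsub>profinite (PBgrp 4)\<^esub> ?h y"
        using xy hom_mult[OF PB.eta_hom[of 4], of "cab.run p (iota x)" "cab.run p (iota y)"] c \<phi> by simp
    next
      fix x assume "x \<in> carrier F2"
      then show "?h x \<in> carrier (profinite (PBgrp 4))" using c \<phi> by simp
    qed
    have "?e \<phi> M = ?h f1 M"
    proof (rule cont_ext_profinite_eq[OF F2_group h gt_pair(2) L M _ f1])
      fix a assume a: "a \<in> L"
      then have "a \<in> carrier F2" using fin_normalD(3)[OF L] by (rule subgroup.mem_carrier[rotated])
      then show "?h a M = M"
        using PB.coset_join2[OF _ M.subgroup_axioms, of "cab.run p (iota a)"] LM[OF a p] c \<phi> M
        by (simp add: eta_apply)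
    qed
    then show ?thesis using \<phi> f1F M by (simp add: eta_apply)
  qed
  have c: "cab.run p (iota f1) \<in> carrier (PBgrp 4)" if "p \<le> 4" for p
    using that f1F by (simp add: cab_PB4)
  have "(?e phi_234 \<otimes>\<^bsub>profinite (PBgrp 4)\<^esub> ?e phi_1_23_4 \<otimes>\<^bsub>profinite (PBgrp 4)\<^esub> ?e phi_123) M
      = (?e phi_1_2_34 \<otimes>\<^bsub>profinite (PBgrp 4)\<^esub> ?e phi_12_3_4) M"
    using gt_pair(4) by (simp only: pentagon_def)
  then have "M #>\<^bsub>PBgrp 4\<^esub> cab.run 0 (iota f1) <#>\<^bsub>PBgrp 4\<^esub> (M #>\<^bsub>PBgrp 4\<^esub> cab.run 2 (iota f1)) <#>\<^bsub>PBgrp 4\<^esub> (M #>\<^bsub>PBgrp 4\<^esub> cab.run 4 (iota f1))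
      = M #>\<^bsub>PBgrp 4\<^esub> cab.run 3 (iota f1) <#>\<^bsub>PBgrp 4\<^esub> (M #>\<^bsub>PBgrp 4\<^esub> cab.run 1 (iota f1))"
    using M eval[of 0 phi_234] eval[of 2 phi_1_23_4] eval[of 4 phi_123] eval[of 3 phi_1_2_34] eval[of 1 phi_12_3_4] phi_eq
    by (simp add: mult_profinite del: PBgrp_simps)
  then have "M #>\<^bsub>PBgrp 4\<^esub> (cab.run 0 (iota f1) \<otimes>\<^bsub>PBgrp 4\<^esub> cab.run 2 (iota f1) \<otimes>\<^bsub>PBgrp 4\<^esub> cab.run 4 (iota f1))
      = M #>\<^bsub>PBgrp 4\<^esub> (cab.run 3 (iota f1) \<otimes>\<^bsub>PBgrp 4\<^esub> cab.run 1 (iota f1))"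
    using c PB.m_closed[of _ 4] by (simp add: M.rcos_sum del: PBgrp_simps)
  then show ?thesis by simp
qed

text \<open>Linking numbers modulo n cut out a normal subgroup of finite index in PB_4, so the
  pentagon can be evaluated there.\<close>

lemma expo_dvd:
  assumes n: "0 < n" and f1: "f1 \<in> f {g \<in> carrier F2. int n dvd expo_x g \<and> int n dvd expo_y g}"
  shows "int n dvd expo_x f1" "int n dvd expo_y f1"
proof -
  let ?L = "{g \<in> carrier F2. int n dvd expo_x g \<and> int n dvd expo_y g}"
  let ?M = "{g \<in> carrier (PBgrp 4). int n dvd link.run (1, 2) g \<and> int n dvd link.run (3, 4) g}"
  have L: "?L \<in> fin_normal F2" using expo_hom n by (rule F2.fin_normal_dvd)
  have M: "?M \<in> fin_normal (PBgrp 4)" using link_hom link_hom n by (rule PB.fin_normal_dvd)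
  have f1F: "f1 \<in> carrier F2" using F2.profinite_mem(2)[OF gt_pair(2) L L _ f1] by simp
  let ?c = "\<lambda>p. cab.run p (iota f1)"
  have c: "?c p \<in> PB 4" if "p \<le> 4" for p using that f1F by (simp add: cab_PB4)
  have c': "?c p \<in> carrier (PBgrp 4)" if "p \<le> 4" for p using c that by simp
  let ?A = "?c 0 \<otimes>\<^bsub>PBgrp 4\<^esub> ?c 2 \<otimes>\<^bsub>PBgrp 4\<^esub> ?c 4" and ?B = "?c 3 \<otimes>\<^bsub>PBgrp 4\<^esub> ?c 1"
  have AB: "?A \<in> carrier (PBgrp 4)" "?B \<in> carrier (PBgrp 4)"
    by (intro PB.m_closed; simp add: c)+
  have "?M #>\<^bsub>B 4\<^esub> (?c 0 \<otimes>\<^bsub>B 4\<^esub> ?c 2 \<otimes>\<^bsub>B 4\<^esub> ?c 4) = ?M #>\<^bsub>B 4\<^esub> (?c 3 \<otimes>\<^bsub>B 4\<^esub> ?c 1)"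
  proof (rule pentagon_quotient[OF M L _ f1])
    fix a and p :: nat assume a: "a \<in> ?L" and p: "p \<le> 4"
    have "p = 0 \<or> p = 1 \<or> p = 2 \<or> p = 3 \<or> p = 4" using p by linarith
    then show "cab.run p (iota a) \<in> ?M"
      using a cab_PB4[OF iota_closed p, of a] by (elim disjE) (simp_all add: link_cab_iota)
  qed
  then have "?A \<otimes>\<^bsub>PBgrp 4\<^esub> inv\<^bsub>PBgrp 4\<^esub> ?B \<in> ?M"
    using PB.coset_eq_iff[OF fin_normalD(3)[OF M] AB] by simp
  moreover have "link.run ij (?A \<otimes>\<^bsub>PBgrp 4\<^esub> inv\<^bsub>PBgrp 4\<^esub> ?B) =
      link.run ij (?c 0) + link.run ij (?c 2) + link.run ij (?c 4) - (link.run ij (?c 3) + link.run ij (?c 1))" for ij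
  proof -
    interpret l: group_hom "PBgrp 4" integer_group "link.run ij"
      using link_hom[of "fst ij" "snd ij"] by (simp add: group_hom_def group_hom_axioms_def)
    show ?thesis
      using AB c' by (simp del: PBgrp_simps inv_PBgrp)
  qed
  \<comment> \<open>For (1, 2) the sum is \<open>0 + expo_x f1 + expo_x f1 - (expo_x f1 + 0)\<close>
    and for (3, 4) it is \<open>expo_y f1 + expo_y f1 + 0 - (0 + expo_y f1)\<close>, so one copy
    survives.\<close>
  ultimately show "int n dvd expo_x f1" "int n dvd expo_y f1"
    using f1F by (simp_all add: link_cab_iota)
qed

text \<open>The composition law on m makes 2 m + 1 multiplicative, so an inverse pair with first
  entry m' yields 2 m' + 1 as the inverse modulo \<open>N_ord N\<close>.\<close>

lemma e_unit: "\<exists>k. (e * k) mod int (N_ord N) = 1 mod int (N_ord N)"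
proof -
  obtain m' where m': "zhat_comp m m' = zhat_zero" by (rule inverse_pair)
  let ?n = "int (N_ord N)" and ?a = "m (N_ord N)" and ?b = "m' (N_ord N)"
  have "(2 * ?a * ?b + ?a + ?b) mod ?n = 0"
    using fun_cong[OF m', of "N_ord N"] N_ord_pos[OF NFI] by (simp add: zhat_comp_def zhat_zero_def)
  then have "?n dvd 2 * (2 * ?a * ?b + ?a + ?b)" by (metis dvd_eq_mod_eq_0 dvd_mult)
  also have "2 * (2 * ?a * ?b + ?a + ?b) = e * (2 * ?b + 1) - 1" by (simp add: algebra_simps)
  finally show ?thesis by (auto simp: mod_eq_dvd_iff intro!: exI[of _ "2 * ?b + 1"])
qed

context
  fixes f0 assumes f0: "f0 \<in> f (N_F2 N)"
begin

lemma f0_closed [simp]: "f0 \<in> carrier F2"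
  using F2.profinite_mem(2)[OF gt_pair(2) _ _ _ f0] N_F2_fin_normal[OF NFI] by blast

lemma shadow_of_eq: "shadow_of N (m, f) = shadow_class N (m (N_ord N)) f0"
proof -
  have "cont_ext F2 (PBgrp 3 Mod N_PB3 N) (discrete_topology (carrier (PBgrp 3 Mod N_PB3 N)))
      (\<lambda>g. N_PB3 N #>\<^bsub>PBgrp 3\<^esub> iota g) f = N_PB3 N #>\<^bsub>PBgrp 3\<^esub> iota f0"
    using gt_pair(2) f0 fin_normalD(2)[OF N_PB3_fin_normal_PB[OF NFI]] N_F2_kernel[OF NFI]
    by (intro group_hom.cont_ext_finite_eq[OF quot_iota_group_hom[OF NFI] _ _ N_F2_fin_normal[OF NFI]]) simp_all
  then show ?thesis by (simp add: shadow_of_def shadow_class_def)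
qed

text \<open>Stated for an arbitrary representative, because \<open>shadow_act\<close> takes the
  union over all of them.\<close>

lemma shadow_twist_eq:
  assumes "group_hom F2 (sym_group d) \<psi>" "N_F2 N \<subseteq> kernel F2 (sym_group d) \<psi>"
    and rep: "(m1, f1) \<in> shadow_reps N (shadow_of N (m, f))"
  shows "shadow_twist d m1 f1 \<psi> = (\<lambda>g \<in> carrier F2. hat_ext d \<psi> (gt_end (m, f) (eta F2 g)))"
proof -
  interpret \<psi>: group_hom F2 "sym_group d" \<psi> by fact
  have f1: "f1 \<in> carrier F2" and cls: "shadow_class N m1 f1 = shadow_class N (m (N_ord N)) f0"
    using rep shadow_of_eq by (auto simp: shadow_reps_def)
  have coset: "N_PB3 N #>\<^bsub>PBgrp 3\<^esub> iota f1 = N_PB3 N #>\<^bsub>PBgrp 3\<^esub> iota f0"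
    and res: "residue_class (N_ord N) m1 = residue_class (N_ord N) (m (N_ord N))"
    using cls by (simp_all add: shadow_class_def)
  have "m1 \<in> residue_class (N_ord N) m1" by (auto simp: residue_class_def intro: exI[of _ 0])
  then obtain t where t: "m1 = m (N_ord N) + int (N_ord N) * t"
    unfolding res by (auto simp: residue_class_def)
  have \<psi>_pow: "\<psi> (a [^]\<^bsub>F2\<^esub> (2 * m1 + 1)) = \<psi> (a [^]\<^bsub>F2\<^esub> e)" if a: "a \<in> {F2x, F2y}" for a
  proof -
    have aF: "a \<in> carrier F2" using a by auto
    have "\<psi> (a [^]\<^bsub>F2\<^esub> N_ord N) = \<one>\<^bsub>sym_group d\<^esub>"
      using F2_gen_pow_N_ord[OF a] assms(2) by (auto simp: kernel_def)
    then have "\<psi> a [^]\<^bsub>sym_group d\<^esub> N_ord N = \<one>\<^bsub>sym_group d\<^esub>" using \<psi>.hom_nat_pow aF by simp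
    then have "int (\<psi>.H.ord (\<psi> a)) dvd int (N_ord N)" using \<psi>.H.pow_eq_id aF by simp
    then have "int (\<psi>.H.ord (\<psi> a)) dvd e - (2 * m1 + 1)"
      by (simp add: t algebra_simps) 
    then have "\<psi> a [^]\<^bsub>sym_group d\<^esub> (2 * m1 + 1) = \<psi> a [^]\<^bsub>sym_group d\<^esub> e"
      using \<psi>.H.int_pow_eq aF by simp
    then show ?thesis using \<psi>.hom_int_pow aF by simp
  qed
  have "iota f1 \<otimes>\<^bsub>PBgrp 3\<^esub> inv\<^bsub>PBgrp 3\<^esub> iota f0 \<in> N_PB3 N"
    using coset PB.coset_eq_iff[OF fin_normalD(3)[OF N_PB3_fin_normal_PB[OF NFI]]] f1 by simp
  moreover have "iota (f1 \<otimes>\<^bsub>F2\<^esub> inv\<^bsub>F2\<^esub> f0) = iota f1 \<otimes>\<^bsub>PBgrp 3\<^esub> inv\<^bsub>PBgrp 3\<^esub> iota f0"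
  proof -
    interpret i: group_hom F2 "PBgrp 3" iota by (simp add: group_hom_def group_hom_axioms_def iota_hom)
    show ?thesis using f1 by (simp del: PBgrp_simps inv_PBgrp)
  qed
  ultimately have "f1 \<otimes>\<^bsub>F2\<^esub> inv\<^bsub>F2\<^esub> f0 \<in> N_F2 N" using f1 by (simp add: N_F2_def)
  then have "\<psi> (f1 \<otimes>\<^bsub>F2\<^esub> inv\<^bsub>F2\<^esub> f0) = \<one>\<^bsub>sym_group d\<^esub>" using assms(2) by (auto simp: kernel_def)
  then have "\<psi> f1 \<otimes>\<^bsub>sym_group d\<^esub> inv\<^bsub>sym_group d\<^esub> \<psi> f0 = \<one>\<^bsub>sym_group d\<^esub>"
    using f1 by (simp del: sym_group_inv_equality)
  then have \<psi>f: "\<psi> f1 = \<psi> f0"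
    using f1 f0_closed \<psi>.hom_closed by (metis \<psi>.H.inv_closed \<psi>.H.inv_equality \<psi>.H.inv_inv)
  have "\<psi> (inv\<^bsub>F2\<^esub> f1 \<otimes>\<^bsub>F2\<^esub> F2y [^]\<^bsub>F2\<^esub> (2 * m1 + 1) \<otimes>\<^bsub>F2\<^esub> f1)
      = \<psi> (inv\<^bsub>F2\<^esub> f0 \<otimes>\<^bsub>F2\<^esub> F2y [^]\<^bsub>F2\<^esub> e \<otimes>\<^bsub>F2\<^esub> f0)"
    using f1 \<psi>_pow[of F2y] \<psi>f by (simp del: sym_group_inv_equality)
  then have tw: "shadow_twist d m1 f1 \<psi> =
      F2_hom (sym_group d) (\<psi> (F2x [^]\<^bsub>F2\<^esub> e)) (\<psi> (inv\<^bsub>F2\<^esub> f0 \<otimes>\<^bsub>F2\<^esub> F2y [^]\<^bsub>F2\<^esub> e \<otimes>\<^bsub>F2\<^esub> f0))"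
    using \<psi>_pow[of F2x] by (simp add: shadow_twist_def)
  have fin: "finite (carrier (sym_group d))"
    by (simp add: sym_group_def finite_permutations)
  show ?thesis
  proof (rule extensionalityI[of _ "carrier F2"])
    show "shadow_twist d m1 f1 \<psi> \<in> extensional (carrier F2)"
      unfolding tw by (intro F2_hom_props(2)) (simp_all add: \<psi>.H.is_group del: sym_group_inv_equality)
    fix g assume g: "g \<in> carrier F2"
    have "gt_end (m, f) (eta F2 g) = theta g"
      unfolding gt_end_eq using g by (rule cont_ext_profinite_eta[OF F2_group theta_props(1)])
    then show "shadow_twist d m1 f1 \<psi> g = (\<lambda>g \<in> carrier F2. hat_ext d \<psi> (gt_end (m, f) (eta F2 g))) g"
      using g ext_theta[OF assms(1) fin assms(2) f0 g] by (simp add: tw hat_ext_def)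
  qed simp
qed

section \<open>The GT-shadow conditions\<close>

lemma hexagons_quotient:
  fixes K Q q
  defines "K \<equiv> N_PB3 N" and "Q \<equiv> B 3 Mod K" and "q \<equiv> \<lambda>g. K #>\<^bsub>B 3\<^esub> g"
  shows "hexagons Q (q (sigma 3 1)) (q (sigma 3 2)) (q (xgen 3 1 2) [^]\<^bsub>Q\<^esub> m (N_ord N))
    (q (xgen 3 2 3) [^]\<^bsub>Q\<^esub> m (N_ord N)) (q cgen [^]\<^bsub>Q\<^esub> m (N_ord N)) (q (iota f0))"
proof -
  have K: "K \<in> fin_normal (B 3)" unfolding K_def using NFI by (rule N_PB3_fin_normal)
  interpret K: normal K "B 3" using K by (rule fin_normalD)
  let ?h = "\<lambda>g. eta (B 3) (iota g)"
  have h: "?h \<in> hom F2 (profinite (B 3))"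
  proof (rule homI)
    fix x y assume "x \<in> carrier F2" "y \<in> carrier F2"
    then show "?h (x \<otimes>\<^bsub>F2\<^esub> y) = ?h x \<otimes>\<^bsub>profinite (B 3)\<^esub> ?h y"
      using hom_mult[OF iota_hom, of x y] hom_mult[OF B.eta_hom] by (simp add: PBD)
  qed (simp add: PBD)
  let ?f = "cont_ext F2 (profinite (B 3)) (profinite_top (B 3)) ?h f"
  have f_closed: "?f \<in> carrier (profinite (B 3))"
    using cont_ext_profinite_hom[OF F2_group h] gt_pair(2) by (rule hom_in_carrier)
  have fK: "?f K = q (iota f0)"
  proof -
    have "?f K = ?h f0 K"
    proof (rule cont_ext_profinite_eq[OF F2_group h gt_pair(2) N_F2_fin_normal[OF NFI] K _ f0])
      fix a assume "a \<in> N_F2 N"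
      then show "?h a K = K"
        using K B.coset_join2[OF _ K.subgroup_axioms] by (simp add: N_F2_def eta_apply PBD K_def)
    qed
    then show ?thesis using K by (simp add: eta_apply q_def)
  qed
  have pw: "prof_pow (B 3) (eta (B 3) g) m K = q g [^]\<^bsub>Q\<^esub> m (N_ord N)"
    "prof_pow (B 3) (eta (B 3) g) m \<in> carrier (profinite (B 3))"
    if g: "g \<in> {xgen 3 1 2, xgen 3 2 3, cgen}" for g
  proof -
    have gB: "g \<in> carrier (B 3)" using g by (auto simp: PBD)
    show "prof_pow (B 3) (eta (B 3) g) m K = q g [^]\<^bsub>Q\<^esub> m (N_ord N)"
      using B.prof_pow_eta_eq[OF gt_pair(1) K gB _ N_ord_pos[OF NFI]] N_ord_pow[OF NFI g] gB
      by (simp add: K_def[symmetric] Q_def q_def K.FactGroup_int_pow)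
    show "prof_pow (B 3) (eta (B 3) g) m \<in> carrier (profinite (B 3))"
      using gt_pair(1) gB by (rule B.prof_pow_closed)
  qed
  have "hexagons (B 3 Mod K) (eta (B 3) (sigma 3 1) K) (eta (B 3) (sigma 3 2) K)
     (prof_pow (B 3) (eta (B 3) (xgen 3 1 2)) m K) (prof_pow (B 3) (eta (B 3) (xgen 3 2 3)) m K)
     (prof_pow (B 3) (eta (B 3) cgen) m K) (?f K)"
    by (rule hexagons_hom[OF profinite_eval_group_hom[OF K] gt_pair(3)])
      (simp_all add: f_closed pw(2))
  then show ?thesis
    using K by (simp add: fK pw(1) eta_apply Q_def q_def)
qed

text \<open>Since \<open>f\<close> has an inverse for the composition of the monoid, its image in the finite quotient
  lies in the image of \<open>h\<close>; this is the only obstruction to surjectivity.\<close>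

lemma shadow_hom_onto:
  fixes P p
  defines "P \<equiv> PBgrp 3 Mod N_PB3 N" and "p \<equiv> \<lambda>g. N_PB3 N #>\<^bsub>PBgrp 3\<^esub> g"
  assumes h: "h \<in> hom (PBgrp 3) P"
    and hx: "h (xgen 3 1 2) = p (xgen 3 1 2) [^]\<^bsub>P\<^esub> e"
    and hy: "h (xgen 3 2 3) = inv\<^bsub>P\<^esub> p (iota f0) \<otimes>\<^bsub>P\<^esub> p (xgen 3 2 3) [^]\<^bsub>P\<^esub> e \<otimes>\<^bsub>P\<^esub> p (iota f0)"
    and hc: "h cgen = p cgen [^]\<^bsub>P\<^esub> e"
  shows "h ` PB 3 = carrier P"
proof -
  have K: "N_PB3 N \<in> fin_normal (PBgrp 3)" using NFI by (rule N_PB3_fin_normal_PB)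
  interpret K: normal "N_PB3 N" "PBgrp 3" using K by (rule fin_normalD)
  interpret P: group P unfolding P_def by (rule K.factorgroup_is_group)
  have fin: "finite (carrier P)" unfolding P_def using K by (rule fin_normalD)
  interpret p: group_hom "PBgrp 3" P p
    unfolding group_hom_def group_hom_axioms_def P_def p_def
    by (intro conjI PBgrp_group K.r_coset_hom_Mod K.factorgroup_is_group)
  interpret h: group_hom "PBgrp 3" P h
    using h by (simp add: group_hom_def group_hom_axioms_def P.is_group)
  let ?q = "\<lambda>g. p (iota g)"
  have q: "group_hom F2 P ?q"
    unfolding P_def p_def using NFI by (rule quot_iota_group_hom)
  interpret q: group_hom F2 P ?q by (rule q)
  let ?J = "h ` PB 3"
  have J: "subgroup ?J P" using h.img_is_subgroup by simp
  interpret J: subgroup ?J P by (rule J)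
  \<comment> \<open>The exponent \<open>e\<close> is invertible modulo \<open>N_ord N\<close>, which
    annihilates these cosets, so each is a power of its own \<open>e\<close>-th power.\<close>
  have pow: "p g \<in> ?J" if "p g [^]\<^bsub>P\<^esub> e \<in> ?J" and g: "g \<in> {xgen 3 1 2, xgen 3 2 3, cgen}" for g
  proof -
    have gPB: "g \<in> PB 3" using g by auto
    obtain k where k: "(e * k) mod int (N_ord N) = 1 mod int (N_ord N)" using e_unit by blast
    have "p g [^]\<^bsub>P\<^esub> N_ord N = p (g [^]\<^bsub>PBgrp 3\<^esub> N_ord N)" using p.hom_nat_pow[of g "N_ord N"] gPB by simp
    also have "\<dots> = \<one>\<^bsub>P\<^esub>"
      using N_ord_pow[OF NFI g] PB.coset_join2[OF _ K.subgroup_axioms, of "g [^]\<^bsub>B 3\<^esub> N_ord N"]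
        subsetD[OF N_PB3_sub[OF NFI]]
      by (simp add: p_def P_def)
    finally have "int (P.ord (p g)) dvd int (N_ord N)" using P.pow_eq_id gPB by simp
    then have "int (P.ord (p g)) dvd 1 - e * k" using k by (metis dvd_trans mod_eq_dvd_iff)
    then have "p g [^]\<^bsub>P\<^esub> (e * k) = p g [^]\<^bsub>P\<^esub> (1 :: int)" using P.int_pow_eq[of "p g" "e * k" 1] gPB by simp
    then have "(p g [^]\<^bsub>P\<^esub> e) [^]\<^bsub>P\<^esub> k = p g" using gPB by (simp add: P.int_pow_pow)
    then show ?thesis using P.subgroup_int_pow_closed[OF J that(1), of k] by simp
  qed
  let ?qhat = "cont_ext F2 P (discrete_topology (carrier P)) ?q"
  have qhat: "group_hom F2hat P ?qhat"
    using q.cont_ext_finite_hom[OF fin] by (simp add: group_hom_def group_hom_axioms_def P.is_group F2hat.is_group)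
  interpret qhat: group_hom F2hat P ?qhat by (rule qhat)
  have L: "N_F2 N \<in> fin_normal F2" using NFI by (rule N_F2_fin_normal)
  have ker: "N_F2 N \<subseteq> kernel F2 P ?q" unfolding P_def p_def N_F2_kernel[OF NFI] by simp
  have qhat_eq: "?qhat u = ?q g" if "u \<in> carrier F2hat" "g \<in> u (N_F2 N)" for u g
    using q.cont_ext_finite_eq[OF fin that(1) L ker that(2)] .
  have qhat_theta: "?qhat (theta g) = h (iota g)" if g: "g \<in> carrier F2" for g
  proof -
    have "(\<lambda>g. h (iota g)) \<in> hom F2 P" using hom_compose[OF iota_hom h] by (simp add: o_def)
    then have "restrict (\<lambda>g. h (iota g)) (carrier F2) \<in> hom F2 P" by (auto simp: hom_def)
    then have "F2_hom P (?q (F2x [^]\<^bsub>F2\<^esub> e)) (?q (inv\<^bsub>F2\<^esub> f0 \<otimes>\<^bsub>F2\<^esub> F2y [^]\<^bsub>F2\<^esub> e \<otimes>\<^bsub>F2\<^esub> f0))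
        = restrict (\<lambda>g. h (iota g)) (carrier F2)"
      using hx hy q.hom_int_pow[of F2x e] q.hom_int_pow[of F2y e] q.hom_mult q.hom_inv[of f0] P.is_group
      by (intro F2_hom_eqI) simp_all
    then show ?thesis using ext_theta[OF q fin ker f0 g] g by simp
  qed
  have F: "p (iota f0) \<in> ?J"
  proof -
    obtain m' f' where f': "f' \<in> carrier F2hat" "f \<otimes>\<^bsub>F2hat\<^esub> gt_end (m, f) f' = \<one>\<^bsub>F2hat\<^esub>"
      by (rule inverse_pair)
    let ?E = "gt_end (m, f)"
    have Ef: "?E f' \<in> carrier F2hat"
      unfolding gt_end_eq using cont_ext_profinite_hom[OF F2_group theta_props(1)] f'(1) by (rule hom_in_carrier)
    have th: "group_hom F2 (F2 Mod N_F2 N) (\<lambda>a. theta a (N_F2 N))"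
      using hom_compose[OF theta_props(1) profinite_eval_hom[OF L]] fin_normalD(4)[OF L]
      by (simp add: group_hom_def group_hom_axioms_def o_def)
    \<comment> \<open>Approximating f' modulo \<open>N_F2 N\<close> may be too coarse: the image of
      f' modulo \<open>N_F2 N\<close> is controlled by f' modulo the kernel of theta followed by
      reduction.\<close>
    let ?L = "kernel F2 (F2 Mod N_F2 N) (\<lambda>a. theta a (N_F2 N))"
    have "finite ((\<lambda>a. theta a (N_F2 N)) ` carrier F2)"
      using hom_carrier[OF group_hom.homh[OF th]] fin_normalD(2)[OF L] by (rule finite_subset)
    then have L': "?L \<in> fin_normal F2" by (rule group_hom.kernel_fin_normal[OF th])
    obtain g0 where g0: "g0 \<in> carrier F2" "g0 \<in> f' ?L" using F2.profinite_rep[OF f'(1) L'] .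
    have "?E f' (N_F2 N) = theta g0 (N_F2 N)"
      unfolding gt_end_eq
      by (rule cont_ext_profinite_eq[OF F2_group theta_props(1) f'(1) L' L _ g0(2)]) (simp add: kernel_def)
    moreover obtain t where "t \<in> ?E f' (N_F2 N)" using F2.profinite_rep[OF Ef L] .
    ultimately have "?qhat (?E f') = ?qhat (theta g0)"
      using qhat_eq[OF Ef] qhat_eq[of "theta g0"] hom_in_carrier[OF theta_props(1) g0(1)] by metis
    then have "?qhat (?E f') = h (iota g0)" using qhat_theta[OF g0(1)] by simp
    moreover have "?qhat f \<otimes>\<^bsub>P\<^esub> ?qhat (?E f') = \<one>\<^bsub>P\<^esub>"
      using qhat.hom_mult[OF gt_pair(2) Ef] f'(2) by simp
    moreover have "?qhat f = p (iota f0)" using qhat_eq[OF gt_pair(2) f0] .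
    ultimately have "p (iota f0) = inv\<^bsub>P\<^esub> h (iota g0)"
      using g0 by (metis P.inv_equality f0_closed h.hom_closed iota_closed p.hom_closed PBgrp_simps(1))
    then show ?thesis using g0 J.m_inv_closed by simp
  qed
  have x: "p (xgen 3 1 2) \<in> ?J" using pow hx by (metis imageI insertCI xgen_3_PB(1))
  have c: "p cgen \<in> ?J" using pow hc by (metis cgen_PB imageI insertCI)
  \<comment> \<open>Conjugating h at x_23 by the image of f0 undoes the conjugation in hy and leaves
    the \<open>e\<close>-th power of the class of x_23; F keeps this inside the image of h.\<close>
  have y: "p (xgen 3 2 3) \<in> ?J"
  proof (rule pow)
    have "p (iota f0) \<otimes>\<^bsub>P\<^esub> h (xgen 3 2 3) \<otimes>\<^bsub>P\<^esub> inv\<^bsub>P\<^esub> p (iota f0) \<in> ?J"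
      using F by (intro J.m_closed J.m_inv_closed) auto
    moreover have "p (iota f0) \<otimes>\<^bsub>P\<^esub> h (xgen 3 2 3) \<otimes>\<^bsub>P\<^esub> inv\<^bsub>P\<^esub> p (iota f0) = p (xgen 3 2 3) [^]\<^bsub>P\<^esub> e"
      unfolding hy by (simp add: P.m_assoc)
    ultimately show "p (xgen 3 2 3) [^]\<^bsub>P\<^esub> e \<in> ?J" by simp
  qed simp
  have z: "p (xgen 3 1 3) \<in> ?J"
  proof -
    have "p cgen = p (xgen 3 2 3) \<otimes>\<^bsub>P\<^esub> p (xgen 3 1 2) \<otimes>\<^bsub>P\<^esub> p (xgen 3 1 3)"
      using p.hom_mult PB.m_closed[of _ 3] by (simp add: cgen_def)
    then have "p (xgen 3 1 3) = inv\<^bsub>P\<^esub> p (xgen 3 1 2) \<otimes>\<^bsub>P\<^esub> (inv\<^bsub>P\<^esub> p (xgen 3 2 3) \<otimes>\<^bsub>P\<^esub> p cgen)"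
      by (simp add: P.m_assoc)
    then show ?thesis using x y c by (simp only:) (intro J.m_closed J.m_inv_closed)
  qed
  have sub: "subgroup {g \<in> carrier (PBgrp 3). p g \<in> ?J} (PBgrp 3)"
  proof
    fix x y assume "x \<in> {g \<in> carrier (PBgrp 3). p g \<in> ?J}" "y \<in> {g \<in> carrier (PBgrp 3). p g \<in> ?J}"
    then show "x \<otimes>\<^bsub>PBgrp 3\<^esub> y \<in> {g \<in> carrier (PBgrp 3). p g \<in> ?J}"
      using p.hom_mult[of x y] J.m_closed PB.m_closed[of x 3 y] by simp
  next
    fix x assume "x \<in> {g \<in> carrier (PBgrp 3). p g \<in> ?J}"
    then show "inv\<^bsub>PBgrp 3\<^esub> x \<in> {g \<in> carrier (PBgrp 3). p g \<in> ?J}"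
      using p.hom_inv[of x] J.m_inv_closed PB.inv_closed[of x 3] by (simp del: inv_PBgrp)
  qed (use J.one_closed p.hom_one PB.one_closed in auto)
  have "PB 3 \<subseteq> {g \<in> carrier (PBgrp 3). p g \<in> ?J}"
    using PB.generate_subgroup_incl[OF _ sub, of "{xgen 3 1 2, xgen 3 2 3, xgen 3 1 3}"] x y z
    by (simp add: PB3_generated)
  then show ?thesis
    using J.subset by (auto simp: P_def p_def carrier_FactGroup)
qed

lemma is_GT_pair_f0: "is_GT_pair N (m (N_ord N)) f0"
proof -
  let ?K = "N_PB3 N" and ?P = "PBgrp 3 Mod N_PB3 N" and ?p = "\<lambda>g. N_PB3 N #>\<^bsub>PBgrp 3\<^esub> g"
  have K: "?K \<in> fin_normal (PBgrp 3)" using NFI by (rule N_PB3_fin_normal_PB)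
  interpret K: normal ?K "PBgrp 3" using K by (rule fin_normalD)
  interpret P: group ?P by (rule K.factorgroup_is_group)
  interpret p: group_hom "PBgrp 3" ?P ?p
    unfolding group_hom_def group_hom_axioms_def
    by (intro conjI PBgrp_group K.r_coset_hom_Mod P.is_group)
  let ?a = "?p (xgen 3 1 2) [^]\<^bsub>?P\<^esub> e" and ?c = "?p cgen [^]\<^bsub>?P\<^esub> e"
    and ?b = "inv\<^bsub>?P\<^esub> ?p (iota f0) \<otimes>\<^bsub>?P\<^esub> ?p (xgen 3 2 3) [^]\<^bsub>?P\<^esub> e \<otimes>\<^bsub>?P\<^esub> ?p (iota f0)"
  have pc: "?p g \<in> carrier ?P" if "g \<in> PB 3" for g
    using p.hom_closed[of g] that by simp
  \<comment> \<open>The class of c stays central in the quotient, which is what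
    \<open>PB3_hom_exists\<close> requires for the homomorphism of condition (iv) to exist.\<close>
  have central: "y \<otimes>\<^bsub>?P\<^esub> ?c = ?c \<otimes>\<^bsub>?P\<^esub> y" if y: "y \<in> carrier ?P" for y
  proof -
    obtain g where g: "g \<in> PB 3" "y = ?p g" using y by (auto simp: carrier_FactGroup)
    have "?p (cgen \<otimes>\<^bsub>PBgrp 3\<^esub> g) = ?p (g \<otimes>\<^bsub>PBgrp 3\<^esub> cgen)"
      using cgen_central[of g] g by (simp add: PBD)
    then have "?p cgen \<otimes>\<^bsub>?P\<^esub> y = y \<otimes>\<^bsub>?P\<^esub> ?p cgen"
      using p.hom_mult[of cgen g] p.hom_mult[of g cgen] g by (simp del: mult_FactGroup PBgrp_simps(2-))
    then show ?thesis
      using P.int_pow_commute[OF pc[OF cgen_PB] y] by metis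
  qed
  have abc: "?a \<in> carrier ?P" "?b \<in> carrier ?P" "?c \<in> carrier ?P"
    by (intro P.int_pow_closed P.m_closed P.inv_closed pc iota_closed f0_closed xgen_3_PB cgen_PB)+
  obtain h where h: "h \<in> hom (PBgrp 3) ?P" "h (xgen 3 1 2) = ?a" "h (xgen 3 2 3) = ?b" "h cgen = ?c"
    using PB3_hom_exists[OF P.is_group abc central[OF abc(1)] central[OF abc(2)]] by blast
  have onto: "h ` PB 3 = carrier ?P" using h by (rule shadow_hom_onto)
  have "pentagon (PBgrp 4 Mod N) (\<lambda>\<phi>. N #>\<^bsub>PBgrp 4\<^esub> \<phi> (iota f0))"
  proof -
    have N: "N \<in> fin_normal (PBgrp 4)" using NFI by (rule N_fin_normal_PB)
    interpret N: normal N "PBgrp 4" using N by (rule fin_normalD)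
    have "N #>\<^bsub>B 4\<^esub> (cab.run 0 (iota f0) \<otimes>\<^bsub>B 4\<^esub> cab.run 2 (iota f0) \<otimes>\<^bsub>B 4\<^esub> cab.run 4 (iota f0))
      = N #>\<^bsub>B 4\<^esub> (cab.run 3 (iota f0) \<otimes>\<^bsub>B 4\<^esub> cab.run 1 (iota f0))"
      by (rule pentagon_quotient[OF N N_F2_fin_normal[OF NFI] _ f0])
        (simp add: N_F2_def N_PB3_phi[OF NFI])
    then have eq: "N #>\<^bsub>PBgrp 4\<^esub> (cab.run 0 (iota f0) \<otimes>\<^bsub>PBgrp 4\<^esub> cab.run 2 (iota f0) \<otimes>\<^bsub>PBgrp 4\<^esub> cab.run 4 (iota f0))
      = N #>\<^bsub>PBgrp 4\<^esub> (cab.run 3 (iota f0) \<otimes>\<^bsub>PBgrp 4\<^esub> cab.run 1 (iota f0))"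
      by simp
    have c: "cab.run q (iota f0) \<in> carrier (PBgrp 4)" if "q \<le> 4" for q
      using that by (simp add: cab_PB4)
    show ?thesis
      using eq c PB.m_closed[of _ 4] phi_eq[OF iota_closed[OF f0_closed]]
      by (simp add: pentagon_def N.rcos_sum del: PBgrp_simps)
  qed
  then show ?thesis
    unfolding is_GT_pair_def Let_def
    using hexagons_quotient e_unit h onto f0_closed by blast
qed

end

lemma shadow_of_GT: "shadow_of N (m, f) \<in> GT N"
proof -
  obtain f0 where "f0 \<in> f (N_F2 N)" using F2.profinite_rep[OF gt_pair(2) N_F2_fin_normal[OF NFI]] .
  then show ?thesis using shadow_of_eq is_GT_pair_f0 by (auto simp: GT_def)
qed

text \<open>The pentagon relation forces the exponent sums of \<open>f\<close> to vanish modulo every \<open>n\<close>, because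
  it can be evaluated on the linking numbers of the strands 1, 2 and of the strands 3, 4.\<close>

lemma shadow_of_charming: "charming N (shadow_of N (m, f))"
proof -
  let ?n = "order (F2 Mod N_F2 N)"
  let ?A = "{g \<in> carrier F2. int ?n dvd expo_x g \<and> int ?n dvd expo_y g}"
  have L: "N_F2 N \<in> fin_normal F2" using NFI by (rule N_F2_fin_normal)
  have n: "0 < ?n" by (rule F2.FactGroup_pow_eq_one(1)[OF L F2.one_closed])
  have A: "?A \<in> fin_normal F2" using expo_hom n by (rule F2.fin_normal_dvd)
  \<comment> \<open>One f0 must approximate f modulo both subgroups: modulo the first it represents
    the shadow, modulo the second its exponent sums are controlled.\<close>
  have LA: "N_F2 N \<inter> ?A \<in> fin_normal F2" using L A by (rule F2.fin_normal_Int)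
  obtain f0 where f0: "f0 \<in> f (N_F2 N \<inter> ?A)" using F2.profinite_rep[OF gt_pair(2) LA] .
  have f0L: "f0 \<in> f (N_F2 N)" using profinite_mono[OF gt_pair(2) LA L] f0 by blast
  have f0A: "f0 \<in> f ?A" using profinite_mono[OF gt_pair(2) LA A] f0 by blast
  have f0F: "f0 \<in> carrier F2" using F2.profinite_mem(2)[OF gt_pair(2) L L _ f0L] by simp
  have "N_F2 N #>\<^bsub>F2\<^esub> f0 \<in> derived (F2 Mod N_F2 N) (carrier (F2 Mod N_F2 N))"
    using expo_dvd[OF n f0A] by (rule F2_mod_derived[OF L f0F])
  moreover have "(m (N_ord N), f0) \<in> shadow_reps N (shadow_of N (m, f))"
    using f0F shadow_of_eq[OF f0L] by (simp add: shadow_reps_def)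
  ultimately show ?thesis unfolding charming_def by blast
qed

section \<open>Equality of the two actions on drawings\<close>

lemma conj_class_hom:
  assumes "transitive_hom d \<psi>0" "N_F2 N \<subseteq> kernel F2 (sym_group d) \<psi>0" "\<psi> \<in> conj_class d \<psi>0"
  shows "group_hom F2 (sym_group d) \<psi>" "N_F2 N \<subseteq> kernel F2 (sym_group d) \<psi>"
proof -
  interpret S: group "sym_group d" by (rule sym_group_is_group)
  interpret \<psi>0: group_hom F2 "sym_group d" \<psi>0
    using assms(1) by (simp add: transitive_hom_def group_hom_def group_hom_axioms_def S.is_group)
  obtain p where p: "p \<in> carrier (sym_group d)"
    and \<psi>: "\<psi> = (\<lambda>g \<in> carrier F2. p \<otimes>\<^bsub>sym_group d\<^esub> \<psi>0 g \<otimes>\<^bsub>sym_group d\<^esub> inv\<^bsub>sym_group d\<^esub> p)"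
    using assms(3) by (auto simp: conj_class_def)
  have "\<psi> \<in> hom F2 (sym_group d)"
    by (rule homI) (use p in \<open>simp_all add: \<psi> S.m_assoc del: sym_group_inv_equality\<close>)
  then show "group_hom F2 (sym_group d) \<psi>"
    by (simp add: group_hom_def group_hom_axioms_def S.is_group)
  show "N_F2 N \<subseteq> kernel F2 (sym_group d) \<psi>"
    using assms(2) p by (auto simp: kernel_def \<psi> simp del: sym_group_inv_equality)
qed

lemma GThat_act_eq: "GThat_act N (m, f) = shadow_act N (shadow_of N (m, f))"
  unfolding GThat_act_def shadow_act_def
proof (rule restrict_ext)
  fix D assume "D \<in> Dessin N"
  then obtain d \<psi>0 where D: "D = (d, conj_class d \<psi>0)"
    and \<psi>0: "transitive_hom d \<psi>0" "N_F2 N \<subseteq> kernel F2 (sym_group d) \<psi>0"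
    by (auto simp: Dessin_def)
  obtain f0 where f0: "f0 \<in> f (N_F2 N)"
    using F2.profinite_rep[OF gt_pair(2) N_F2_fin_normal[OF NFI]] .
  let ?s = "shadow_of N (m, f)"
  have rep: "(m (N_ord N), f0) \<in> shadow_reps N ?s"
    using f0_closed[OF f0] shadow_of_eq[OF f0] by (simp add: shadow_reps_def)
  have "(\<Union>(m1, f1)\<in>shadow_reps N ?s. conj_class d (shadow_twist d m1 f1 \<psi>))
      = conj_class d (\<lambda>g \<in> carrier F2. hat_ext d \<psi> (gt_end (m, f) (eta F2 g)))"
    if \<psi>: "\<psi> \<in> conj_class d \<psi>0" for \<psi>
  proof -
    have "(\<Union>(m1, f1)\<in>shadow_reps N ?s. conj_class d (shadow_twist d m1 f1 \<psi>))
        = (\<Union>_\<in>shadow_reps N ?s. conj_class d (\<lambda>g \<in> carrier F2. hat_ext d \<psi> (gt_end (m, f) (eta F2 g))))"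
      using shadow_twist_eq[OF f0 conj_class_hom[OF \<psi>0 \<psi>]] by (intro SUP_cong refl) auto
    \<comment> \<open>A union of a constant family is its value only over a nonempty index set,
      hence the need for \<open>rep\<close>.\<close>
    also have "\<dots> = conj_class d (\<lambda>g \<in> carrier F2. hat_ext d \<psi> (gt_end (m, f) (eta F2 g)))"
      using rep by blast
    finally show ?thesis .
  qed
  then show "(case D of (d, C) \<Rightarrow> (d, \<Union>\<psi>\<in>C. conj_class d (\<lambda>g \<in> carrier F2. hat_ext d \<psi> (gt_end (m, f) (eta F2 g)))))
      = (case D of (d, C) \<Rightarrow> (d, \<Union>\<psi>\<in>C. \<Union>(m, f)\<in>shadow_reps N ?s. conj_class d (shadow_twist d m f \<psi>)))"
    by (simp add: D)
qed

end

theorem theorem3p2: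
  shows "\<A> = \<A>sh \<circ>\<^sub>F PR"
proof -
  have "farr \<A> U V T = farr (\<A>sh \<circ>\<^sub>F PR) U V T" for U V T
  \<comment> \<open>Off the hom-set both sides are \<open>undefined\<close>, so only arrows remain
    to be compared.\<close>
  proof (cases "T \<in> Arr GThat_NFI U V")
    case True
    obtain m f where T: "T = (m, f)" by force
    have V: "V \<in> NFI" "(m, f) \<in> carrier GThat" and U: "U \<in> NFI" "source V (shadow_of V T) = U"
      using True by (auto simp: GThat_NFI_def T)
    \<comment> \<open>This membership gives the composite its intended value at T, since
      \<open>\<A>sh\<close> is restricted to the arrows of \<open>GTSh_heart\<close>.\<close>
    then have "shadow_of V T \<in> Arr GTSh_heart U V"
      using shadow_of_GT[OF V] shadow_of_charming[OF V] by (simp add: GTSh_heart_def T)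
    moreover have "U \<in> Ob GThat_NFI" "V \<in> Ob GThat_NFI"
      using U V by (simp_all add: GThat_NFI_def)
    ultimately show ?thesis
      using True GThat_act_eq[OF V] by (simp add: functor_comp_def \<A>_def \<A>sh_def PR_def T)
  qed (simp add: functor_comp_def \<A>_def PR_def)
  moreover have "fob \<A> U = fob (\<A>sh \<circ>\<^sub>F PR) U" for U
    by (simp add: functor_comp_def \<A>_def \<A>sh_def PR_def restrict_def)
      (simp add: GThat_NFI_def GTSh_heart_def)
  ultimately show ?thesis
    by (intro functor_data.equality ext) (simp_all add: functor_comp_def \<A>_def \<A>sh_def PR_def)
qed

end
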